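(* Let $G$ be a finite group, let $C_G$ be a $G$-crossed braided extension of a modular tensor category $C$ with 0-form symmetry $G$, and let $C^G$ be the modular tensor category obtained by gauging $G$. For every $q\in\mathrm{Gal}(K_{C_G})$ there exists $q'\in\mathrm{Gal}(K_{C^G})$ such that $$(q(C_G))^G=q'(C^G),$$ where $(q(C_G))^G$ denotes the theory obtained by gauging the $G$ symmetry after the Galois action on $C_G$.
   Context: A modular tensor category (MTC) is described, after choosing bases of the fusion spaces $V_{ab}^c$ (such a choice is called a gauge), by its $F$ symbols (associativity matrices), $R$ symbols (braiding matrices) and pivotal coefficients $\epsilon_a\in\{\pm1\}$. There is always a gauge in which all entries lie in a number field. The defining Galois field $K_{C^G}$ of the MTC $C^G$ is the normal closure over $\mathbb{Q}$ of the field generated by its $F$ and $R$ symbols, and for $q'\in\mathrm{Gal}(K_{C^G}/\mathbb{Q})$, $q'(C^G)$ is the MTC with the same simple objects and fusion rules and with data $q'(F),q'(R)$. Given an MTC $C$ with an action of a finite group $G$ with vanishing obstructions, a $G$-crossed braided extension is a faithfully $G$-graded fusion category $C_G=\oplus_{g\in G}C_g$ with $C_e=C$, a $G$-action, and a $G$-crossed braiding $c_{x,y}:x\otimes y\to g(y)\otimes x$ for $x\in C_g$. Gauging $G$ means passing to the MTC $C^G$ of $G$-equivariant objects of $C_G$. The field $K_{C_G}$ is the Galois (normal) closure over $\mathbb{Q}$ of the number field generated, in a suitable gauge, by the defining data of $C_G$ ($F$ symbols, $G$-crossed $R$ symbols, and the phases/matrices specifying the $G$-action), and for $q\in\mathrm{Gal}(K_{C_G}/\mathbb{Q})$,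 $q(C_G)$ is the $G$-crossed braided category with the same simple objects and fusion rules and with $q$ applied to all of this data. Equality of MTCs means equivalence. *)

theory Defs
  imports
    Complex_Main
    "HOL-Algebra.Algebraic_Closure_Type"
    "HOL-Algebra.Generated_Fields"
    "HOL-Algebra.Embedded_Algebras"
begin

no_notation var ("X\<index>")  (* polynomial variable; X is used for objects below *)

section \<open>Number fields inside the complex numbers\<close>

abbreviation CC :: "complex ring" where
  "CC \<equiv> ring_of_type_algebra"

definition number_field :: "complex set \<Rightarrow> bool" where
  "number_field K \<longleftrightarrow> subfield K CC \<and> ring.finite_dimension CC \<rat> K"

definition normal_over_rat :: "complex set \<Rightarrow> bool" where
  "normal_over_rat L \<longleftrightarrow>
     subfield L CC \<and> (\<forall>x\<in>L. algebraic x) \<and>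
     (\<forall>p :: rat poly. Factorial_Ring.irreducible p \<and> (\<exists>x\<in>L. poly (map_poly of_rat p) x = 0)
        \<longrightarrow> (\<forall>y. poly (map_poly of_rat p) y = 0 \<longrightarrow> y \<in> L))"

definition normal_closure :: "complex set \<Rightarrow> complex set" where
  "normal_closure K = \<Inter>{L. normal_over_rat L \<and> K \<subseteq> L}"

text \<open>Only the values of an element of \<open>Gal K\<close> on \<open>K\<close> matter; off \<open>K\<close> the function is arbitrary.\<close>

definition Gal :: "complex set \<Rightarrow> (complex \<Rightarrow> complex) set" where
  "Gal K = {q \<in> ring_iso (CC\<lparr>carrier := K\<rparr>) (CC\<lparr>carrier := K\<rparr>). \<forall>x\<in>\<rat>. q x = x}"


section \<open>Skeletal data\<close>

text \<open>
  Data of a fusion category in a gauge, i.e. after choosing for all labels \<open>a, b, c\<close> a basis of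
  \<open>V_ab^c = Hom(c, a \<otimes> b)\<close>, numbered by the \<open>\<mu> < fus a b c\<close>. The entry
  \<open>Fsym a b c d (e, \<mu>, \<nu>) (f, \<rho>, \<sigma>)\<close> belongs to the basis vectors \<open>\<mu> \<in> V_ab^e\<close>, \<open>\<nu> \<in> V_ec^d\<close> of
  \<open>Hom(d, (a \<otimes> b) \<otimes> c)\<close> and \<open>\<rho> \<in> V_bc^f\<close>, \<open>\<sigma> \<in> V_af^d\<close> of \<open>Hom(d, a \<otimes> (b \<otimes> c))\<close>.
  Entries with an index out of range carry no meaning and are never used. \<open>piv\<close> are the
  pivotal coefficients.
\<close>

record 'a fusion_data =
  lab :: "'a set"
  vac :: 'a
  dua :: "'a \<Rightarrow> 'a"
  fus :: "'a \<Rightarrow> 'a \<Rightarrow> 'a \<Rightarrow> nat"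
  Fsym :: "'a \<Rightarrow> 'a \<Rightarrow> 'a \<Rightarrow> 'a \<Rightarrow> 'a \<times> nat \<times> nat \<Rightarrow> 'a \<times> nat \<times> nat \<Rightarrow> complex"
  piv :: "'a \<Rightarrow> complex"

record 'a mtc_data = "'a fusion_data" +
  Rsym :: "'a \<Rightarrow> 'a \<Rightarrow> 'a \<Rightarrow> nat \<Rightarrow> nat \<Rightarrow> complex"

text \<open>
  \<open>grd\<close> is the grading and \<open>act\<close> the permutation of labels by the group. \<open>Xsym a b c\<close> is the matrix
  of \<open>c_{a,b} : a \<otimes> b \<rightarrow> g(b) \<otimes> a\<close> (where \<open>g = grd a\<close>) on the \<open>c\<close>-components; \<open>Usym g a b c\<close> that of
  \<open>g(x \<otimes> y) \<rightarrow> a \<otimes> b\<close> on the \<open>c\<close>-components, where \<open>a = g(x)\<close> and \<open>b = g(y)\<close>; and \<open>eta a g h\<close> is the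
  scalar by which \<open>g(h(x)) \<rightarrow> (gh)(x)\<close> acts, where \<open>a = (gh)(x)\<close>.
\<close>

record ('a, 'g) crossed_data = "'a fusion_data" +
  grd :: "'a \<Rightarrow> 'g"
  act :: "'g \<Rightarrow> 'a \<Rightarrow> 'a"
  Xsym :: "'a \<Rightarrow> 'a \<Rightarrow> 'a \<Rightarrow> nat \<Rightarrow> nat \<Rightarrow> complex"
  Usym :: "'g \<Rightarrow> 'a \<Rightarrow> 'a \<Rightarrow> 'a \<Rightarrow> nat \<Rightarrow> nat \<Rightarrow> complex"
  eta :: "'a \<Rightarrow> 'g \<Rightarrow> 'g \<Rightarrow> complex"

definition F_entries :: "('a, 'z) fusion_data_scheme \<Rightarrow> complex set" where
  "F_entries D = {Fsym D a b c d (e, \<mu>, \<nu>) (f, \<rho>, \<sigma>) | a b c d e f \<mu> \<nu> \<rho> \<sigma>.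
     {a, b, c, d, e, f} \<subseteq> lab D \<and>
     \<mu> < fus D a b e \<and> \<nu> < fus D e c d \<and> \<rho> < fus D b c f \<and> \<sigma> < fus D a f d}"

definition mtc_entries :: "'a mtc_data \<Rightarrow> complex set" where
  "mtc_entries M = F_entries M \<union>
     {Rsym M a b c \<mu> \<nu> | a b c \<mu> \<nu>.
        {a, b, c} \<subseteq> lab M \<and> \<mu> < fus M a b c \<and> \<nu> < fus M b a c}"

definition crossed_entries :: "('g, 'y) monoid_scheme \<Rightarrow> ('a, 'g) crossed_data \<Rightarrow> complex set" where
  "crossed_entries G D = F_entries D \<union>
     {Xsym D a b c \<mu> \<nu> | a b c \<mu> \<nu>.
        {a, b, c} \<subseteq> lab D \<and> \<mu> < fus D a b c \<and> \<nu> < fus D (act D (grd D a) b) a c} \<union>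
     {Usym D g (act D g a) (act D g b) (act D g c) \<mu> \<nu> | g a b c \<mu> \<nu>.
        g \<in> carrier G \<and> {a, b, c} \<subseteq> lab D \<and> \<mu> < fus D a b c \<and>
        \<nu> < fus D (act D g a) (act D g b) (act D g c)} \<union>
     {eta D a g h | a g h. a \<in> lab D \<and> g \<in> carrier G \<and> h \<in> carrier G}"

definition mtc_field :: "'a mtc_data \<Rightarrow> complex set" where
  "mtc_field M = generate_field CC (mtc_entries M)"

definition crossed_field :: "('g, 'y) monoid_scheme \<Rightarrow> ('a, 'g) crossed_data \<Rightarrow> complex set" where
  "crossed_field G D = generate_field CC (crossed_entries G D)"

text \<open>The pivotal coefficients will be required to be \<open>\<plusminus>1\<close>, so they are Galois invariant.\<close>

definition galois_mtc :: "(complex \<Rightarrow> complex) \<Rightarrow> 'a mtc_data \<Rightarrow> 'a mtc_data" where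
  "galois_mtc q M = M\<lparr>
     Fsym := (\<lambda>a b c d s t. q (Fsym M a b c d s t)),
     Rsym := (\<lambda>a b c \<mu> \<nu>. q (Rsym M a b c \<mu> \<nu>))\<rparr>"

definition galois_crossed ::
    "(complex \<Rightarrow> complex) \<Rightarrow> ('a, 'g) crossed_data \<Rightarrow> ('a, 'g) crossed_data" where
  "galois_crossed q D = D\<lparr>
     Fsym := (\<lambda>a b c d s t. q (Fsym D a b c d s t)),
     Xsym := (\<lambda>a b c \<mu> \<nu>. q (Xsym D a b c \<mu> \<nu>)),
     Usym := (\<lambda>g a b c \<mu> \<nu>. q (Usym D g a b c \<mu> \<nu>)),
     eta := (\<lambda>a g h. q (eta D a g h))\<rparr>"


section \<open>The semisimple category of a set of labels\<close>

text \<open>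
  An object is a formal direct sum of labels: \<open>X a\<close> is a finite set indexing the copies of the
  label \<open>a\<close> in \<open>X\<close>. A morphism is a family of complex matrices, \<open>f a j i\<close> being the entry from the
  \<open>i\<close>-th copy of \<open>a\<close> in the source to the \<open>j\<close>-th copy in the target. The copies of \<open>c\<close> in \<open>X \<otimes> Y\<close>
  are indexed by \<open>Node a b i j \<mu>\<close>: the \<open>\<mu>\<close>-th basis vector of \<open>V_ab^c\<close> at the \<open>i\<close>-th copy of \<open>a\<close> in
  \<open>X\<close> and the \<open>j\<close>-th copy of \<open>b\<close> in \<open>Y\<close>.
\<close>

datatype 'a tree = Leaf nat | Node 'a 'a "'a tree" "'a tree" nat

type_synonym 'a obj = "'a \<Rightarrow> 'a tree set"
type_synonym 'a mor = "'a \<Rightarrow> 'a tree \<Rightarrow> 'a tree \<Rightarrow> complex"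

definition objs :: "('a, 'z) fusion_data_scheme \<Rightarrow> 'a obj set" where
  "objs D = {X. (\<forall>a. finite (X a)) \<and> (\<forall>a. a \<notin> lab D \<longrightarrow> X a = {})}"

definition homs :: "'a obj \<Rightarrow> 'a obj \<Rightarrow> 'a mor set" where
  "homs X Y = {f. \<forall>a j i. f a j i \<noteq> 0 \<longrightarrow> i \<in> X a \<and> j \<in> Y a}"

definition mat :: "'a obj \<Rightarrow> 'a obj \<Rightarrow> 'a mor \<Rightarrow> 'a mor" where
  "mat X Y m = (\<lambda>a j i. if i \<in> X a \<and> j \<in> Y a then m a j i else 0)"

text \<open>Matrix product; the sum is over the support of a column of \<open>f\<close>, so that the intermediate
  object need not be mentioned.\<close>

definition cmp :: "'a mor \<Rightarrow> 'a mor \<Rightarrow> 'a mor" (infixr "\<star>" 55) where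
  "g \<star> f = (\<lambda>a k i. \<Sum>j | f a j i \<noteq> 0. g a k j * f a j i)"

definition idm :: "'a obj \<Rightarrow> 'a mor" where
  "idm X = mat X X (\<lambda>a j i. if i = j then 1 else 0)"

definition addm :: "'a mor \<Rightarrow> 'a mor \<Rightarrow> 'a mor" where
  "addm f g = (\<lambda>a j i. f a j i + g a j i)"

definition sclm :: "complex \<Rightarrow> 'a mor \<Rightarrow> 'a mor" where
  "sclm z f = (\<lambda>a j i. z * f a j i)"

definition is_inv :: "'a obj \<Rightarrow> 'a obj \<Rightarrow> 'a mor \<Rightarrow> 'a mor \<Rightarrow> bool" where
  "is_inv X Y f g \<longleftrightarrow> f \<in> homs X Y \<and> g \<in> homs Y X \<and> g \<star> f = idm X \<and> f \<star> g = idm Y"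

definition is_iso :: "'a obj \<Rightarrow> 'a obj \<Rightarrow> 'a mor \<Rightarrow> bool" where
  "is_iso X Y f \<longleftrightarrow> (\<exists>g. is_inv X Y f g)"

definition invm :: "'a obj \<Rightarrow> 'a obj \<Rightarrow> 'a mor \<Rightarrow> 'a mor" where
  "invm X Y f = (THE g. is_inv X Y f g)"


section \<open>Fusion categories\<close>

definition tenO :: "('a, 'z) fusion_data_scheme \<Rightarrow> 'a obj \<Rightarrow> 'a obj \<Rightarrow> 'a obj" where
  "tenO D X Y = (\<lambda>c. {Node a b i j \<mu> | a b i j \<mu>.
     c \<in> lab D \<and> i \<in> X a \<and> j \<in> Y b \<and> \<mu> < fus D a b c})"

definition tenM :: "('a, 'z) fusion_data_scheme \<Rightarrow> 'a mor \<Rightarrow> 'a mor \<Rightarrow> 'a mor" where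
  "tenM D f g = (\<lambda>c t s. case (s, t) of
     (Node a b i j \<mu>, Node a' b' i' j' \<mu>') \<Rightarrow>
       if a' = a \<and> b' = b \<and> \<mu>' = \<mu> \<and> c \<in> lab D \<and> \<mu> < fus D a b c
       then f a i' i * g b j' j else 0
   | _ \<Rightarrow> 0)"

abbreviation tenO_infix ("_ \<boxdot>\<^bsub>_\<^esub> _" [71, 0, 70] 70) where "X \<boxdot>\<^bsub>D\<^esub> Y \<equiv> tenO D X Y"
abbreviation tenM_infix ("_ \<boxtimes>\<^bsub>_\<^esub> _" [71, 0, 70] 70) where "f \<boxtimes>\<^bsub>D\<^esub> g \<equiv> tenM D f g"

definition unitO :: "('a, 'z) fusion_data_scheme \<Rightarrow> 'a obj" where
  "unitO D = (\<lambda>a. if a = vac D then {Leaf 0} else {})"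

text \<open>Associator \<open>(X \<otimes> Y) \<otimes> Z \<rightarrow> X \<otimes> (Y \<otimes> Z)\<close>.\<close>

definition asc :: "('a, 'z) fusion_data_scheme \<Rightarrow> 'a obj \<Rightarrow> 'a obj \<Rightarrow> 'a obj \<Rightarrow> 'a mor" where
  "asc D X Y Z = mat ((X \<boxdot>\<^bsub>D\<^esub> Y) \<boxdot>\<^bsub>D\<^esub> Z) (X \<boxdot>\<^bsub>D\<^esub> (Y \<boxdot>\<^bsub>D\<^esub> Z)) (\<lambda>d t s. case (s, t) of
     (Node e c (Node a b i j \<mu>) k \<nu>, Node a' f i' (Node b' c' j' k' \<rho>) \<sigma>) \<Rightarrow>
       if a' = a \<and> b' = b \<and> c' = c \<and> i' = i \<and> j' = j \<and> k' = k
       then Fsym D a b c d (e, \<mu>, \<nu>) (f, \<rho>, \<sigma>) else 0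
   | _ \<Rightarrow> 0)"

text \<open>The gauge is normalised so that the basis vectors of \<open>V_1a^a\<close> and \<open>V_a1^a\<close> are the unitors.\<close>

definition lun :: "('a, 'z) fusion_data_scheme \<Rightarrow> 'a obj \<Rightarrow> 'a mor" where
  "lun D X = mat (unitO D \<boxdot>\<^bsub>D\<^esub> X) X (\<lambda>a j s. case s of
     Node e b i j' \<mu> \<Rightarrow> if b = a \<and> j' = j then 1 else 0 | _ \<Rightarrow> 0)"

definition run :: "('a, 'z) fusion_data_scheme \<Rightarrow> 'a obj \<Rightarrow> 'a mor" where
  "run D X = mat (X \<boxdot>\<^bsub>D\<^esub> unitO D) X (\<lambda>a j s. case s of
     Node b e j' i \<mu> \<Rightarrow> if b = a \<and> j' = j then 1 else 0 | _ \<Rightarrow> 0)"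

definition dual :: "('a, 'z) fusion_data_scheme \<Rightarrow> 'a obj \<Rightarrow> 'a obj" where
  "dual D X = (\<lambda>a. if a \<in> lab D then X (dua D a) else {})"

text \<open>\<open>X* \<otimes> X \<rightarrow> 1\<close> and \<open>1 \<rightarrow> X \<otimes> X*\<close>. Evaluation on a label is given by the basis vector of
  \<open>V_{a*,a}^1\<close>; the coefficient of coevaluation is then dictated by the zigzag identities.\<close>

definition ev :: "('a, 'z) fusion_data_scheme \<Rightarrow> 'a obj \<Rightarrow> 'a mor" where
  "ev D X = mat (dual D X \<boxdot>\<^bsub>D\<^esub> X) (unitO D) (\<lambda>a t s. case s of
     Node b b' i i' \<mu> \<Rightarrow> if i' = i then 1 else 0 | _ \<Rightarrow> 0)"

definition coev :: "('a, 'z) fusion_data_scheme \<Rightarrow> 'a obj \<Rightarrow> 'a mor" where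
  "coev D X = mat (unitO D) (X \<boxdot>\<^bsub>D\<^esub> dual D X) (\<lambda>a t s. case t of
     Node b b' i i' \<mu> \<Rightarrow>
       if i' = i then inverse (Fsym D b (dua D b) b b (vac D, 0, 0) (vac D, 0, 0)) else 0
   | _ \<Rightarrow> 0)"

text \<open>The dual of a morphism with respect to \<open>ev\<close> is the transpose, as \<open>ev\<close> pairs
  \<open>X a\<close> with its copy inside \<open>X*\<close>.\<close>

definition dualM :: "('a, 'z) fusion_data_scheme \<Rightarrow> 'a mor \<Rightarrow> 'a mor" where
  "dualM D f = (\<lambda>a i j. if a \<in> lab D then f (dua D a) j i else 0)"

text \<open>Pivotal structure \<open>X \<rightarrow> X** = X\<close>, evaluation \<open>X \<otimes> X* \<rightarrow> 1\<close>, coevaluation \<open>1 \<rightarrow> X* \<otimes> X\<close>,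
  and the traces of an endomorphism.\<close>

definition pivm :: "('a, 'z) fusion_data_scheme \<Rightarrow> 'a obj \<Rightarrow> 'a mor" where
  "pivm D X = mat X X (\<lambda>a j i. if i = j then piv D a else 0)"

definition ev' :: "('a, 'z) fusion_data_scheme \<Rightarrow> 'a obj \<Rightarrow> 'a mor" where
  "ev' D X = ev D (dual D X) \<star> (pivm D X \<boxtimes>\<^bsub>D\<^esub> idm (dual D X))"

definition coev' :: "('a, 'z) fusion_data_scheme \<Rightarrow> 'a obj \<Rightarrow> 'a mor" where
  "coev' D X = (idm (dual D X) \<boxtimes>\<^bsub>D\<^esub> invm X X (pivm D X)) \<star> coev D (dual D X)"

definition trc :: "('a, 'z) fusion_data_scheme \<Rightarrow> 'a obj \<Rightarrow> 'a mor \<Rightarrow> complex" where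
  "trc D X f = (ev' D X \<star> (f \<boxtimes>\<^bsub>D\<^esub> idm (dual D X)) \<star> coev D X) (vac D) (Leaf 0) (Leaf 0)"

definition trc' :: "('a, 'z) fusion_data_scheme \<Rightarrow> 'a obj \<Rightarrow> 'a mor \<Rightarrow> complex" where
  "trc' D X f = (ev D X \<star> (idm (dual D X) \<boxtimes>\<^bsub>D\<^esub> f) \<star> coev' D X) (vac D) (Leaf 0) (Leaf 0)"

text \<open>The canonical isomorphism \<open>\<psi> : Y* \<otimes> X* \<rightarrow> (X \<otimes> Y)*\<close>.\<close>

definition is_dual_ten :: "('a, 'z) fusion_data_scheme \<Rightarrow> 'a obj \<Rightarrow> 'a obj \<Rightarrow> 'a mor \<Rightarrow> bool" where
  "is_dual_ten D X Y \<psi> \<longleftrightarrow>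
     \<psi> \<in> homs (dual D Y \<boxdot>\<^bsub>D\<^esub> dual D X) (dual D (X \<boxdot>\<^bsub>D\<^esub> Y)) \<and>
     ev D (X \<boxdot>\<^bsub>D\<^esub> Y) \<star> (\<psi> \<boxtimes>\<^bsub>D\<^esub> idm (X \<boxdot>\<^bsub>D\<^esub> Y)) =
       ev D Y
       \<star> (idm (dual D Y) \<boxtimes>\<^bsub>D\<^esub>
            (lun D Y \<star> (ev D X \<boxtimes>\<^bsub>D\<^esub> idm Y)
             \<star> invm ((dual D X \<boxdot>\<^bsub>D\<^esub> X) \<boxdot>\<^bsub>D\<^esub> Y) (dual D X \<boxdot>\<^bsub>D\<^esub> (X \<boxdot>\<^bsub>D\<^esub> Y)) (asc D (dual D X) X Y)))
       \<star> asc D (dual D Y) (dual D X) (X \<boxdot>\<^bsub>D\<^esub> Y)"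

text \<open>
  Bifunctoriality of the tensor product and naturality of all structure morphisms hold by
  construction, so the axioms of a spherical fusion category that remain are: the fusion rules of
  the unit and of duals, invertibility of the associator, pentagon, triangle, zigzag identities,
  monoidality of the pivotal structure, and equality of left and right traces.
\<close>

definition spherical_fusion :: "('a, 'z) fusion_data_scheme \<Rightarrow> bool" where
  "spherical_fusion D \<longleftrightarrow>
     finite (lab D) \<and> vac D \<in> lab D \<and>
     (\<forall>a\<in>lab D. dua D a \<in> lab D \<and> dua D (dua D a) = a) \<and>
     (\<forall>a\<in>lab D. \<forall>b\<in>lab D.
        fus D (vac D) a b = (if a = b then 1 else 0) \<and>
        fus D a (vac D) b = (if a = b then 1 else 0) \<and>
        fus D a b (vac D) = (if b = dua D a then 1 else 0)) \<and>
     (\<forall>X\<in>objs D. \<forall>Y\<in>objs D. \<forall>Z\<in>objs D.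
        is_iso ((X \<boxdot>\<^bsub>D\<^esub> Y) \<boxdot>\<^bsub>D\<^esub> Z) (X \<boxdot>\<^bsub>D\<^esub> (Y \<boxdot>\<^bsub>D\<^esub> Z)) (asc D X Y Z)) \<and>
     (\<forall>W\<in>objs D. \<forall>X\<in>objs D. \<forall>Y\<in>objs D. \<forall>Z\<in>objs D.
        (idm W \<boxtimes>\<^bsub>D\<^esub> asc D X Y Z) \<star> asc D W (X \<boxdot>\<^bsub>D\<^esub> Y) Z \<star> (asc D W X Y \<boxtimes>\<^bsub>D\<^esub> idm Z) =
        asc D W X (Y \<boxdot>\<^bsub>D\<^esub> Z) \<star> asc D (W \<boxdot>\<^bsub>D\<^esub> X) Y Z) \<and>
     (\<forall>X\<in>objs D. \<forall>Y\<in>objs D.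
        (idm X \<boxtimes>\<^bsub>D\<^esub> lun D Y) \<star> asc D X (unitO D) Y = run D X \<boxtimes>\<^bsub>D\<^esub> idm Y) \<and>
     (\<forall>X\<in>objs D.
        run D X \<star> (idm X \<boxtimes>\<^bsub>D\<^esub> ev D X) \<star> asc D X (dual D X) X
          \<star> (coev D X \<boxtimes>\<^bsub>D\<^esub> idm X) \<star> invm (unitO D \<boxdot>\<^bsub>D\<^esub> X) X (lun D X) = idm X \<and>
        lun D (dual D X) \<star> (ev D X \<boxtimes>\<^bsub>D\<^esub> idm (dual D X))
          \<star> invm ((dual D X \<boxdot>\<^bsub>D\<^esub> X) \<boxdot>\<^bsub>D\<^esub> dual D X) (dual D X \<boxdot>\<^bsub>D\<^esub> (X \<boxdot>\<^bsub>D\<^esub> dual D X))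
              (asc D (dual D X) X (dual D X))
          \<star> (idm (dual D X) \<boxtimes>\<^bsub>D\<^esub> coev D X)
          \<star> invm (dual D X \<boxdot>\<^bsub>D\<^esub> unitO D) (dual D X) (run D (dual D X)) = idm (dual D X)) \<and>
     (\<forall>a\<in>lab D. piv D a = 1 \<or> piv D a = -1) \<and>
     (\<forall>X\<in>objs D. \<forall>Y\<in>objs D. \<exists>\<psi> \<psi>'.
        is_dual_ten D X Y \<psi> \<and> is_dual_ten D (dual D Y) (dual D X) \<psi>' \<and>
        dualM D \<psi> \<star> pivm D (X \<boxdot>\<^bsub>D\<^esub> Y) = \<psi>' \<star> (pivm D X \<boxtimes>\<^bsub>D\<^esub> pivm D Y)) \<and>
     (\<forall>X\<in>objs D. \<forall>f\<in>homs X X. trc D X f = trc' D X f)"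

text \<open>The twist, as the partial trace of the self-braiding \<open>c : X \<otimes> X \<rightarrow> X \<otimes> X\<close>.\<close>

definition twist :: "('a, 'z) fusion_data_scheme \<Rightarrow> 'a obj \<Rightarrow> 'a mor \<Rightarrow> 'a mor" where
  "twist D X c =
     run D X \<star> (idm X \<boxtimes>\<^bsub>D\<^esub> ev' D X) \<star> asc D X X (dual D X) \<star> (c \<boxtimes>\<^bsub>D\<^esub> idm (dual D X))
     \<star> invm ((X \<boxdot>\<^bsub>D\<^esub> X) \<boxdot>\<^bsub>D\<^esub> dual D X) (X \<boxdot>\<^bsub>D\<^esub> (X \<boxdot>\<^bsub>D\<^esub> dual D X)) (asc D X X (dual D X))
     \<star> (idm X \<boxtimes>\<^bsub>D\<^esub> coev D X) \<star> invm (X \<boxdot>\<^bsub>D\<^esub> unitO D) X (run D X)"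


section \<open>Modular tensor categories\<close>

definition brd :: "'a mtc_data \<Rightarrow> 'a obj \<Rightarrow> 'a obj \<Rightarrow> 'a mor" where
  "brd M X Y = mat (X \<boxdot>\<^bsub>M\<^esub> Y) (Y \<boxdot>\<^bsub>M\<^esub> X) (\<lambda>c t s. case (s, t) of
     (Node a b i j \<mu>, Node b' a' j' i' \<nu>) \<Rightarrow>
       if a' = a \<and> b' = b \<and> i' = i \<and> j' = j then Rsym M a b c \<mu> \<nu> else 0
   | _ \<Rightarrow> 0)"

definition simple :: "'a \<Rightarrow> 'a obj" where
  "simple a = (\<lambda>b. if b = a then {Leaf 0} else {})"

definition S_matrix :: "'a mtc_data \<Rightarrow> 'a \<Rightarrow> 'a \<Rightarrow> complex" where
  "S_matrix M a b = trc M (simple a \<boxdot>\<^bsub>M\<^esub> simple b)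
     (brd M (simple b) (simple a) \<star> brd M (simple a) (simple b))"

definition modular :: "'a mtc_data \<Rightarrow> bool" where
  "modular M \<longleftrightarrow>
     spherical_fusion M \<and>
     (\<forall>X\<in>objs M. \<forall>Y\<in>objs M. is_iso (X \<boxdot>\<^bsub>M\<^esub> Y) (Y \<boxdot>\<^bsub>M\<^esub> X) (brd M X Y)) \<and>
     (\<forall>X\<in>objs M. \<forall>Y\<in>objs M. \<forall>Z\<in>objs M.
        asc M Y Z X \<star> brd M X (Y \<boxdot>\<^bsub>M\<^esub> Z) \<star> asc M X Y Z =
          (idm Y \<boxtimes>\<^bsub>M\<^esub> brd M X Z) \<star> asc M Y X Z \<star> (brd M X Y \<boxtimes>\<^bsub>M\<^esub> idm Z) \<and>
        brd M (X \<boxdot>\<^bsub>M\<^esub> Y) Z =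
          asc M Z X Y \<star> (brd M X Z \<boxtimes>\<^bsub>M\<^esub> idm Y)
          \<star> invm ((X \<boxdot>\<^bsub>M\<^esub> Z) \<boxdot>\<^bsub>M\<^esub> Y) (X \<boxdot>\<^bsub>M\<^esub> (Z \<boxdot>\<^bsub>M\<^esub> Y)) (asc M X Z Y)
          \<star> (idm X \<boxtimes>\<^bsub>M\<^esub> brd M Y Z) \<star> asc M X Y Z) \<and>
     (\<exists>T. \<forall>a\<in>lab M. \<forall>b\<in>lab M.
        (\<Sum>c\<in>lab M. S_matrix M a c * T c b) = (if a = b then 1 else 0))"


section \<open>Equivalence of ribbon categories\<close>

record ('o, 'm) ribbon_cat =
  Ob :: "'o set"
  Mor :: "'o \<Rightarrow> 'o \<Rightarrow> 'm set"
  Cmp :: "'m \<Rightarrow> 'm \<Rightarrow> 'm"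
  Ide :: "'o \<Rightarrow> 'm"
  Add :: "'m \<Rightarrow> 'm \<Rightarrow> 'm"
  Scl :: "complex \<Rightarrow> 'm \<Rightarrow> 'm"
  TenO :: "'o \<Rightarrow> 'o \<Rightarrow> 'o"
  TenM :: "'m \<Rightarrow> 'm \<Rightarrow> 'm"
  Unt :: 'o
  Asc :: "'o \<Rightarrow> 'o \<Rightarrow> 'o \<Rightarrow> 'm"
  Lun :: "'o \<Rightarrow> 'm"
  Run :: "'o \<Rightarrow> 'm"
  Brd :: "'o \<Rightarrow> 'o \<Rightarrow> 'm"
  Twi :: "'o \<Rightarrow> 'm"

definition iso_in :: "('o, 'm) ribbon_cat \<Rightarrow> 'o \<Rightarrow> 'o \<Rightarrow> 'm \<Rightarrow> bool" where
  "iso_in A X Y f \<longleftrightarrow>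
     f \<in> Mor A X Y \<and> (\<exists>g\<in>Mor A Y X. Cmp A g f = Ide A X \<and> Cmp A f g = Ide A Y)"

text \<open>\<open>Fo\<close>, \<open>Fm X Y : Hom(X, Y) \<rightarrow> Hom(Fo X, Fo Y)\<close> is a complex linear equivalence, monoidal by
  \<open>J X Y : Fo X \<otimes> Fo Y \<rightarrow> Fo (X \<otimes> Y)\<close> and \<open>J0 : 1 \<rightarrow> Fo 1\<close>, preserving braiding and twist. For
  ribbon categories, preserving the twist amounts to preserving the pivotal structure.\<close>

definition ribbon_equivalence ::
    "('o, 'm) ribbon_cat \<Rightarrow> ('p, 'n) ribbon_cat \<Rightarrow> ('o \<Rightarrow> 'p) \<Rightarrow> ('o \<Rightarrow> 'o \<Rightarrow> 'm \<Rightarrow> 'n) \<Rightarrow>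
     ('o \<Rightarrow> 'o \<Rightarrow> 'n) \<Rightarrow> 'n \<Rightarrow> bool" where
  "ribbon_equivalence A B Fo Fm J J0 \<longleftrightarrow>
     (\<forall>X\<in>Ob A. Fo X \<in> Ob B) \<and>
     (\<forall>X\<in>Ob A. \<forall>Y\<in>Ob A. bij_betw (Fm X Y) (Mor A X Y) (Mor B (Fo X) (Fo Y))) \<and>
     (\<forall>P\<in>Ob B. \<exists>X\<in>Ob A. \<exists>f. iso_in B (Fo X) P f) \<and>
     (\<forall>X\<in>Ob A. Fm X X (Ide A X) = Ide B (Fo X)) \<and>
     (\<forall>X\<in>Ob A. \<forall>Y\<in>Ob A. \<forall>Z\<in>Ob A. \<forall>f\<in>Mor A X Y. \<forall>g\<in>Mor A Y Z.
        Fm X Z (Cmp A g f) = Cmp B (Fm Y Z g) (Fm X Y f)) \<and>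
     (\<forall>X\<in>Ob A. \<forall>Y\<in>Ob A. \<forall>f\<in>Mor A X Y. \<forall>g\<in>Mor A X Y.
        Fm X Y (Add A f g) = Add B (Fm X Y f) (Fm X Y g)) \<and>
     (\<forall>X\<in>Ob A. \<forall>Y\<in>Ob A. \<forall>f\<in>Mor A X Y. \<forall>z.
        Fm X Y (Scl A z f) = Scl B z (Fm X Y f)) \<and>
     iso_in B (Unt B) (Fo (Unt A)) J0 \<and>
     (\<forall>X\<in>Ob A. \<forall>Y\<in>Ob A. iso_in B (TenO B (Fo X) (Fo Y)) (Fo (TenO A X Y)) (J X Y)) \<and>
     (\<forall>X\<in>Ob A. \<forall>Y\<in>Ob A. \<forall>X'\<in>Ob A. \<forall>Y'\<in>Ob A. \<forall>f\<in>Mor A X X'. \<forall>g\<in>Mor A Y Y'.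
        Cmp B (Fm (TenO A X Y) (TenO A X' Y') (TenM A f g)) (J X Y) =
        Cmp B (J X' Y') (TenM B (Fm X X' f) (Fm Y Y' g))) \<and>
     (\<forall>X\<in>Ob A. \<forall>Y\<in>Ob A. \<forall>Z\<in>Ob A.
        Cmp B (Fm (TenO A (TenO A X Y) Z) (TenO A X (TenO A Y Z)) (Asc A X Y Z))
          (Cmp B (J (TenO A X Y) Z) (TenM B (J X Y) (Ide B (Fo Z)))) =
        Cmp B (J X (TenO A Y Z))
          (Cmp B (TenM B (Ide B (Fo X)) (J Y Z)) (Asc B (Fo X) (Fo Y) (Fo Z)))) \<and>
     (\<forall>X\<in>Ob A.
        Cmp B (Fm (TenO A (Unt A) X) X (Lun A X))
          (Cmp B (J (Unt A) X) (TenM B J0 (Ide B (Fo X)))) = Lun B (Fo X) \<and>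
        Cmp B (Fm (TenO A X (Unt A)) X (Run A X))
          (Cmp B (J X (Unt A)) (TenM B (Ide B (Fo X)) J0)) = Run B (Fo X)) \<and>
     (\<forall>X\<in>Ob A. \<forall>Y\<in>Ob A.
        Cmp B (Fm (TenO A X Y) (TenO A Y X) (Brd A X Y)) (J X Y) =
        Cmp B (J Y X) (Brd B (Fo X) (Fo Y))) \<and>
     (\<forall>X\<in>Ob A. Fm X X (Twi A X) = Twi B (Fo X))"

definition ribbon_equivalent ::
    "('o, 'm) ribbon_cat \<Rightarrow> ('p, 'n) ribbon_cat \<Rightarrow> bool" (infix "\<cong>\<^sub>r" 50) where
  "A \<cong>\<^sub>r B \<longleftrightarrow> (\<exists>Fo Fm J J0. ribbon_equivalence A B Fo Fm J J0)"

definition mtc_cat :: "'a mtc_data \<Rightarrow> ('a obj, 'a mor) ribbon_cat" where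
  "mtc_cat M = \<lparr>
     Ob = objs M, Mor = homs, Cmp = cmp, Ide = idm, Add = addm, Scl = sclm,
     TenO = tenO M, TenM = tenM M, Unt = unitO M, Asc = asc M, Lun = lun M, Run = run M,
     Brd = brd M, Twi = (\<lambda>X. twist M X (brd M X X))\<rparr>"


section \<open>G-crossed braided extensions\<close>

definition actO ::
    "('g, 'y) monoid_scheme \<Rightarrow> ('a, 'g) crossed_data \<Rightarrow> 'g \<Rightarrow> 'a obj \<Rightarrow> 'a obj" where
  "actO G D g X = (\<lambda>a. if a \<in> lab D then X (act D (inv\<^bsub>G\<^esub> g) a) else {})"

definition actM ::
    "('g, 'y) monoid_scheme \<Rightarrow> ('a, 'g) crossed_data \<Rightarrow> 'g \<Rightarrow> 'a mor \<Rightarrow> 'a mor" where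
  "actM G D g f = (\<lambda>a j i. if a \<in> lab D then f (act D (inv\<^bsub>G\<^esub> g) a) j i else 0)"

text \<open>\<open>g(X \<otimes> Y) \<rightarrow> g(X) \<otimes> g(Y)\<close>\<close>

definition act_ten ::
    "('g, 'y) monoid_scheme \<Rightarrow> ('a, 'g) crossed_data \<Rightarrow> 'g \<Rightarrow> 'a obj \<Rightarrow> 'a obj \<Rightarrow> 'a mor" where
  "act_ten G D g X Y = mat (actO G D g (X \<boxdot>\<^bsub>D\<^esub> Y)) (actO G D g X \<boxdot>\<^bsub>D\<^esub> actO G D g Y)
     (\<lambda>c t s. case (s, t) of
        (Node a b i j \<mu>, Node a' b' i' j' \<nu>) \<Rightarrow>
          if a' = act D g a \<and> b' = act D g b \<and> i' = i \<and> j' = j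
          then Usym D g a' b' c \<mu> \<nu> else 0
      | _ \<Rightarrow> 0)"

text \<open>\<open>g(h(X)) \<rightarrow> (gh)(X)\<close>\<close>

definition act_mul ::
    "('g, 'y) monoid_scheme \<Rightarrow> ('a, 'g) crossed_data \<Rightarrow> 'g \<Rightarrow> 'g \<Rightarrow> 'a obj \<Rightarrow> 'a mor" where
  "act_mul G D g h X = mat (actO G D g (actO G D h X)) (actO G D (g \<otimes>\<^bsub>G\<^esub> h) X)
     (\<lambda>a j i. if i = j then eta D a g h else 0)"

definition homogeneous :: "('a, 'g) crossed_data \<Rightarrow> 'g \<Rightarrow> 'a obj \<Rightarrow> bool" where
  "homogeneous D g X \<longleftrightarrow> X \<in> objs D \<and> (\<forall>a. X a \<noteq> {} \<longrightarrow> grd D a = g)"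

text \<open>\<open>X \<otimes> Y \<rightarrow> g(Y) \<otimes> X\<close>, for \<open>X\<close> homogeneous of degree \<open>g\<close>\<close>

definition xbrd ::
    "('g, 'y) monoid_scheme \<Rightarrow> ('a, 'g) crossed_data \<Rightarrow> 'g \<Rightarrow> 'a obj \<Rightarrow> 'a obj \<Rightarrow> 'a mor" where
  "xbrd G D g X Y = mat (X \<boxdot>\<^bsub>D\<^esub> Y) (actO G D g Y \<boxdot>\<^bsub>D\<^esub> X) (\<lambda>c t s. case (s, t) of
     (Node a b i j \<mu>, Node b' a' j' i' \<nu>) \<Rightarrow>
       if a' = a \<and> b' = act D g b \<and> i' = i \<and> j' = j then Xsym D a b c \<mu> \<nu> else 0
   | _ \<Rightarrow> 0)"

definition conj_by :: "('g, 'y) monoid_scheme \<Rightarrow> 'g \<Rightarrow> 'g \<Rightarrow> 'g" where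
  "conj_by G g h = g \<otimes>\<^bsub>G\<^esub> h \<otimes>\<^bsub>G\<^esub> inv\<^bsub>G\<^esub> g"

definition graded :: "('g, 'y) monoid_scheme \<Rightarrow> ('a, 'g) crossed_data \<Rightarrow> bool" where
  "graded G D \<longleftrightarrow>
     grd D ` lab D = carrier G \<and>
     (\<forall>a\<in>lab D. \<forall>b\<in>lab D. \<forall>c\<in>lab D. fus D a b c \<noteq> 0 \<longrightarrow> grd D c = grd D a \<otimes>\<^bsub>G\<^esub> grd D b)"

text \<open>An action by pivotal tensor autoequivalences, with \<open>g\<close> mapping degree \<open>h\<close> to degree
  \<open>ghg\<^sup>-\<^sup>1\<close>. The gauge is normalised so that the neutral element acts as the identity. An
  autoequivalence respects the pivotal structure iff it respects traces.\<close>

definition crossed_action :: "('g, 'y) monoid_scheme \<Rightarrow> ('a, 'g) crossed_data \<Rightarrow> bool" where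
  "crossed_action G D \<longleftrightarrow>
     (\<forall>g\<in>carrier G. \<forall>a\<in>lab D.
        act D g a \<in> lab D \<and> grd D (act D g a) = conj_by G g (grd D a)) \<and>
     (\<forall>g\<in>carrier G. act D g (vac D) = vac D) \<and>
     (\<forall>a\<in>lab D. act D \<one>\<^bsub>G\<^esub> a = a) \<and>
     (\<forall>g\<in>carrier G. \<forall>h\<in>carrier G. \<forall>a\<in>lab D. act D (g \<otimes>\<^bsub>G\<^esub> h) a = act D g (act D h a)) \<and>
     (\<forall>g\<in>carrier G. \<forall>X\<in>objs D. \<forall>Y\<in>objs D.
        is_iso (actO G D g (X \<boxdot>\<^bsub>D\<^esub> Y)) (actO G D g X \<boxdot>\<^bsub>D\<^esub> actO G D g Y) (act_ten G D g X Y)) \<and>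
     (\<forall>g\<in>carrier G. \<forall>X\<in>objs D. \<forall>Y\<in>objs D. \<forall>Z\<in>objs D.
        asc D (actO G D g X) (actO G D g Y) (actO G D g Z)
          \<star> (act_ten G D g X Y \<boxtimes>\<^bsub>D\<^esub> idm (actO G D g Z)) \<star> act_ten G D g (X \<boxdot>\<^bsub>D\<^esub> Y) Z =
        (idm (actO G D g X) \<boxtimes>\<^bsub>D\<^esub> act_ten G D g Y Z) \<star> act_ten G D g X (Y \<boxdot>\<^bsub>D\<^esub> Z)
          \<star> actM G D g (asc D X Y Z)) \<and>
     (\<forall>g\<in>carrier G. \<forall>X\<in>objs D.
        lun D (actO G D g X) \<star> act_ten G D g (unitO D) X = actM G D g (lun D X) \<and>
        run D (actO G D g X) \<star> act_ten G D g X (unitO D) = actM G D g (run D X)) \<and>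
     (\<forall>g\<in>carrier G. \<forall>h\<in>carrier G. \<forall>X\<in>objs D.
        is_iso (actO G D g (actO G D h X)) (actO G D (g \<otimes>\<^bsub>G\<^esub> h) X) (act_mul G D g h X)) \<and>
     (\<forall>g\<in>carrier G. \<forall>h\<in>carrier G. \<forall>X\<in>objs D. \<forall>Y\<in>objs D.
        act_ten G D (g \<otimes>\<^bsub>G\<^esub> h) X Y \<star> act_mul G D g h (X \<boxdot>\<^bsub>D\<^esub> Y) =
        (act_mul G D g h X \<boxtimes>\<^bsub>D\<^esub> act_mul G D g h Y)
          \<star> act_ten G D g (actO G D h X) (actO G D h Y) \<star> actM G D g (act_ten G D h X Y)) \<and>
     (\<forall>g\<in>carrier G. \<forall>h\<in>carrier G. act_mul G D g h (unitO D) = idm (unitO D)) \<and>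
     (\<forall>g\<in>carrier G. \<forall>h\<in>carrier G. \<forall>k\<in>carrier G. \<forall>X\<in>objs D.
        act_mul G D g (h \<otimes>\<^bsub>G\<^esub> k) X \<star> actM G D g (act_mul G D h k X) =
        act_mul G D (g \<otimes>\<^bsub>G\<^esub> h) k X \<star> act_mul G D g h (actO G D k X)) \<and>
     (\<forall>X\<in>objs D. \<forall>Y\<in>objs D. act_ten G D \<one>\<^bsub>G\<^esub> X Y = idm (X \<boxdot>\<^bsub>D\<^esub> Y)) \<and>
     (\<forall>g\<in>carrier G. \<forall>X\<in>objs D.
        act_mul G D \<one>\<^bsub>G\<^esub> g X = idm (actO G D g X) \<and> act_mul G D g \<one>\<^bsub>G\<^esub> X = idm (actO G D g X)) \<and>
     (\<forall>g\<in>carrier G. \<forall>X\<in>objs D. \<forall>f\<in>homs X X.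
        trc D (actO G D g X) (actM G D g f) = trc D X f)"

text \<open>The three coherence conditions are compatibility of the braiding with the action
  and the two heptagons.\<close>

definition crossed_braiding :: "('g, 'y) monoid_scheme \<Rightarrow> ('a, 'g) crossed_data \<Rightarrow> bool" where
  "crossed_braiding G D \<longleftrightarrow>
     (\<forall>g\<in>carrier G. \<forall>X Y. homogeneous D g X \<and> Y \<in> objs D \<longrightarrow>
        is_iso (X \<boxdot>\<^bsub>D\<^esub> Y) (actO G D g Y \<boxdot>\<^bsub>D\<^esub> X) (xbrd G D g X Y)) \<and>
     (\<forall>g\<in>carrier G. \<forall>h\<in>carrier G. \<forall>X Y. homogeneous D h X \<and> Y \<in> objs D \<longrightarrow>
        (act_mul G D g h Y \<boxtimes>\<^bsub>D\<^esub> idm (actO G D g X))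
          \<star> act_ten G D g (actO G D h Y) X \<star> actM G D g (xbrd G D h X Y) =
        (act_mul G D (conj_by G g h) g Y \<boxtimes>\<^bsub>D\<^esub> idm (actO G D g X))
          \<star> xbrd G D (conj_by G g h) (actO G D g X) (actO G D g Y) \<star> act_ten G D g X Y) \<and>
     (\<forall>g\<in>carrier G. \<forall>X Y Z. homogeneous D g X \<and> Y \<in> objs D \<and> Z \<in> objs D \<longrightarrow>
        asc D (actO G D g Y) (actO G D g Z) X \<star> (act_ten G D g Y Z \<boxtimes>\<^bsub>D\<^esub> idm X)
          \<star> xbrd G D g X (Y \<boxdot>\<^bsub>D\<^esub> Z) \<star> asc D X Y Z =
        (idm (actO G D g Y) \<boxtimes>\<^bsub>D\<^esub> xbrd G D g X Z) \<star> asc D (actO G D g Y) X Z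
          \<star> (xbrd G D g X Y \<boxtimes>\<^bsub>D\<^esub> idm Z)) \<and>
     (\<forall>g\<in>carrier G. \<forall>h\<in>carrier G. \<forall>X Y Z.
        homogeneous D g X \<and> homogeneous D h Y \<and> Z \<in> objs D \<longrightarrow>
        xbrd G D (g \<otimes>\<^bsub>G\<^esub> h) (X \<boxdot>\<^bsub>D\<^esub> Y) Z =
        asc D (actO G D (g \<otimes>\<^bsub>G\<^esub> h) Z) X Y \<star> ((act_mul G D g h Z \<boxtimes>\<^bsub>D\<^esub> idm X) \<boxtimes>\<^bsub>D\<^esub> idm Y)
          \<star> (xbrd G D g X (actO G D h Z) \<boxtimes>\<^bsub>D\<^esub> idm Y)
          \<star> invm ((X \<boxdot>\<^bsub>D\<^esub> actO G D h Z) \<boxdot>\<^bsub>D\<^esub> Y) (X \<boxdot>\<^bsub>D\<^esub> (actO G D h Z \<boxdot>\<^bsub>D\<^esub> Y))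
              (asc D X (actO G D h Z) Y)
          \<star> (idm X \<boxtimes>\<^bsub>D\<^esub> xbrd G D h Y Z) \<star> asc D X Y Z)"

definition trivial_sector :: "('g, 'y) monoid_scheme \<Rightarrow> ('a, 'g) crossed_data \<Rightarrow> 'a mtc_data" where
  "trivial_sector G D = \<lparr>
     lab = {a \<in> lab D. grd D a = \<one>\<^bsub>G\<^esub>}, vac = vac D, dua = dua D, fus = fus D,
     Fsym = Fsym D, piv = piv D, Rsym = Xsym D\<rparr>"

text \<open>Equality of modular tensor categories, here of the trivially graded component with \<open>C\<close>,
  means equivalence.\<close>

definition crossed_extension ::
    "('g, 'y) monoid_scheme \<Rightarrow> 'c mtc_data \<Rightarrow> ('a, 'g) crossed_data \<Rightarrow> bool" where
  "crossed_extension G C D \<longleftrightarrow>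
     spherical_fusion D \<and> graded G D \<and> crossed_action G D \<and> crossed_braiding G D \<and>
     mtc_cat (trivial_sector G D) \<cong>\<^sub>r mtc_cat C"


section \<open>Gauging: the category of equivariant objects\<close>

definition equivariant ::
    "('g, 'y) monoid_scheme \<Rightarrow> ('a, 'g) crossed_data \<Rightarrow> 'a obj \<Rightarrow> ('g \<Rightarrow> 'a mor) \<Rightarrow> bool" where
  "equivariant G D X u \<longleftrightarrow>
     X \<in> objs D \<and>
     (\<forall>g\<in>carrier G. is_iso (actO G D g X) X (u g)) \<and>
     (\<forall>g\<in>carrier G. \<forall>h\<in>carrier G.
        u (g \<otimes>\<^bsub>G\<^esub> h) \<star> act_mul G D g h X = u g \<star> actM G D g (u h))"

definition sector :: "('a, 'g) crossed_data \<Rightarrow> 'g \<Rightarrow> 'a obj \<Rightarrow> 'a obj" where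
  "sector D g X = (\<lambda>a. if grd D a = g then X a else {})"

text \<open>The braiding \<open>X \<otimes> Y \<rightarrow> Y \<otimes> X\<close> of equivariant objects, \<open>v\<close> being the equivariant structure of
  \<open>Y\<close>: on the degree \<open>g\<close> part \<open>X\<^sub>g\<close> of \<open>X\<close> it is \<open>X\<^sub>g \<otimes> Y \<rightarrow> g(Y) \<otimes> X\<^sub>g \<rightarrow> Y \<otimes> X\<^sub>g\<close>, and these are
  blocks of one matrix.\<close>

definition eq_brd ::
    "('g, 'y) monoid_scheme \<Rightarrow> ('a, 'g) crossed_data \<Rightarrow> 'a obj \<Rightarrow> 'a obj \<Rightarrow> ('g \<Rightarrow> 'a mor) \<Rightarrow> 'a mor" where
  "eq_brd G D X Y v = (\<lambda>c t s. \<Sum>g\<in>carrier G.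
     ((v g \<boxtimes>\<^bsub>D\<^esub> idm (sector D g X)) \<star> xbrd G D g (sector D g X) Y) c t s)"

definition gauging ::
    "('g, 'y) monoid_scheme \<Rightarrow> ('a, 'g) crossed_data \<Rightarrow> ('a obj \<times> ('g \<Rightarrow> 'a mor), 'a mor) ribbon_cat" where
  "gauging G D = \<lparr>
     Ob = {(X, u). equivariant G D X u},
     Mor = (\<lambda>(X, u) (Y, v). {f \<in> homs X Y. \<forall>g\<in>carrier G. v g \<star> actM G D g f = f \<star> u g}),
     Cmp = cmp, Ide = (\<lambda>(X, u). idm X), Add = addm, Scl = sclm,
     TenO = (\<lambda>(X, u) (Y, v). (X \<boxdot>\<^bsub>D\<^esub> Y, \<lambda>g. (u g \<boxtimes>\<^bsub>D\<^esub> v g) \<star> act_ten G D g X Y)),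
     TenM = tenM D,
     Unt = (unitO D, \<lambda>g. idm (unitO D)),
     Asc = (\<lambda>(X, u) (Y, v) (Z, w). asc D X Y Z),
     Lun = (\<lambda>(X, u). lun D X), Run = (\<lambda>(X, u). run D X),
     Brd = (\<lambda>(X, u) (Y, v). eq_brd G D X Y v),
     Twi = (\<lambda>(X, u). twist D X (eq_brd G D X X u))\<rparr>"

end

theory Submission
  imports Defs
begin

text \<open>
  An automorphism \<open>q\<close> of the Galois field of \<open>D\<close> extends to an automorphism \<open>\<sigma>\<close> of the complex field,
  and \<open>\<sigma>\<close> restricts to the Galois field of \<open>M\<close>, which is normal; take \<open>q' = \<sigma>\<close>. All structure
  morphisms of an equivariantisation and of a modular category are built from their data by matrix
  algebra, so applying \<open>\<sigma>\<close> to every matrix entry is a \<open>\<sigma>\<close>-semilinear ribbon isomorphism from the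
  gauging of \<open>D\<close> to that of \<open>q(D)\<close>, and from \<open>M\<close> to \<open>\<sigma>(M)\<close>. Composing a given equivalence with
  the inverse of the first and with the second gives a complex linear one.
\<close>

section \<open>Extending automorphisms of subfields of an algebraically closed field\<close>

text \<open>The equivariant structures and the given equivalence involve arbitrary complex matrices,
  whereas \<open>q\<close> is controlled only on the normal closure of
  \<open>crossed_field G D\<close>. This forces an automorphism of all of the complex numbers; a
  single map then acts on the data of both \<open>D\<close> and \<open>M\<close>, and their two
  fields are never compared. For the extension, the obstacle is surjectivity: an embedding of the
  complex field into itself may have a proper subfield as image. For the categories, the obstacles
  come from the encoding. The extension agrees with \<open>q\<close> only on entries whose indices
  are in range, so each structure matrix must be shown to use only those. And an equivariant
  structure is a function on a whole type, of which only the values on the carrier of the group mean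
  anything, so that an equivalence may send two representatives of one object to different, merely
  isomorphic objects.\<close>

text \<open>A partial isomorphism between subrings is represented by its graph, so that unions of chains
  are immediate.\<close>

definition partial_iso :: "('a::idom \<times> 'a) set \<Rightarrow> bool" where
  "partial_iso R \<longleftrightarrow> (1, 1) \<in> R \<and>
     (\<forall>x y x' y'. (x, y) \<in> R \<longrightarrow> (x', y') \<in> R \<longrightarrow> (x + x', y + y') \<in> R \<and> (x * x', y * y') \<in> R) \<and>
     (\<forall>x y. (x, y) \<in> R \<longrightarrow> (- x, - y) \<in> R \<and> (x = 0 \<longleftrightarrow> y = 0))"

text \<open>The graph of the isomorphism that \<open>R\<close> induces, coefficient by coefficient,
  between polynomial rings.\<close>

definition poly_pairs :: "('a::idom \<times> 'a) set \<Rightarrow> ('a poly \<times> 'a poly) set" where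
  "poly_pairs R = {(p, q). \<forall>i. (coeff p i, coeff q i) \<in> R}"

text \<open>The candidate for extending \<open>R\<close> by sending \<open>x\<close> to
  \<open>y\<close>. Polynomial values suffice, without quotients, because domains are only required
  to be subrings.\<close>

definition adjoin :: "('a::idom \<times> 'a) set \<Rightarrow> 'a \<Rightarrow> 'a \<Rightarrow> ('a \<times> 'a) set" where
  "adjoin R x y = {(poly p x, poly q y) | p q. (p, q) \<in> poly_pairs R}"

context
  fixes R :: "('a::idom \<times> 'a) set"
  assumes R: "partial_iso R"
begin

lemma piso_one: "(1, 1) \<in> R"
  and piso_add: "(x, y) \<in> R \<Longrightarrow> (x', y') \<in> R \<Longrightarrow> (x + x', y + y') \<in> R"
  and piso_mult: "(x, y) \<in> R \<Longrightarrow> (x', y') \<in> R \<Longrightarrow> (x * x', y * y') \<in> R"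
  and piso_uminus: "(x, y) \<in> R \<Longrightarrow> (- x, - y) \<in> R"
  and piso_eq0: "(x, y) \<in> R \<Longrightarrow> x = 0 \<longleftrightarrow> y = 0"
  using R by (auto simp: partial_iso_def)

lemma piso_zero: "(0, 0) \<in> R"
  using piso_add[OF piso_one piso_uminus[OF piso_one]] by simp

lemma piso_diff: "(x, y) \<in> R \<Longrightarrow> (x', y') \<in> R \<Longrightarrow> (x - x', y - y') \<in> R"
  using piso_add[OF _ piso_uminus] by fastforce

lemma piso_sum: "(\<And>i. i \<in> A \<Longrightarrow> (f i, g i) \<in> R) \<Longrightarrow> (sum f A, sum g A) \<in> R"
  by (induction A rule: infinite_finite_induct) (auto intro: piso_zero piso_add)

text \<open>Preservation and reflection of 0, applied to a difference, make the relation both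
  single-valued and injective.\<close>

lemma piso_unique: "(x, y) \<in> R \<Longrightarrow> (x', y') \<in> R \<Longrightarrow> x = x' \<longleftrightarrow> y = y'"
  using piso_eq0[OF piso_diff] by fastforce

text \<open>The definition is symmetric in the two coordinates. Statements about ranges are obtained
  from those about domains in this way.\<close>

lemma partial_iso_converse: "partial_iso (R\<inverse>)"
  using R by (auto simp: partial_iso_def)

lemma poly_pairs_const: "(x, y) \<in> R \<Longrightarrow> ([:x:], [:y:]) \<in> poly_pairs R"
  by (auto simp: poly_pairs_def coeff_pCons piso_zero split: nat.splits)

lemma poly_pairs_monom: "(x, y) \<in> R \<Longrightarrow> (monom x n, monom y n) \<in> poly_pairs R"
  by (auto simp: poly_pairs_def piso_zero)

lemma poly_pairs_add:
  "(p, q) \<in> poly_pairs R \<Longrightarrow> (p', q') \<in> poly_pairs R \<Longrightarrow> (p + p', q + q') \<in> poly_pairs R"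
  by (auto simp: poly_pairs_def piso_add)

lemma poly_pairs_diff:
  "(p, q) \<in> poly_pairs R \<Longrightarrow> (p', q') \<in> poly_pairs R \<Longrightarrow> (p - p', q - q') \<in> poly_pairs R"
  by (auto simp: poly_pairs_def piso_diff)

lemma poly_pairs_mult:
  "(p, q) \<in> poly_pairs R \<Longrightarrow> (p', q') \<in> poly_pairs R \<Longrightarrow> (p * p', q * q') \<in> poly_pairs R"
  by (auto simp: poly_pairs_def coeff_mult intro!: piso_sum piso_mult)

lemma poly_pairs_smult:
  "(x, y) \<in> R \<Longrightarrow> (p, q) \<in> poly_pairs R \<Longrightarrow> (smult x p, smult y q) \<in> poly_pairs R"
  by (auto simp: poly_pairs_def piso_mult)

lemma poly_pairs_degree: assumes "(p, q) \<in> poly_pairs R" shows "degree p = degree q"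
proof -
  have "coeff p i = 0 \<longleftrightarrow> coeff q i = 0" for i
    using assms by (auto simp: poly_pairs_def dest: piso_eq0)
  then show ?thesis by (simp add: degree_def)
qed

lemma poly_pairs_eq0: "(p, q) \<in> poly_pairs R \<Longrightarrow> p = 0 \<longleftrightarrow> q = 0"
  unfolding poly_eq_iff poly_pairs_def by (auto dest: piso_eq0)

lemma poly_pairs_coeff: "(p, q) \<in> poly_pairs R \<Longrightarrow> (coeff p i, coeff q i) \<in> R"
  by (simp add: poly_pairs_def)

lemma poly_pairs_lead_coeff:
  "(p, q) \<in> poly_pairs R \<Longrightarrow> (lead_coeff p, lead_coeff q) \<in> R"
  using poly_pairs_degree poly_pairs_coeff by metis

lemma poly_pairs_converse: "(p, q) \<in> poly_pairs R \<longleftrightarrow> (q, p) \<in> poly_pairs (R\<inverse>)"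
  by (simp add: poly_pairs_def)

lemma poly_pairs_exists:
  assumes "\<And>i. coeff p i \<in> Domain R" shows "\<exists>q. (p, q) \<in> poly_pairs R"
proof -
  from assms have "\<forall>i. \<exists>y. (coeff p i, y) \<in> R" by blast
  then obtain f where f: "(coeff p i, f i) \<in> R" for i by metis
  \<comment> \<open>The sum is cut off at \<open>degree p\<close> to make it a polynomial; beyond
    that both coefficients are 0, and \<open>piso_zero\<close> pairs them.\<close>
  have "(p, \<Sum>i\<le>degree p. monom (f i) i) \<in> poly_pairs R"
    unfolding poly_pairs_def using f piso_zero
    by (auto simp: coeff_sum coeff_monom if_distrib [of "\<lambda>x. _ = x"] coeff_eq_0 sum.delta)
  then show ?thesis ..
qed

lemma adjoin_subset: "R \<subseteq> adjoin R x y"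
proof
  fix z assume "z \<in> R"
  then have "([:fst z:], [:snd z:]) \<in> poly_pairs R" by (simp add: poly_pairs_const)
  then show "z \<in> adjoin R x y" unfolding adjoin_def by (force simp: prod_eq_iff)
qed

lemma adjoin_self: "(x, y) \<in> adjoin R x y"
  using poly_pairs_monom[OF piso_one, of 1] unfolding adjoin_def
  by (force simp: poly_monom)

text \<open>By hypothesis the kernels of evaluation at \<open>x\<close> and at \<open>y\<close>
  correspond under \<open>R\<close>, so pairing the values is well defined and injective; the ring
  operations are inherited from the polynomials.\<close>

lemma partial_iso_adjoin:
  assumes "\<And>p q. (p, q) \<in> poly_pairs R \<Longrightarrow> poly p x = 0 \<longleftrightarrow> poly q y = 0"
  shows "partial_iso (adjoin R x y)"
  unfolding partial_iso_def
proof (intro conjI allI impI)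
  show "(1, 1) \<in> adjoin R x y" using piso_one adjoin_subset by blast
next
  fix a b a' b'
  assume "(a, b) \<in> adjoin R x y" and "(a', b') \<in> adjoin R x y"
  then obtain p q p' q' where *: "(p, q) \<in> poly_pairs R" "(p', q') \<in> poly_pairs R"
    "a = poly p x" "b = poly q y" "a' = poly p' x" "b' = poly q' y"
    by (auto simp: adjoin_def)
  show "(a + a', b + b') \<in> adjoin R x y"
    using poly_pairs_add[OF *(1,2)] * unfolding adjoin_def by force
  show "(a * a', b * b') \<in> adjoin R x y"
    using poly_pairs_mult[OF *(1,2)] * unfolding adjoin_def by force
next
  fix a b
  assume "(a, b) \<in> adjoin R x y"
  then obtain p q where *: "(p, q) \<in> poly_pairs R" "a = poly p x" "b = poly q y"
    by (auto simp: adjoin_def)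
  show "(- a, - b) \<in> adjoin R x y"
    using poly_pairs_diff[OF poly_pairs_const[OF piso_zero] *(1)] * unfolding adjoin_def by force
  show "(a = 0) = (b = 0)" using * assms by simp
qed

text \<open>Division with remainder, carried out on both sides of \<open>R\<close> at once. Leading
  coefficients need not be invertible in the domain of \<open>R\<close>, so instead of dividing by
  that of \<open>p\<close> one multiplies \<open>f\<close> by it in each round; \<open>c\<close>
  collects these factors.\<close>

lemma pseudo_division_pairs:
  assumes "(p, q) \<in> poly_pairs R" "p \<noteq> 0" "(f, g) \<in> poly_pairs R"
  shows "\<exists>c d h k r s. (c, d) \<in> R \<and> c \<noteq> 0 \<and> (h, k) \<in> poly_pairs R \<and> (r, s) \<in> poly_pairs R \<and>
    smult c f = p * h + r \<and> smult d g = q * k + s \<and> (r = 0 \<or> degree r < degree p)"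
  using assms(3)
proof (induction "degree f" arbitrary: f g rule: less_induct)
  case less
  show ?case
  proof (cases "f = 0 \<or> degree f < degree p")
    case True
    show ?thesis
      by (rule exI[of _ 1], rule exI[of _ 1], rule exI[of _ 0], rule exI[of _ 0], rule exI[of _ f],
          rule exI[of _ g])
        (use True less.prems piso_one poly_pairs_const[OF piso_zero] in auto)
  next
    case False
    define n where "n = degree f - degree p"
    define a b a' b' where ab: "a = lead_coeff p" "b = lead_coeff q" "a' = lead_coeff f" "b' = lead_coeff g"
    have R: "(a, b) \<in> R" "(a', b') \<in> R"
      using poly_pairs_lead_coeff assms(1) less.prems by (auto simp: ab)
    have "a \<noteq> 0" using assms(2) by (simp add: ab)
    \<comment> \<open>Cross-multiplying by the leading coefficients cancels the leading term of
      \<open>f\<close> against that of a shifted \<open>p\<close>.\<close>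
    define f' g' where fg: "f' = smult a f - p * monom a' n" "g' = smult b g - q * monom b' n"
    have fg': "(f', g') \<in> poly_pairs R"
      unfolding fg by (intro poly_pairs_diff poly_pairs_smult poly_pairs_mult poly_pairs_monom R assms less.prems)
    have small: "f' = 0 \<or> degree f' < degree f"
    proof (cases "degree f = 0")
      case True
      then have "degree p = 0" "n = 0" using False by (auto simp: n_def)
      then obtain u v where "p = [:u:]" "f = [:v:]" using True by (metis degree_eq_zeroE)
      \<comment> \<open>For two constants there is no lower degree to drop to; the cross-multiplied
        difference vanishes by commutativity.\<close>
      then have "f' = 0" by (simp add: fg ab \<open>n = 0\<close> monom_0 mult.commute)
      then show ?thesis ..
    next
      case nz: False
      have deg: "degree (p * monom a' n) \<le> degree f"
        using degree_mult_le[of p "monom a' n"] degree_monom_le[of a' n] False unfolding n_def by linarith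
      have le: "degree f' \<le> degree f" unfolding fg
        by (intro degree_diff_le degree_smult_le deg)
      have "coeff (p * monom a' n) (degree f) = a * a'"
        using False by (subst mult.commute) (simp add: coeff_monom_mult n_def ab)
      then have "coeff f' (degree f) = 0" by (simp add: fg ab)
      then have "degree f' \<noteq> degree f" using nz by (metis leading_coeff_0_iff degree_0)
      then show ?thesis using le by simp
    qed
    have "\<exists>c d h k r s. (c, d) \<in> R \<and> c \<noteq> 0 \<and> (h, k) \<in> poly_pairs R \<and> (r, s) \<in> poly_pairs R \<and>
      smult c f' = p * h + r \<and> smult d g' = q * k + s \<and> (r = 0 \<or> degree r < degree p)"
    proof (cases "f' = 0")
      case True
      then have "g' = 0" using fg' poly_pairs_eq0 by blast
      show ?thesis
        by (rule exI[of _ 1], rule exI[of _ 1], rule exI[of _ 0], rule exI[of _ 0], rule exI[of _ 0],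
            rule exI[of _ 0])
          (use True \<open>g' = 0\<close> piso_one poly_pairs_const[OF piso_zero] in auto)
    next
      case False
      then have "degree f' < degree f" using small by blast
      then show ?thesis using fg' by (rule less.hyps)
    qed
    then obtain c d h k r s where *: "(c, d) \<in> R" "c \<noteq> 0" "(h, k) \<in> poly_pairs R" "(r, s) \<in> poly_pairs R"
      "smult c f' = p * h + r" "smult d g' = q * k + s" "r = 0 \<or> degree r < degree p"
      by blast
    \<comment> \<open>The definition of \<open>f'\<close> is substituted into its own division, and
      the subtracted multiple of \<open>p\<close> moves into the quotient.\<close>
    have "smult (c * a) f = p * (h + smult c (monom a' n)) + r"
      using *(5) by (simp add: fg algebra_simps smult_diff_right)
    moreover have "smult (d * b) g = q * (k + smult d (monom b' n)) + s"
      using *(6) by (simp add: fg algebra_simps smult_diff_right)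
    moreover have "(h + smult c (monom a' n), k + smult d (monom b' n)) \<in> poly_pairs R"
      by (intro poly_pairs_add poly_pairs_smult poly_pairs_monom R *)
    moreover have "(c * a, d * b) \<in> R" "c * a \<noteq> 0"
      using * R piso_mult \<open>a \<noteq> 0\<close> by auto
    moreover note *(4,7)
    ultimately have "(c * a, d * b) \<in> R \<and> c * a \<noteq> 0 \<and>
        (h + smult c (monom a' n), k + smult d (monom b' n)) \<in> poly_pairs R \<and> (r, s) \<in> poly_pairs R \<and>
        smult (c * a) f = p * (h + smult c (monom a' n)) + r \<and>
        smult (d * b) g = q * (k + smult d (monom b' n)) + s \<and> (r = 0 \<or> degree r < degree p)"
      by (intro conjI)
    then show ?thesis by (intro exI)
  qed
qed

end

text \<open>Each closure condition involves at most two pairs, and two pairs from the union of a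
  chain already lie in one member.\<close>

lemma partial_iso_Union:
  assumes "\<C> \<noteq> {}" and chain: "subset.chain \<A> \<C>" and "\<And>R. R \<in> \<C> \<Longrightarrow> partial_iso R"
  shows "partial_iso (\<Union>\<C>)"
proof -
  have common: "\<exists>R\<in>\<C>. u \<in> R \<and> v \<in> R" if "u \<in> \<Union>\<C>" "v \<in> \<Union>\<C>" for u v
    using that chain unfolding subset.chain_def by blast
  show ?thesis
    unfolding partial_iso_def
  proof (intro conjI allI impI)
    show "(1, 1) \<in> \<Union>\<C>" using assms piso_one by blast
  next
    fix x y x' y' assume "(x, y) \<in> \<Union>\<C>" "(x', y') \<in> \<Union>\<C>"
    then obtain R where "R \<in> \<C>" "(x, y) \<in> R" "(x', y') \<in> R" using common by blast
    then show "(x + x', y + y') \<in> \<Union>\<C>" "(x * x', y * y') \<in> \<Union>\<C>"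
      using piso_add piso_mult assms(3) by blast+
  next
    fix x y assume "(x, y) \<in> \<Union>\<C>"
    then obtain R where "R \<in> \<C>" "(x, y) \<in> R" by blast
    then show "(- x, - y) \<in> \<Union>\<C>" "(x = 0) = (y = 0)"
      using piso_uminus piso_eq0 assms(3) by blast+
  qed
qed

text \<open>A transcendental element can always be fixed. The complex field is isomorphic to proper
  subfields of itself, so domain and range are kept equal until only algebraic elements remain.\<close>

lemma partial_automorphism_algebraic:
  fixes R0 :: "('a::idom \<times> 'a) set"
  assumes "partial_iso R0" and "Domain R0 = Range R0"
  obtains R where "partial_iso R" "R0 \<subseteq> R" "Domain R = Range R"
    "\<And>x. \<exists>(p, q)\<in>poly_pairs R. p \<noteq> 0 \<and> poly p x = 0"
proof -
  let ?A = "{R. partial_iso R \<and> R0 \<subseteq> R \<and> Domain R = Range R}"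
  have "\<exists>M\<in>?A. \<forall>X\<in>?A. M \<subseteq> X \<longrightarrow> X = M"
  proof (rule subset_Zorn_nonempty)
    show "?A \<noteq> {}" using assms by blast
    fix \<C> assume C: "\<C> \<noteq> {}" "subset.chain ?A \<C>"
    then have "\<C> \<subseteq> ?A" by (simp add: subset.chain_def)
    then have "Domain (\<Union>\<C>) = Range (\<Union>\<C>)"
      unfolding Domain_Union Range_Union by (intro SUP_cong) blast+
    with \<open>\<C> \<subseteq> ?A\<close> show "\<Union>\<C> \<in> ?A"
      using partial_iso_Union[OF C] C(1) by blast
  qed
  then obtain R where "R \<in> ?A" and maxR: "\<forall>X\<in>?A. R \<subseteq> X \<longrightarrow> X = R" by blast
  then have R: "partial_iso R" "R0 \<subseteq> R" "Domain R = Range R" by auto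
  have max: "X = R" if "partial_iso X" "Domain X = Range X" "R \<subseteq> X" for X
    using maxR that R(2) by auto
  have "\<exists>(p, q)\<in>poly_pairs R. p \<noteq> 0 \<and> poly p x = 0" for x
  proof (rule ccontr)
    \<comment> \<open>Suppose \<open>x\<close> is transcendental over the common domain. Pairing
      \<open>x\<close> with itself then extends \<open>R\<close> and keeps domain and range equal,
      so by maximality \<open>x\<close> was in the domain all along.\<close>
    assume "\<not> ?thesis"
    then have trans1: "poly p x = 0 \<longleftrightarrow> p = 0" if "(p, q) \<in> poly_pairs R" for p q
      using that by (auto split: prod.splits)
    \<comment> \<open>Since domain and range coincide, either component of a pair also occurs as the
      other component of some pair; thus transcendence applies to \<open>q\<close> as well as to
      \<open>p\<close>.\<close>
    have pre: "\<exists>p'. (p', p) \<in> poly_pairs R" "\<exists>q'. (q, q') \<in> poly_pairs R" 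
      if "(p, q) \<in> poly_pairs R" for p q
    proof -
      have *: "coeff p i \<in> Domain R" "coeff p i \<in> Domain (R\<inverse>)" "coeff q i \<in> Domain R" for i
        using that R(3) unfolding poly_pairs_def by auto
      show "\<exists>q'. (q, q') \<in> poly_pairs R" using poly_pairs_exists[OF R(1) *(3)] by auto
      show "\<exists>p'. (p', p) \<in> poly_pairs R"
        using poly_pairs_exists[OF partial_iso_converse[OF R(1)] *(2)] poly_pairs_converse[OF R(1)] by blast
    qed
    have "poly p x = 0 \<longleftrightarrow> poly q x = 0" if "(p, q) \<in> poly_pairs R" for p q
      using trans1 that pre[OF that] poly_pairs_eq0[OF R(1)] by metis
    then have "partial_iso (adjoin R x x)" by (rule partial_iso_adjoin[OF R(1)])
    moreover have "Domain (adjoin R x x) = Range (adjoin R x x)"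
      unfolding adjoin_def using pre by blast
    ultimately have "adjoin R x x = R" using max adjoin_subset[OF R(1)] by blast
    then have "(x, x) \<in> R" using adjoin_self[OF R(1), of x x] by simp
    \<comment> \<open>The linear polynomial with root \<open>x\<close> now has coefficients in the
      domain, contradicting transcendence.\<close>
    then have *: "([:0, 1:] - [:x:], [:0, 1:] - [:x:]) \<in> poly_pairs R"
      using poly_pairs_monom[OF R(1) piso_one[OF R(1)], of 1]
      by (intro poly_pairs_diff poly_pairs_const R) (simp_all add: monom_altdef)
    show False using trans1[OF *] by simp
  qed
  with R that show thesis by blast
qed

text \<open>A substitute for the minimal polynomial: an annihilator of least degree, not made monic
  because its leading coefficient need not be a unit in the domain of \<open>R\<close>.\<close>

lemma minimal_poly_pair:
  assumes "(p0, q0) \<in> poly_pairs R" "p0 \<noteq> 0" "poly p0 x = 0"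
  obtains p q where "(p, q) \<in> poly_pairs R" "p \<noteq> 0" "poly p x = 0"
    "\<And>r s. (r, s) \<in> poly_pairs R \<Longrightarrow> r \<noteq> 0 \<Longrightarrow> poly r x = 0 \<Longrightarrow> degree p \<le> degree r"
proof -
  let ?P = "\<lambda>(p, q). (p, q) \<in> poly_pairs R \<and> p \<noteq> 0 \<and> poly p x = 0"
  have "?P (p0, q0)" using assms by simp
  from ex_has_least_nat[of ?P, OF this, of "\<lambda>(p, q). degree p"]
  obtain p q where "?P (p, q)" "\<And>r s. ?P (r, s) \<Longrightarrow> degree p \<le> degree r"
    by auto
  then show thesis using that[of p q] by auto
qed

text \<open>The partner \<open>y\<close> is a root of the conjugate \<open>q\<close> of the minimal polynomial of \<open>x\<close>. That \<open>q\<close> is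
  in turn minimal for \<open>y\<close> is irreducibility, argued without inverses by pseudo-division.\<close>

lemma algebraic_partner:
  fixes R :: "('a::alg_closed_field \<times> 'a) set"
  assumes R: "partial_iso R" and "(p0, q0) \<in> poly_pairs R" "p0 \<noteq> 0" "poly p0 x = 0"
  obtains y where "\<And>f g. (f, g) \<in> poly_pairs R \<Longrightarrow> poly f x = 0 \<longleftrightarrow> poly g y = 0"
proof -
  obtain p q where p: "(p, q) \<in> poly_pairs R" "p \<noteq> 0" "poly p x = 0"
    and min_p: "\<And>r s. (r, s) \<in> poly_pairs R \<Longrightarrow> r \<noteq> 0 \<Longrightarrow> poly r x = 0 \<Longrightarrow> degree p \<le> degree r"
    using minimal_poly_pair[OF assms(2-4)] by blast
  \<comment> \<open>A nonzero constant \<open>p\<close> could not vanish at \<open>x\<close>, and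
    \<open>q\<close> has the degree of \<open>p\<close>.\<close>
  have "degree q > 0"
    using p poly_pairs_degree[OF R p(1)] by (metis degree_eq_zeroE gr0I mult_zero_right
        pCons_0_0 poly_pCons poly_0 add.right_neutral)
  then obtain y where y: "poly q y = 0" using alg_closed_imp_poly_has_root by blast
  have "q \<noteq> 0" using p poly_pairs_eq0[OF R] by blast
  have "(q, p) \<in> poly_pairs (R\<inverse>)" using p poly_pairs_converse[OF R] by blast
  \<comment> \<open>Here \<open>t\<close> is an annihilator of \<open>y\<close> of least degree on
    the range side and \<open>s\<close> is its partner; the aim is that \<open>t\<close> is no
    shorter than \<open>q\<close>.\<close>
  then obtain t s where st': "(t, s) \<in> poly_pairs (R\<inverse>)" "t \<noteq> 0" "poly t y = 0"
    and min': "\<And>r s. (r, s) \<in> poly_pairs (R\<inverse>) \<Longrightarrow> r \<noteq> 0 \<Longrightarrow> poly r y = 0 \<Longrightarrow> degree t \<le> degree r"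
    using minimal_poly_pair[of q p "R\<inverse>" y] \<open>q \<noteq> 0\<close> y by metis
  have st: "(s, t) \<in> poly_pairs R" using st'(1) poly_pairs_converse[OF R] by blast
  have "s \<noteq> 0" using st st' poly_pairs_eq0[OF R] by blast
  have min_t: "degree t \<le> degree g" if "(f, g) \<in> poly_pairs R" "g \<noteq> 0" "poly g y = 0" for f g
    using min' that poly_pairs_converse[OF R] by blast
  have t_le: "degree t \<le> degree q" using min_t[OF p(1) \<open>q \<noteq> 0\<close> y] .
  have eq_deg: "degree t = degree q"
  proof (rule ccontr)
    assume "degree t \<noteq> degree q"
    then have lt: "degree s < degree p"
      using t_le poly_pairs_degree[OF R st] poly_pairs_degree[OF R p(1)] by simp
    \<comment> \<open>Dividing \<open>q\<close> by \<open>t\<close> leaves a remainder that kills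
      \<open>y\<close> and is too short to be nonzero. On the other side \<open>s\<close> therefore
      divides a multiple of \<open>p\<close>, and \<open>s\<close> or its cofactor \<open>h\<close>,
      both of smaller degree than \<open>p\<close>, would kill \<open>x\<close>.\<close>
    obtain c d h k r u where *: "(c, d) \<in> R" "c \<noteq> 0" "(h, k) \<in> poly_pairs R" "(r, u) \<in> poly_pairs R"
      "smult c p = s * h + r" "smult d q = t * k + u" "r = 0 \<or> degree r < degree s"
      using pseudo_division_pairs[OF R st \<open>s \<noteq> 0\<close> p(1)] by blast
    have "poly u y = 0" using arg_cong[OF *(6), of "\<lambda>g. poly g y"] y st' by simp
    then have "r = 0"
      using min_t[OF *(4)] *(7) poly_pairs_degree[OF R *(4)] poly_pairs_degree[OF R st]
        poly_pairs_eq0[OF R *(4)] by force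
    then have fac: "smult c p = s * h" using *(5) by simp
    then have "h \<noteq> 0" using p(2) *(2) by auto
    have "degree p = degree s + degree h"
      using arg_cong[OF fac, of degree] *(2) \<open>h \<noteq> 0\<close> \<open>s \<noteq> 0\<close> by (simp add: degree_mult_eq)
    moreover have "degree s \<noteq> 0"
      using st' poly_pairs_degree[OF R st] by (metis degree_eq_zeroE mult_zero_right
        pCons_0_0 poly_pCons poly_0 add.right_neutral)
    ultimately have "degree h < degree p" by simp
    moreover have "poly s x = 0 \<or> poly h x = 0"
      using arg_cong[OF fac, of "\<lambda>g. poly g x"] p(3) by simp
    ultimately show False
      using min_p[OF st \<open>s \<noteq> 0\<close>] min_p[OF *(3) \<open>h \<noteq> 0\<close>] lt by auto
  qed
  have "poly f x = 0 \<longleftrightarrow> poly g y = 0" if fg: "(f, g) \<in> poly_pairs R" for f g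
  proof -
    \<comment> \<open>Modulo \<open>p\<close> and \<open>q\<close> the polynomials may be replaced
      by their remainders, which are shorter than the least annihilators on both sides and so vanish
      at \<open>x\<close> or \<open>y\<close> only if they are 0.\<close>
    obtain c d h k r u where *: "(c, d) \<in> R" "c \<noteq> 0" "(h, k) \<in> poly_pairs R" "(r, u) \<in> poly_pairs R"
      "smult c f = p * h + r" "smult d g = q * k + u" "r = 0 \<or> degree r < degree p"
      using pseudo_division_pairs[OF R p(1,2) fg] by blast
    have "d \<noteq> 0" using * piso_eq0[OF R] by blast
    moreover have "c * poly f x = poly r x" "d * poly g y = poly u y"
      using arg_cong[OF *(5), of "\<lambda>g. poly g x"] arg_cong[OF *(6), of "\<lambda>g. poly g y"] p(3) y
      by simp_all
    ultimately have eqs: "poly f x = 0 \<longleftrightarrow> poly r x = 0" "poly u y = 0 \<longleftrightarrow> poly g y = 0"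
      using *(2) by (metis mult_eq_0_iff)+
    have "poly f x = 0 \<longleftrightarrow> poly r x = 0" by (rule eqs(1))
    also have "\<dots> \<longleftrightarrow> r = 0" using min_p[OF *(4)] *(7) by force
    also have "\<dots> \<longleftrightarrow> u = 0" by (rule poly_pairs_eq0[OF R *(4)])
    also have "\<dots> \<longleftrightarrow> poly u y = 0"
      using min_t[OF *(4)] *(7) eq_deg poly_pairs_degree[OF R *(4)] poly_pairs_degree[OF R p(1)] 
        poly_pairs_eq0[OF R *(4)] by force
    also have "\<dots> \<longleftrightarrow> poly g y = 0" by (rule eqs(2))
    finally show ?thesis .
  qed
  then show thesis using that by blast
qed

definition field_automorphism :: "('a::field \<Rightarrow> 'a) \<Rightarrow> bool" where
  "field_automorphism \<sigma> \<longleftrightarrow> bij \<sigma> \<and> (\<forall>x y. \<sigma> (x + y) = \<sigma> x + \<sigma> y \<and> \<sigma> (x * y) = \<sigma> x * \<sigma> y)"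

text \<open>Zorn's lemma is used twice. The first use gives \<open>R1\<close>, with equal domain and
  range over which everything is algebraic. The second may then drop the equality: a maximal
  extension is total by adjoining roots, and so is its converse, as everything is also algebraic
  over the range of \<open>R1\<close>.\<close>

theorem extend_partial_automorphism:
  fixes R0 :: "('a::alg_closed_field \<times> 'a) set"
  assumes "partial_iso R0" and "Domain R0 = Range R0"
  obtains \<sigma> where "field_automorphism \<sigma>" "\<And>x y. (x, y) \<in> R0 \<Longrightarrow> \<sigma> x = y"
proof -
  obtain R1 where R1: "partial_iso R1" "R0 \<subseteq> R1" "Domain R1 = Range R1"
    and alg: "\<And>x. \<exists>(p, q)\<in>poly_pairs R1. p \<noteq> 0 \<and> poly p x = 0"
    by (rule partial_automorphism_algebraic[OF assms]) (use that in blast)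
  let ?A = "{R. partial_iso R \<and> R1 \<subseteq> R}"
  have "\<exists>M\<in>?A. \<forall>X\<in>?A. M \<subseteq> X \<longrightarrow> X = M"
  proof (rule subset_Zorn_nonempty)
    show "?A \<noteq> {}" using R1 by blast
    fix \<C> assume C: "\<C> \<noteq> {}" "subset.chain ?A \<C>"
    then have "\<C> \<subseteq> ?A" by (simp add: subset.chain_def)
    then show "\<Union>\<C> \<in> ?A" using partial_iso_Union[OF C] C(1) by auto
  qed
  then obtain R where "R \<in> ?A" and maxR: "\<forall>X\<in>?A. R \<subseteq> X \<longrightarrow> X = R" by blast
  then have R: "partial_iso R" "R1 \<subseteq> R" by auto
  have max: "X = R" if "partial_iso X" "R \<subseteq> X" for X
    using maxR that R(2) by auto
  \<comment> \<open>Stated for an arbitrary maximal \<open>S\<close> because it serves both for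
    \<open>R\<close> and for the converse of \<open>R\<close>.\<close>
  have total: "\<exists>y. (x, y) \<in> S"
    if S: "partial_iso S" "\<And>X. partial_iso X \<Longrightarrow> S \<subseteq> X \<Longrightarrow> X = S"
      and ann: "\<exists>(p, q)\<in>poly_pairs S. p \<noteq> 0 \<and> poly p x = 0" for S and x :: 'a
  proof -
    obtain p q where "(p, q) \<in> poly_pairs S" "p \<noteq> 0" "poly p x = 0" using ann by blast
    from algebraic_partner[OF S(1) this]
    obtain y where "\<And>f g. (f, g) \<in> poly_pairs S \<Longrightarrow> poly f x = 0 \<longleftrightarrow> poly g y = 0" by blast
    then have "partial_iso (adjoin S x y)" by (rule partial_iso_adjoin[OF S(1)])
    then have "adjoin S x y = S" using S(2) adjoin_subset[OF S(1)] by blast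
    then show ?thesis using adjoin_self[OF S(1), of x y] by auto
  qed
  have dom: "\<exists>y. (x, y) \<in> R" for x
  proof (rule total[OF R(1) max])
    show "\<exists>(p, q)\<in>poly_pairs R. p \<noteq> 0 \<and> poly p x = 0"
      using alg[of x] R(2) unfolding poly_pairs_def by blast
  qed auto
  have ran: "\<exists>x. (x, y) \<in> R" for y
  proof -
    have "\<exists>x. (y, x) \<in> R\<inverse>"
    proof (rule total[OF partial_iso_converse[OF R(1)]])
      fix X assume X: "partial_iso X" "R\<inverse> \<subseteq> X"
      then have "R \<subseteq> X\<inverse>" by auto
      then have "X\<inverse> = R" by (rule max[OF partial_iso_converse[OF X(1)]])
      then show "X = R\<inverse>" by auto
    next
      \<comment> \<open>The coefficients of \<open>p\<close> lie in the domain of \<open>R1\<close>,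
        which is its range, so \<open>p\<close> can be the first component of a pair for the
        converse relation.\<close>
      obtain p q where pq: "(p, q) \<in> poly_pairs R1" "p \<noteq> 0" "poly p y = 0" using alg[of y] by blast
      then have "coeff p i \<in> Domain (R1\<inverse>)" for i using R1(3) by (auto simp: poly_pairs_def)
      then obtain r where "(p, r) \<in> poly_pairs (R1\<inverse>)"
        using poly_pairs_exists[OF partial_iso_converse[OF R1(1)]] by blast
      then have "(p, r) \<in> poly_pairs (R\<inverse>)" using R(2) by (auto simp: poly_pairs_def)
      then show "\<exists>(p, q)\<in>poly_pairs (R\<inverse>). p \<noteq> 0 \<and> poly p y = 0" using pq by blast
    qed
    then show ?thesis by simp
  qed
  define \<sigma> where "\<sigma> x = (THE y. (x, y) \<in> R)" for x
  have \<sigma>: "(x, y) \<in> R \<longleftrightarrow> \<sigma> x = y" for x y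
    unfolding \<sigma>_def using dom piso_unique[OF R(1)] by (metis the_equality)
  have "bij \<sigma>"
    using \<sigma> ran piso_unique[OF R(1)] unfolding bij_def inj_def surj_def by metis
  moreover have "\<sigma> (x + y) = \<sigma> x + \<sigma> y" "\<sigma> (x * y) = \<sigma> x * \<sigma> y" for x y
    using \<sigma> piso_add[OF R(1)] piso_mult[OF R(1)] by metis+
  moreover have "\<sigma> x = y" if "(x, y) \<in> R0" for x y
    using that \<sigma> R(2) R1(2) by blast
  ultimately show thesis
    by (intro that[of \<sigma>]) (simp_all add: field_automorphism_def)
qed

section \<open>Automorphisms and normal closures\<close>

context
  fixes \<sigma> :: "'a::field \<Rightarrow> 'a"
  assumes aut: "field_automorphism \<sigma>"
begin

lemma aut_add: "\<sigma> (x + y) = \<sigma> x + \<sigma> y"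
  and aut_mult: "\<sigma> (x * y) = \<sigma> x * \<sigma> y"
  and aut_bij: "bij \<sigma>"
  using aut by (simp_all add: field_automorphism_def)

lemma aut_zero: "\<sigma> 0 = 0"
  using aut_add[of 0 0] by (metis add.right_neutral add_left_cancel)

lemma aut_eq_iff: "\<sigma> x = \<sigma> y \<longleftrightarrow> x = y"
  using aut_bij by (auto simp: bij_def inj_def)

lemma aut_eq_0_iff: "\<sigma> x = 0 \<longleftrightarrow> x = 0"
  using aut_eq_iff[of x 0] by (simp add: aut_zero)

lemma aut_one: "\<sigma> 1 = 1"
  using aut_mult[of 1 1] by (simp add: aut_eq_0_iff)

lemma aut_uminus: "\<sigma> (- x) = - \<sigma> x"
  using aut_add[of x "- x"] by (simp add: aut_zero add_eq_0_iff)

lemma aut_inverse: "\<sigma> (inverse x) = inverse (\<sigma> x)"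
proof (cases "x = 0")
  case False
  then have "\<sigma> x * \<sigma> (inverse x) = 1" by (simp add: aut_one flip: aut_mult)
  then show ?thesis by (metis inverse_unique)
qed (simp add: aut_zero)

lemma aut_sum: "\<sigma> (sum f A) = (\<Sum>x\<in>A. \<sigma> (f x))"
  by (induction A rule: infinite_finite_induct) (simp_all add: aut_zero aut_add)

lemma aut_power: "\<sigma> (x ^ n) = \<sigma> x ^ n"
  by (induction n) (simp_all add: aut_one aut_mult)

lemma aut_inv: "inv_into UNIV \<sigma> (\<sigma> x) = x" "\<sigma> (inv_into UNIV \<sigma> x) = x"
  using aut_bij by (simp_all add: bij_def surj_f_inv_f)

lemma field_automorphism_inv: "field_automorphism (inv_into UNIV \<sigma>)"
  unfolding field_automorphism_def
proof (intro conjI allI)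
  show "bij (inv_into UNIV \<sigma>)" using aut_bij by (rule bij_imp_bij_inv)
  fix x y
  show "inv_into UNIV \<sigma> (x + y) = inv_into UNIV \<sigma> x + inv_into UNIV \<sigma> y"
    by (subst aut_eq_iff[symmetric]) (simp add: aut_add aut_inv)
  show "inv_into UNIV \<sigma> (x * y) = inv_into UNIV \<sigma> x * inv_into UNIV \<sigma> y"
    by (subst aut_eq_iff[symmetric]) (simp add: aut_mult aut_inv)
qed

end

lemma aut_of_nat:
  assumes "field_automorphism (\<sigma> :: 'a::field_char_0 \<Rightarrow> 'a)" shows "\<sigma> (of_nat n) = of_nat n"
  by (induction n) (simp_all add: aut_zero[OF assms] aut_one[OF assms] aut_add[OF assms])

lemma aut_of_int:
  assumes "field_automorphism (\<sigma> :: 'a::field_char_0 \<Rightarrow> 'a)" shows "\<sigma> (of_int k) = of_int k"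
  by (cases k rule: int_cases) (simp_all add: aut_of_nat[OF assms] aut_uminus[OF assms] aut_add[OF assms] aut_one[OF assms] del: of_nat_Suc)

lemma aut_of_rat:
  assumes "field_automorphism (\<sigma> :: 'a::field_char_0 \<Rightarrow> 'a)" shows "\<sigma> (of_rat r) = of_rat r"
proof -
  obtain a b where "r = Rat.Fract a b" "b > 0" by (cases r)
  then have "(of_rat r :: 'a) = of_int a * inverse (of_int b)"
    by (simp add: of_rat_rat divide_inverse)
  then show ?thesis
    by (simp add: aut_mult[OF assms] aut_inverse[OF assms] aut_of_int[OF assms])
qed

lemma aut_rational_root:
  fixes \<sigma> :: "'a::field_char_0 \<Rightarrow> 'a"
  assumes "field_automorphism \<sigma>" "poly (map_poly of_rat p) x = 0"
  shows "poly (map_poly of_rat p) (\<sigma> x) = 0"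
proof -
  have "poly (map_poly of_rat p) (\<sigma> x) = \<sigma> (poly (map_poly of_rat p) x)"
    by (simp add: poly_altdef aut_sum[OF assms(1)] aut_mult[OF assms(1)] aut_power[OF assms(1)]
        coeff_map_poly aut_of_rat[OF assms(1)])
  then show ?thesis using assms by (simp add: aut_zero)
qed

text \<open>Bridges two conventions: \<open>algebraic\<close> provides an integer polynomial,
  \<open>normal_over_rat\<close> asks for an irreducible rational one. A rational annihilator of
  least degree is irreducible, since one factor of any factorisation again kills
  \<open>x\<close>.\<close>

lemma algebraic_irreducible_root:
  fixes x :: "'a::field_char_0"
  assumes "algebraic x"
  obtains p :: "rat poly" where "Factorial_Ring.irreducible p" "poly (map_poly of_rat p) x = 0"
proof -
  let ?P = "\<lambda>p::rat poly. p \<noteq> 0 \<and> poly (map_poly of_rat p) x = 0"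
  obtain p0 :: "int poly" where p0: "p0 \<noteq> 0" "poly (map_poly of_int p0) x = 0"
    using algebraicE'[OF assms] by blast
  have "map_poly of_rat (map_poly of_int p0 :: rat poly) = (map_poly of_int p0 :: 'a poly)"
    by (intro poly_eqI) (simp add: coeff_map_poly)
  moreover have "(map_poly of_int p0 :: rat poly) \<noteq> 0"
    using p0(1) by (simp add: poly_eq_iff coeff_map_poly)
  ultimately have "?P (map_poly of_int p0)" using p0 by simp
  from ex_has_least_nat[of ?P, OF this, of degree]
  obtain p where p: "?P p" and min: "\<And>r. ?P r \<Longrightarrow> degree p \<le> degree r" by blast
  have mult: "map_poly of_rat (a * b) = (map_poly of_rat a * map_poly of_rat b :: 'a poly)" for a b
    by (intro poly_eqI) (simp add: coeff_map_poly coeff_mult of_rat_sum of_rat_mult)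
  have "Factorial_Ring.irreducible p"
  proof (rule irreducibleI)
    show "p \<noteq> 0" using p by simp
    show "\<not> is_unit p"
    proof
      assume "is_unit p"
      then obtain c where "p = [:c:]" "c \<noteq> 0" using p by (auto simp: is_unit_poly_iff)
      then show False using p by (simp add: map_poly_pCons)
    qed
    fix a b assume ab: "p = a * b"
    then have "a \<noteq> 0" "b \<noteq> 0" using p by auto
    have "?P a \<or> ?P b" using p ab \<open>a \<noteq> 0\<close> \<open>b \<noteq> 0\<close> by (simp add: mult)
    then have "degree p \<le> degree a \<or> degree p \<le> degree b" using min by blast
    moreover have "degree p = degree a + degree b"
      using ab \<open>a \<noteq> 0\<close> \<open>b \<noteq> 0\<close> by (simp add: degree_mult_eq)
    ultimately have "degree b = 0 \<or> degree a = 0" by linarith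
    then show "is_unit a \<or> is_unit b"
      using \<open>a \<noteq> 0\<close> \<open>b \<noteq> 0\<close> by (auto simp: is_unit_iff_degree)
  qed
  then show thesis using that p by blast
qed

section \<open>Normal closures inside the complex numbers\<close>

lemma CC_simps:
  "carrier CC = UNIV" "x \<oplus>\<^bsub>CC\<^esub> y = x + y" "x \<otimes>\<^bsub>CC\<^esub> y = x * y" "\<one>\<^bsub>CC\<^esub> = 1" "\<zero>\<^bsub>CC\<^esub> = 0"
  by (simp_all add: ring_of_type_algebra_def)

lemma CC_a_inv: "\<ominus>\<^bsub>CC\<^esub> x = - x"
proof -
  interpret ring CC by (rule ring_from_type_algebra)
  show ?thesis using r_neg[of x] by (simp add: CC_simps add_eq_0_iff)
qed

lemma normal_closure_incl: "K \<subseteq> normal_closure K"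
  by (auto simp: normal_closure_def)

text \<open>These are the closure properties that \<open>partial_iso\<close> asks for; each passes
  from the normal fields to their intersection.\<close>

lemma normal_closure_closed:
  shows "1 \<in> normal_closure K"
    and "x \<in> normal_closure K \<Longrightarrow> y \<in> normal_closure K \<Longrightarrow> x + y \<in> normal_closure K"
    and "x \<in> normal_closure K \<Longrightarrow> y \<in> normal_closure K \<Longrightarrow> x * y \<in> normal_closure K"
    and "x \<in> normal_closure K \<Longrightarrow> - x \<in> normal_closure K"
proof -
  have "subring L CC" if "normal_over_rat L" for L
    using that subfieldE(1) by (auto simp: normal_over_rat_def)
  note L = subringE[OF this, unfolded CC_simps CC_a_inv]
  show "1 \<in> normal_closure K"
    using L(3) by (auto simp: normal_closure_def)
  show "x \<in> normal_closure K \<Longrightarrow> y \<in> normal_closure K \<Longrightarrow> x + y \<in> normal_closure K"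
    using L(7) by (auto simp: normal_closure_def)
  show "x \<in> normal_closure K \<Longrightarrow> y \<in> normal_closure K \<Longrightarrow> x * y \<in> normal_closure K"
    using L(6) by (auto simp: normal_closure_def)
  show "x \<in> normal_closure K \<Longrightarrow> - x \<in> normal_closure K"
    using L(5) by (auto simp: normal_closure_def)
qed

text \<open>The graph of \<open>q\<close> over the normal closure is a partial isomorphism, and its
  domain equals its range because \<open>q\<close> permutes the normal closure.\<close>

lemma Gal_extends:
  assumes "q \<in> Gal (normal_closure K)"
  obtains \<sigma> where "field_automorphism \<sigma>" "\<And>x. x \<in> normal_closure K \<Longrightarrow> \<sigma> x = q x"
proof -
  let ?N = "normal_closure K"
  note N = normal_closure_closed[where K = K]
  have q: "bij_betw q ?N ?N" "q 1 = 1"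
    and q_add: "\<And>x y. x \<in> ?N \<Longrightarrow> y \<in> ?N \<Longrightarrow> q (x + y) = q x + q y"
    and q_mult: "\<And>x y. x \<in> ?N \<Longrightarrow> y \<in> ?N \<Longrightarrow> q (x * y) = q x * q y"
    using assms by (auto simp: Gal_def ring_iso_def ring_hom_def CC_simps)
  have "0 \<in> ?N" using N(2)[OF N(1) N(4)[OF N(1)]] by simp
  then have q0: "q 0 = 0" using q_add[of 0 0] by simp
  have q_uminus: "q (- x) = - q x" if "x \<in> ?N" for x
    using q_add[OF that N(4)[OF that]] q0 by (simp add: add_eq_0_iff)
  have q_eq0: "q x = 0 \<longleftrightarrow> x = 0" if "x \<in> ?N" for x
    using q(1) q0 that \<open>0 \<in> ?N\<close> unfolding bij_betw_def inj_on_def by metis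
  let ?R = "{(x, q x) | x. x \<in> ?N}"
  have "partial_iso ?R"
    unfolding partial_iso_def using N by (auto simp: q q_add q_mult q_uminus q_eq0)
  moreover have "Domain ?R = ?N" "Range ?R = q ` ?N" by auto
  then have "Domain ?R = Range ?R" using q(1) by (simp add: bij_betw_def)
  ultimately obtain \<sigma> where "field_automorphism \<sigma>" "\<And>x y. (x, y) \<in> ?R \<Longrightarrow> \<sigma> x = y"
    by (rule extend_partial_automorphism) (use that in blast)
  then show thesis using that by auto
qed

text \<open>An automorphism permutes the roots of every rational polynomial, and each normal field
  in the intersection contains all roots of an irreducible one as soon as it contains one.\<close>

lemma aut_normal_closure:
  assumes "field_automorphism \<sigma>" "x \<in> normal_closure K"
  shows "\<sigma> x \<in> normal_closure K"
proof -
  have "\<sigma> x \<in> L" if L: "normal_over_rat L" "K \<subseteq> L" for L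
  proof -
    have "x \<in> L" using assms(2) L by (auto simp: normal_closure_def)
    moreover have "algebraic x" using L(1) \<open>x \<in> L\<close> by (simp add: normal_over_rat_def)
    then obtain p :: "rat poly" where "Factorial_Ring.irreducible p" "poly (map_poly of_rat p) x = 0"
      by (rule algebraic_irreducible_root)
    ultimately show ?thesis
      using L(1) aut_rational_root[OF assms(1)] unfolding normal_over_rat_def by blast
  qed
  then show ?thesis by (auto simp: normal_closure_def)
qed

text \<open>Surjectivity on the normal closure comes from applying \<open>aut_normal_closure\<close>
  to the inverse automorphism. \<open>Gal\<close> constrains a function only on the field, so
  \<sigma> itself is an element and no restriction has to be formed.\<close>

lemma aut_in_Gal:
  assumes "field_automorphism \<sigma>" shows "\<sigma> \<in> Gal (normal_closure K)"
proof -
  have "x \<in> \<sigma> ` normal_closure K" if "x \<in> normal_closure K" for x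
    using aut_normal_closure[OF field_automorphism_inv[OF assms] that] aut_inv(2)[OF assms]
    by (metis imageI)
  then have "bij_betw \<sigma> (normal_closure K) (normal_closure K)"
    using aut_normal_closure[OF assms] by (auto simp: bij_betw_def inj_on_def aut_eq_iff[OF assms])
  moreover have "\<sigma> x = x" if "x \<in> \<rat>" for x
    using that by (cases rule: Rats_cases) (simp add: aut_of_rat[OF assms])
  ultimately show ?thesis
    using aut_normal_closure[OF assms]
    by (auto simp: Gal_def ring_iso_def ring_hom_def CC_simps aut_add[OF assms] aut_mult[OF assms]
        aut_one[OF assms])
qed

section \<open>Matrices between formal direct sums\<close>

text \<open>All that matrix algebra asks of an object; unlike \<open>objs\<close> it does not refer
  to fusion data, so it also applies to morphisms of different categories.\<close>

definition fin_obj :: "'a obj \<Rightarrow> bool" where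
  "fin_obj X \<longleftrightarrow> (\<forall>a. finite (X a))"

lemma objs_fin: "X \<in> objs D \<Longrightarrow> fin_obj X"
  by (simp add: objs_def fin_obj_def)

lemma objs_lab: "X \<in> objs D \<Longrightarrow> i \<in> X a \<Longrightarrow> a \<in> lab D"
  by (auto simp: objs_def)

lemma homsD: "f \<in> homs X Y \<Longrightarrow> f a j i \<noteq> 0 \<Longrightarrow> i \<in> X a \<and> j \<in> Y a"
  by (simp add: homs_def)

lemma homs_0: "f \<in> homs X Y \<Longrightarrow> i \<notin> X a \<or> j \<notin> Y a \<Longrightarrow> f a j i = 0"
  by (auto simp: homs_def)

lemma mat_homs: "mat X Y m \<in> homs X Y"
  by (simp add: mat_def homs_def)

lemma idm_homs: "idm X \<in> homs X X"
  unfolding idm_def by (rule mat_homs)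

text \<open>Recovers the ordinary matrix product: the support of each column of \<open>f\<close>
  lies in the finite set \<open>Y a\<close>.\<close>

lemma cmp_eq_sum:
  assumes "f \<in> homs X Y" "fin_obj Y"
  shows "(g \<star> f) a k i = (\<Sum>j\<in>Y a. g a k j * f a j i)"
  unfolding cmp_def using assms(2)
  by (intro sum.mono_neutral_left) (auto simp: fin_obj_def dest: homsD[OF assms(1)])

lemma cmp_eq_single:
  assumes "\<And>j. f a j i \<noteq> 0 \<Longrightarrow> j = j0"
  shows "(g \<star> f) a k i = g a k j0 * f a j0 i"
proof (cases "f a j0 i = 0")
  case True
  then have "{j. f a j i \<noteq> 0} = {}" using assms by force
  then show ?thesis using True by (simp add: cmp_def)
next
  case False
  then have "{j. f a j i \<noteq> 0} = {j0}" using assms by blast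
  then show ?thesis by (simp add: cmp_def)
qed

text \<open>Here neither the row nor the column alone has to single out \<open>j0\<close>; it is
  enough that all other products vanish.\<close>

lemma cmp_eq_only:
  assumes "f \<in> homs X Y" "fin_obj Y" and only: "\<And>j. j \<noteq> j0 \<Longrightarrow> g a k j * f a j i = 0"
  shows "(g \<star> f) a k i = g a k j0 * f a j0 i"
proof -
  have "(g \<star> f) a k i = (\<Sum>j\<in>Y a. g a k j * f a j i)" by (rule cmp_eq_sum[OF assms(1,2)])
  also have "\<dots> = (\<Sum>j\<in>Y a. if j = j0 then g a k j0 * f a j0 i else 0)"
    using only by (intro sum.cong) auto
  also have "\<dots> = g a k j0 * f a j0 i"
    using assms(1,2) homsD[of f X Y a j0 i] by (auto simp: fin_obj_def sum.delta)
  finally show ?thesis .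
qed

lemma cmp_eq_single_left:
  assumes "f \<in> homs X Y" "fin_obj Y" and "\<And>j. g a k j \<noteq> 0 \<Longrightarrow> j = j0"
  shows "(g \<star> f) a k i = g a k j0 * f a j0 i"
  using assms(3) by (intro cmp_eq_only[OF assms(1,2)]) fastforce

lemma cmp_homs: assumes "f \<in> homs X Y" "g \<in> homs Y Z" shows "g \<star> f \<in> homs X Z"
  unfolding homs_def
proof (intro CollectI allI impI)
  fix a k i assume "(g \<star> f) a k i \<noteq> 0"
  then obtain j where "g a k j * f a j i \<noteq> 0"
    unfolding cmp_def by (rule sum.not_neutral_contains_not_neutral)
  then show "i \<in> X a \<and> k \<in> Z a" using homsD[OF assms(1), of a j i] homsD[OF assms(2), of a k j] by simp
qed

lemma cmp_idm_right: "f \<in> homs X Y \<Longrightarrow> f \<star> idm X = f"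
  by (intro ext, subst cmp_eq_single) (auto simp: idm_def mat_def homs_0 split: if_splits)

lemma cmp_idm_left: "f \<in> homs X Y \<Longrightarrow> fin_obj Y \<Longrightarrow> idm Y \<star> f = f"
  by (intro ext, subst cmp_eq_single_left, assumption+)
    (auto simp: idm_def mat_def homs_0 split: if_splits)

lemma cmp_assoc:
  assumes "f \<in> homs W X" "g \<in> homs X Y" "fin_obj X" "fin_obj Y"
  shows "(h \<star> g) \<star> f = h \<star> (g \<star> f)"
proof (intro ext)
  fix a l i
  have gf: "g \<star> f \<in> homs W Y" by (rule cmp_homs[OF assms(1,2)])
  have "((h \<star> g) \<star> f) a l i = (\<Sum>j\<in>X a. (h \<star> g) a l j * f a j i)"
    by (rule cmp_eq_sum[OF assms(1,3)])
  also have "\<dots> = (\<Sum>j\<in>X a. \<Sum>k\<in>Y a. h a l k * g a k j * f a j i)"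
    by (simp add: cmp_eq_sum[OF assms(2,4)] sum_distrib_right)
  also have "\<dots> = (\<Sum>k\<in>Y a. \<Sum>j\<in>X a. h a l k * g a k j * f a j i)"
    by (rule sum.swap)
  also have "\<dots> = (\<Sum>k\<in>Y a. h a l k * (g \<star> f) a k i)"
    by (simp add: cmp_eq_sum[OF assms(1,3)] sum_distrib_left mult.assoc)
  also have "\<dots> = (h \<star> (g \<star> f)) a l i"
    by (rule cmp_eq_sum[OF gf assms(4), symmetric])
  finally show "((h \<star> g) \<star> f) a l i = (h \<star> (g \<star> f)) a l i" .
qed

lemma is_inv_unique:
  assumes "is_inv X Y f g" "is_inv X Y f g'" "fin_obj X" "fin_obj Y"
  shows "g = g'"
proof -
  have f: "f \<in> homs X Y" and g: "g \<in> homs Y X" "f \<star> g = idm Y" and g': "g' \<in> homs Y X" "g' \<star> f = idm X"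
    using assms by (auto simp: is_inv_def)
  have "g = (g' \<star> f) \<star> g" using g' cmp_idm_left[OF g(1) assms(3)] by simp
  also have "\<dots> = g' \<star> (f \<star> g)" by (rule cmp_assoc[OF g(1) f assms(3,4)])
  also have "\<dots> = g'" using g cmp_idm_right[OF g'(1)] by simp
  finally show ?thesis .
qed

lemma invm_eq: "is_inv X Y f g \<Longrightarrow> fin_obj X \<Longrightarrow> fin_obj Y \<Longrightarrow> invm X Y f = g"
  unfolding invm_def by (rule the_equality) (auto intro: is_inv_unique)

lemma is_inv_cmp:
  assumes f: "is_inv X Y f f'" and g: "is_inv Y Z g g'" and fin: "fin_obj X" "fin_obj Y" "fin_obj Z"
  shows "is_inv X Z (g \<star> f) (f' \<star> g')"
proof -
  have h: "f \<in> homs X Y" "f' \<in> homs Y X" "g \<in> homs Y Z" "g' \<in> homs Z Y"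
    and eq: "f' \<star> f = idm X" "f \<star> f' = idm Y" "g' \<star> g = idm Y" "g \<star> g' = idm Z"
    using f g by (auto simp: is_inv_def)
  have "(f' \<star> g') \<star> (g \<star> f) = f' \<star> ((g' \<star> g) \<star> f)"
    using h fin by (simp add: cmp_assoc[of _ X] cmp_assoc[of _ X Z] cmp_assoc[OF cmp_homs])
  then have 1: "(f' \<star> g') \<star> (g \<star> f) = idm X"
    using eq h fin by (simp add: cmp_idm_left)
  have "(g \<star> f) \<star> (f' \<star> g') = g \<star> ((f \<star> f') \<star> g')"
    using h fin by (simp add: cmp_assoc[of _ Z] cmp_assoc[OF cmp_homs])
  then have "(g \<star> f) \<star> (f' \<star> g') = idm Z"
    using eq h fin by (simp add: cmp_idm_left)
  with 1 show ?thesis using h by (auto simp: is_inv_def intro: cmp_homs)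
qed

lemma is_iso_cmp:
  "is_iso X Y f \<Longrightarrow> is_iso Y Z g \<Longrightarrow> fin_obj X \<Longrightarrow> fin_obj Y \<Longrightarrow> fin_obj Z \<Longrightarrow> is_iso X Z (g \<star> f)"
  unfolding is_iso_def using is_inv_cmp by blast

lemma is_iso_homs: "is_iso X Y f \<Longrightarrow> f \<in> homs X Y"
  by (auto simp: is_iso_def is_inv_def)

lemma is_iso_idm: "fin_obj X \<Longrightarrow> is_iso X X (idm X)"
  unfolding is_iso_def is_inv_def using cmp_idm_right[OF idm_homs] idm_homs by blast

section \<open>Tensor products\<close>

lemma tenO_iff:
  "t \<in> tenO D X Y c \<longleftrightarrow>
    (\<exists>a b i j \<mu>. t = Node a b i j \<mu> \<and> c \<in> lab D \<and> i \<in> X a \<and> j \<in> Y b \<and> \<mu> < fus D a b c)"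
  by (auto simp: tenO_def)

lemma Node_in_tenO [simp]:
  "Node a b i j \<mu> \<in> tenO D X Y c \<longleftrightarrow> c \<in> lab D \<and> i \<in> X a \<and> j \<in> Y b \<and> \<mu> < fus D a b c"
  by (simp add: tenO_iff)

lemma Leaf_notin_tenO [simp]: "Leaf n \<notin> tenO D X Y c"
  by (simp add: tenO_iff)

lemma tenO_objs:
  assumes "finite (lab D)" "X \<in> objs D" "Y \<in> objs D"
  shows "tenO D X Y \<in> objs D"
  unfolding objs_def
proof (intro CollectI conjI allI impI)
  fix c
  have fin: "finite (X a)" "finite (Y a)" for a using assms by (auto simp: objs_def)
  have "tenO D X Y c \<subseteq> (\<Union>a\<in>lab D. \<Union>b\<in>lab D. \<Union>i\<in>X a. \<Union>j\<in>Y b. Node a b i j ` {..<fus D a b c})"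
    using objs_lab[OF assms(2)] objs_lab[OF assms(3)] by (fastforce simp: tenO_iff)
  then show "finite (tenO D X Y c)"
    by (rule finite_subset) (intro finite_UN_I assms fin finite_imageI finite_lessThan)
  show "tenO D X Y c = {}" if "c \<notin> lab D" using that by (auto simp: tenO_def)
qed

lemma unitO_objs: "vac D \<in> lab D \<Longrightarrow> unitO D \<in> objs D"
  by (auto simp: unitO_def objs_def)

lemma dual_objs: "(\<And>a. a \<in> lab D \<Longrightarrow> dua D a \<in> lab D) \<Longrightarrow> X \<in> objs D \<Longrightarrow> dual D X \<in> objs D"
  by (auto simp: dual_def objs_def)

lemma tenM_Node [simp]:
  "tenM D f g c (Node a' b' i' j' \<mu>') (Node a b i j \<mu>) =
    (if a' = a \<and> b' = b \<and> \<mu>' = \<mu> \<and> c \<in> lab D \<and> \<mu> < fus D a b c then f a i' i * g b j' j else 0)"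
  by (simp add: tenM_def)

lemma tenM_nonzero:
  assumes "tenM D f g c t s \<noteq> 0"
  obtains a b i j i' j' \<mu> where "s = Node a b i j \<mu>" "t = Node a b i' j' \<mu>" "c \<in> lab D" "\<mu> < fus D a b c"
    "f a i' i \<noteq> 0" "g b j' j \<noteq> 0"
  using assms unfolding tenM_def by (cases s; cases t) (auto split: if_splits)

lemma tenM_homs:
  assumes "f \<in> homs X X'" "g \<in> homs Y Y'"
  shows "tenM D f g \<in> homs (tenO D X Y) (tenO D X' Y')"
  unfolding homs_def
  by (auto elim!: tenM_nonzero dest: homsD[OF assms(1)] homsD[OF assms(2)])

lemma tenM_idm: "idm X \<boxtimes>\<^bsub>D\<^esub> idm Y = idm (X \<boxdot>\<^bsub>D\<^esub> Y)"
proof (intro ext)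
  fix c t s show "(idm X \<boxtimes>\<^bsub>D\<^esub> idm Y) c t s = idm (X \<boxdot>\<^bsub>D\<^esub> Y) c t s"
    by (cases s; cases t) (auto simp: idm_def mat_def tenM_def)
qed

text \<open>The interchange law. Tensor products of morphisms change only the two copies below a
  node and keep its labels and multiplicity index, so the sum over intermediate trees
  factorises.\<close>

lemma tenM_cmp:
  assumes "finite (lab D)" "f \<in> homs X X'" "g \<in> homs Y Y'" "X' \<in> objs D" "Y' \<in> objs D"
  shows "(f' \<boxtimes>\<^bsub>D\<^esub> g') \<star> (f \<boxtimes>\<^bsub>D\<^esub> g) = (f' \<star> f) \<boxtimes>\<^bsub>D\<^esub> (g' \<star> g)"
proof (intro ext)
  fix c t s
  note fin = objs_fin[OF tenO_objs[OF assms(1,4,5)]]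
  note hom = tenM_homs[OF assms(2,3)]
  note fins = objs_fin[OF assms(4)] objs_fin[OF assms(5)]
  show "((f' \<boxtimes>\<^bsub>D\<^esub> g') \<star> (f \<boxtimes>\<^bsub>D\<^esub> g)) c t s = ((f' \<star> f) \<boxtimes>\<^bsub>D\<^esub> (g' \<star> g)) c t s" (is "?l = ?r")
  proof (cases "\<exists>a b i j i' j' \<mu>. s = Node a b i j \<mu> \<and> t = Node a b i' j' \<mu> \<and> c \<in> lab D \<and> \<mu> < fus D a b c")
    case True
    then obtain a b i j i' j' \<mu> where st: "s = Node a b i j \<mu>" "t = Node a b i' j' \<mu>"
      and c: "c \<in> lab D" "\<mu> < fus D a b c" by blast
    \<comment> \<open>These are the only intermediate trees that contribute: labels and multiplicity
      as in \<open>s\<close> and \<open>t\<close>, with arbitrary copies below.\<close>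
    let ?n = "\<lambda>(p, q). Node a b p q \<mu>"
    have "?l = (\<Sum>r\<in>(X' \<boxdot>\<^bsub>D\<^esub> Y') c. (f' \<boxtimes>\<^bsub>D\<^esub> g') c t r * (f \<boxtimes>\<^bsub>D\<^esub> g) c r s)"
      by (rule cmp_eq_sum[OF hom fin])
    also have "\<dots> = (\<Sum>r\<in>?n ` (X' a \<times> Y' b). (f' \<boxtimes>\<^bsub>D\<^esub> g') c t r * (f \<boxtimes>\<^bsub>D\<^esub> g) c r s)"
    proof (intro sum.mono_neutral_right ballI)
      show "finite ((X' \<boxdot>\<^bsub>D\<^esub> Y') c)" using fin by (simp add: fin_obj_def)
      show "?n ` (X' a \<times> Y' b) \<subseteq> (X' \<boxdot>\<^bsub>D\<^esub> Y') c" using c by auto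
      fix r assume "r \<in> (X' \<boxdot>\<^bsub>D\<^esub> Y') c - ?n ` (X' a \<times> Y' b)"
      then have "(f \<boxtimes>\<^bsub>D\<^esub> g) c r s = 0"
        unfolding st by (auto simp: tenO_iff image_iff split: if_splits)
      then show "(f' \<boxtimes>\<^bsub>D\<^esub> g') c t r * (f \<boxtimes>\<^bsub>D\<^esub> g) c r s = 0" by simp
    qed
    also have "\<dots> = (\<Sum>(p, q)\<in>X' a \<times> Y' b. (f' a i' p * g' b j' q) * (f a p i * g b q j))"
      by (subst sum.reindex) (auto simp: inj_on_def st c split_def)
    also have "\<dots> = (\<Sum>p\<in>X' a. f' a i' p * f a p i) * (\<Sum>q\<in>Y' b. g' b j' q * g b q j)"
      by (simp add: sum_product sum.cartesian_product split_def mult_ac)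
    also have "\<dots> = ?r"
      by (simp add: st c cmp_eq_sum[OF assms(2) fins(1)] cmp_eq_sum[OF assms(3) fins(2)])
    finally show ?thesis .
  next
    case False
    have "?r = 0"
    proof (rule ccontr)
      assume "?r \<noteq> 0"
      then show False using False by (auto elim!: tenM_nonzero)
    qed
    moreover have "?l = 0"
    proof (rule ccontr)
      assume "?l \<noteq> 0"
      then obtain r where "(f' \<boxtimes>\<^bsub>D\<^esub> g') c t r * (f \<boxtimes>\<^bsub>D\<^esub> g) c r s \<noteq> 0"
        unfolding cmp_def by (rule sum.not_neutral_contains_not_neutral)
      then have "(f' \<boxtimes>\<^bsub>D\<^esub> g') c t r \<noteq> 0" "(f \<boxtimes>\<^bsub>D\<^esub> g) c r s \<noteq> 0" by auto
      then show False using False by (auto elim!: tenM_nonzero)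
    qed
    ultimately show ?thesis by simp
  qed
qed

lemma is_iso_tenM:
  assumes "finite (lab D)" "X \<in> objs D" "Y \<in> objs D" "X' \<in> objs D" "Y' \<in> objs D"
    and "is_iso X X' f" "is_iso Y Y' g"
  shows "is_iso (X \<boxdot>\<^bsub>D\<^esub> Y) (X' \<boxdot>\<^bsub>D\<^esub> Y') (f \<boxtimes>\<^bsub>D\<^esub> g)"
proof -
  obtain f' g' where "is_inv X X' f f'" "is_inv Y Y' g g'" using assms(6,7) by (auto simp: is_iso_def)
  then have "is_inv (X \<boxdot>\<^bsub>D\<^esub> Y) (X' \<boxdot>\<^bsub>D\<^esub> Y') (f \<boxtimes>\<^bsub>D\<^esub> g) (f' \<boxtimes>\<^bsub>D\<^esub> g')"
    using assms(1-5) by (auto simp: is_inv_def tenM_homs tenM_cmp tenM_idm)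
  then show ?thesis by (auto simp: is_iso_def)
qed

section \<open>Applying a field automorphism to all matrix entries\<close>

definition conj_mor :: "(complex \<Rightarrow> complex) \<Rightarrow> 'a mor \<Rightarrow> 'a mor" where
  "conj_mor \<sigma> f = (\<lambda>a j i. \<sigma> (f a j i))"

context
  fixes \<sigma> :: "complex \<Rightarrow> complex"
  assumes aut: "field_automorphism \<sigma>"
begin

lemma conj_mor_eq_iff: "conj_mor \<sigma> f = conj_mor \<sigma> g \<longleftrightarrow> f = g"
  by (simp add: conj_mor_def fun_eq_iff aut_eq_iff[OF aut])

lemma conj_mor_inv:
  "conj_mor (inv_into UNIV \<sigma>) (conj_mor \<sigma> f) = f" "conj_mor \<sigma> (conj_mor (inv_into UNIV \<sigma>) f) = f"
  by (simp_all add: conj_mor_def aut_inv[OF aut])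

text \<open>An automorphism sends only 0 to 0, so the support over which \<open>cmp\<close> sums is
  unchanged.\<close>

lemma conj_mor_cmp: "conj_mor \<sigma> (g \<star> f) = conj_mor \<sigma> g \<star> conj_mor \<sigma> f"
  by (simp add: conj_mor_def cmp_def aut_sum[OF aut] aut_mult[OF aut] aut_eq_0_iff[OF aut])

lemma conj_mor_mat: "conj_mor \<sigma> (mat X Y m) = mat X Y (conj_mor \<sigma> m)"
  by (simp add: conj_mor_def mat_def aut_zero[OF aut] fun_eq_iff)

lemma conj_mor_idm: "conj_mor \<sigma> (idm X) = idm X"
  by (simp add: conj_mor_def idm_def mat_def aut_zero[OF aut] aut_one[OF aut] fun_eq_iff)

lemma conj_mor_eq_idm: "conj_mor \<sigma> f = idm X \<longleftrightarrow> f = idm X"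
  using conj_mor_eq_iff[of f "idm X"] by (simp add: conj_mor_idm)

lemma conj_mor_addm: "conj_mor \<sigma> (addm f g) = addm (conj_mor \<sigma> f) (conj_mor \<sigma> g)"
  by (simp add: conj_mor_def addm_def aut_add[OF aut])

lemma conj_mor_sclm: "conj_mor \<sigma> (sclm z f) = sclm (\<sigma> z) (conj_mor \<sigma> f)"
  by (simp add: conj_mor_def sclm_def aut_mult[OF aut])

lemma conj_mor_homs: "conj_mor \<sigma> f \<in> homs X Y \<longleftrightarrow> f \<in> homs X Y"
  by (simp add: conj_mor_def homs_def aut_eq_0_iff[OF aut])

lemma conj_mor_tenM: "conj_mor \<sigma> (f \<boxtimes>\<^bsub>D\<^esub> g) = conj_mor \<sigma> f \<boxtimes>\<^bsub>D\<^esub> conj_mor \<sigma> g"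
  by (auto simp: conj_mor_def tenM_def aut_mult[OF aut] aut_zero[OF aut] fun_eq_iff split: tree.splits)

lemma is_inv_conj_mor: "is_inv X Y (conj_mor \<sigma> f) (conj_mor \<sigma> g) \<longleftrightarrow> is_inv X Y f g"
  by (simp add: is_inv_def conj_mor_homs conj_mor_eq_idm flip: conj_mor_cmp)

lemma is_iso_conj_mor: "is_iso X Y (conj_mor \<sigma> f) \<longleftrightarrow> is_iso X Y f"
  unfolding is_iso_def using is_inv_conj_mor conj_mor_inv(2) by metis

text \<open>\<open>invm\<close> is a definite description; for an isomorphism between finite objects
  it denotes the unique inverse, and conjugation carries inverses to inverses.\<close>

lemma conj_mor_invm:
  assumes "is_iso X Y f" "fin_obj X" "fin_obj Y"
  shows "conj_mor \<sigma> (invm X Y f) = invm X Y (conj_mor \<sigma> f)"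
proof -
  obtain g where "is_inv X Y f g" using assms by (auto simp: is_iso_def)
  then show ?thesis using assms invm_eq is_inv_conj_mor by metis
qed

end

text \<open>A relation, rather than the equation that defines a Galois conjugate, because
  \<open>q\<close> and its extension may differ on \<open>Fsym\<close> entries with indices out of
  range. It covers \<open>galois_crossed q D\<close> and \<open>galois_mtc \<sigma> M\<close>
  alike.\<close>

definition galois_related ::
    "(complex \<Rightarrow> complex) \<Rightarrow> ('a, 'z) fusion_data_scheme \<Rightarrow> ('a, 'z) fusion_data_scheme \<Rightarrow> bool" where
  "galois_related \<sigma> D D' \<longleftrightarrow>
     lab D' = lab D \<and> vac D' = vac D \<and> dua D' = dua D \<and> fus D' = fus D \<and> piv D' = piv D \<and>
     (\<forall>a b c d e f \<mu> \<nu> \<rho> \<tau>. {a, b, c, d, e, f} \<subseteq> lab D \<and>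
        \<mu> < fus D a b e \<and> \<nu> < fus D e c d \<and> \<rho> < fus D b c f \<and> \<tau> < fus D a f d \<longrightarrow>
        Fsym D' a b c d (e, \<mu>, \<nu>) (f, \<rho>, \<tau>) = \<sigma> (Fsym D a b c d (e, \<mu>, \<nu>) (f, \<rho>, \<tau>)))"

lemma spherical_finite: "spherical_fusion D \<Longrightarrow> finite (lab D)"
  and spherical_vac: "spherical_fusion D \<Longrightarrow> vac D \<in> lab D"
  and spherical_dua: "spherical_fusion D \<Longrightarrow> a \<in> lab D \<Longrightarrow> dua D a \<in> lab D \<and> dua D (dua D a) = a"
  and spherical_fus: "spherical_fusion D \<Longrightarrow> a \<in> lab D \<Longrightarrow> b \<in> lab D \<Longrightarrow>
        fus D (vac D) a b = (if a = b then 1 else 0) \<and>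
        fus D a (vac D) b = (if a = b then 1 else 0) \<and>
        fus D a b (vac D) = (if b = dua D a then 1 else 0)"
  and spherical_asc: "spherical_fusion D \<Longrightarrow> X \<in> objs D \<Longrightarrow> Y \<in> objs D \<Longrightarrow> Z \<in> objs D \<Longrightarrow>
        is_iso ((X \<boxdot>\<^bsub>D\<^esub> Y) \<boxdot>\<^bsub>D\<^esub> Z) (X \<boxdot>\<^bsub>D\<^esub> (Y \<boxdot>\<^bsub>D\<^esub> Z)) (asc D X Y Z)"
  and spherical_piv: "spherical_fusion D \<Longrightarrow> a \<in> lab D \<Longrightarrow> piv D a = 1 \<or> piv D a = -1"
  by (simp_all add: spherical_fusion_def)

lemma mat_cong:
  "(\<And>a j i. i \<in> X a \<Longrightarrow> j \<in> Y a \<Longrightarrow> m a j i = n a j i) \<Longrightarrow> mat X Y m = mat X Y n"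
  by (simp add: mat_def fun_eq_iff)

text \<open>\<open>twist\<close> contains the inverse of \<open>run\<close>, and
  \<open>conj_mor_invm\<close> can move conjugation past it only for an isomorphism.\<close>

lemma is_iso_run:
  assumes sph: "spherical_fusion D" and X: "X \<in> objs D"
  shows "is_iso (X \<boxdot>\<^bsub>D\<^esub> unitO D) X (run D X)"
proof -
  let ?U = "X \<boxdot>\<^bsub>D\<^esub> unitO D"
  \<comment> \<open>The inverse attaches to each copy of \<open>a\<close> the single basis vector of
    the space with fusion coefficient \<open>fus D a (vac D) a = 1\<close>, hence multiplicity index
    0.\<close>
  define g :: "'a mor" where
    "g = mat X ?U (\<lambda>a t j. if t = Node a (vac D) j (Leaf 0) 0 then 1 else 0)"
  have U: "t \<in> ?U a \<longleftrightarrow> (\<exists>j\<in>X a. t = Node a (vac D) j (Leaf 0) 0)" for t a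
    using objs_lab[OF X] spherical_fus[OF sph] spherical_vac[OF sph]
    by (auto simp: tenO_iff unitO_def split: if_splits)
  have 1: "run D X \<star> g = idm X"
  proof (intro ext)
    fix a k i
    have "(run D X \<star> g) a k i = run D X a k (Node a (vac D) i (Leaf 0) 0) * g a (Node a (vac D) i (Leaf 0) 0) i"
      by (rule cmp_eq_single) (auto simp: g_def mat_def split: if_splits)
    also have "\<dots> = idm X a k i" by (auto simp: g_def mat_def U run_def idm_def)
    finally show "(run D X \<star> g) a k i = idm X a k i" .
  qed
  have 2: "g \<star> run D X = idm ?U"
  proof (intro ext)
    fix a t s
    show "(g \<star> run D X) a t s = idm ?U a t s"
    proof (cases "s \<in> ?U a")
      case True
      then obtain j where j: "j \<in> X a" "s = Node a (vac D) j (Leaf 0) 0" using U by blast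
      have "(g \<star> run D X) a t s = g a t j * run D X a j s"
        by (rule cmp_eq_single) (auto simp: run_def mat_def j split: if_splits)
      also have "\<dots> = idm ?U a t s"
        using j True by (auto simp: g_def mat_def U run_def idm_def)
      finally show ?thesis .
    next
      case False
      have "g \<star> run D X \<in> homs ?U ?U" by (rule cmp_homs[of _ _ X]) (auto simp: run_def g_def mat_homs)
      then show ?thesis using False homs_0[OF _ disjI1] idm_homs by metis
    qed
  qed
  have "run D X \<in> homs ?U X" "g \<in> homs X ?U" by (simp_all add: run_def g_def mat_homs)
  with 1 2 show ?thesis unfolding is_iso_def is_inv_def by blast
qed

section \<open>Structure morphisms of a fusion category under conjugation\<close>

context
  fixes \<sigma> :: "complex \<Rightarrow> complex" and D D' :: "('a, 'z) fusion_data_scheme"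
  assumes aut: "field_automorphism \<sigma>"
    and rel: "galois_related \<sigma> D D'"
begin

lemma galois_related_simps:
  "lab D' = lab D" "vac D' = vac D" "dua D' = dua D" "fus D' = fus D" "piv D' = piv D"
  using rel by (simp_all add: galois_related_def)

lemma galois_related_F:
  "{a, b, c, d, e, f} \<subseteq> lab D \<Longrightarrow>
   \<mu> < fus D a b e \<Longrightarrow> \<nu> < fus D e c d \<Longrightarrow> \<rho> < fus D b c f \<Longrightarrow> \<tau> < fus D a f d \<Longrightarrow>
   \<sigma> (Fsym D a b c d (e, \<mu>, \<nu>) (f, \<rho>, \<tau>)) = Fsym D' a b c d (e, \<mu>, \<nu>) (f, \<rho>, \<tau>)"
  using rel by (auto simp: galois_related_def)

text \<open>None of these involves an \<open>Fsym\<close> entry, so they are literally the same for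
  \<open>D\<close> and \<open>D'\<close>.\<close>

lemma galois_related_structure:
  "objs D' = objs D" "tenO D' = tenO D" "tenM D' = tenM D" "unitO D' = unitO D" "dual D' = dual D"
  "lun D' = lun D" "run D' = run D" "ev D' = ev D" "pivm D' = pivm D"
  unfolding fun_eq_iff objs_def tenO_def tenM_def unitO_def dual_def lun_def run_def ev_def
      pivm_def galois_related_simps by simp_all

lemma galois_related_ev': "ev' D' = ev' D"
  by (simp add: fun_eq_iff ev'_def galois_related_structure)

lemma conj_lun: "conj_mor \<sigma> (lun D X) = lun D X"
  and conj_run: "conj_mor \<sigma> (run D X) = run D X"
  and conj_ev: "conj_mor \<sigma> (ev D X) = ev D X"
  unfolding lun_def run_def ev_def conj_mor_mat[OF aut]
  by (intro mat_cong; simp add: conj_mor_def aut_zero[OF aut] aut_one[OF aut] split: tree.splits)+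

text \<open>The only scalars that enter are pivotal coefficients, which are 1 or -1 and hence
  fixed.\<close>

lemma conj_ev':
  assumes "spherical_fusion D" "X \<in> objs D" shows "conj_mor \<sigma> (ev' D X) = ev' D X"
proof -
  have "\<sigma> (piv D a) = piv D a" if "i \<in> X a" for a i
    using spherical_piv[OF assms(1) objs_lab[OF assms(2) that]]
    by (auto simp: aut_one[OF aut] aut_uminus[OF aut])
  then have "conj_mor \<sigma> (pivm D X) = pivm D X"
    unfolding pivm_def conj_mor_mat[OF aut]
    by (intro mat_cong) (simp add: conj_mor_def aut_zero[OF aut])
  then show ?thesis
    by (simp add: ev'_def conj_mor_cmp[OF aut] conj_mor_tenM[OF aut] conj_ev conj_mor_idm[OF aut])
qed

text \<open>\<open>mat\<close> cuts the matrix down to trees that occur in the two objects, and the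
  indices read off such trees are in range for \<open>Fsym\<close>.\<close>

lemma conj_asc:
  assumes "X \<in> objs D" "Y \<in> objs D" "Z \<in> objs D"
  shows "conj_mor \<sigma> (asc D X Y Z) = asc D' X Y Z"
  unfolding asc_def conj_mor_mat[OF aut] galois_related_structure
proof (intro mat_cong)
  fix d s t assume "s \<in> ((X \<boxdot>\<^bsub>D\<^esub> Y) \<boxdot>\<^bsub>D\<^esub> Z) d" "t \<in> (X \<boxdot>\<^bsub>D\<^esub> (Y \<boxdot>\<^bsub>D\<^esub> Z)) d"
  then show "conj_mor \<sigma> (\<lambda>d t s. case (s, t) of
     (Node e c (Node a b i j \<mu>) k \<nu>, Node a' f i' (Node b' c' j' k' \<rho>) \<sigma>) \<Rightarrow>
       if a' = a \<and> b' = b \<and> c' = c \<and> i' = i \<and> j' = j \<and> k' = k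
       then Fsym D a b c d (e, \<mu>, \<nu>) (f, \<rho>, \<sigma>) else 0
     | _ \<Rightarrow> 0) d t s = (case (s, t) of
     (Node e c (Node a b i j \<mu>) k \<nu>, Node a' f i' (Node b' c' j' k' \<rho>) \<sigma>) \<Rightarrow>
       if a' = a \<and> b' = b \<and> c' = c \<and> i' = i \<and> j' = j \<and> k' = k
       then Fsym D' a b c d (e, \<mu>, \<nu>) (f, \<rho>, \<sigma>) else 0
     | _ \<Rightarrow> 0)"
    using objs_lab[OF assms(1)] objs_lab[OF assms(2)] objs_lab[OF assms(3)]
    by (auto simp: tenO_iff conj_mor_def aut_zero[OF aut] intro!: galois_related_F)
qed

lemma conj_coev:
  assumes "spherical_fusion D" "X \<in> objs D"
  shows "conj_mor \<sigma> (coev D X) = coev D' X"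
  unfolding coev_def conj_mor_mat[OF aut] galois_related_structure
proof (intro mat_cong)
  fix a s t assume st: "s \<in> unitO D a" "t \<in> (X \<boxdot>\<^bsub>D\<^esub> dual D X) a"
  \<comment> \<open>This entry is in range because the four multiplicities involved, those of the
    unit in \<open>b\<close> times its dual in either order and of \<open>b\<close> in its product
    with the unit on either side, are all 1.\<close>
  have F: "\<sigma> (Fsym D b (dua D b) b b (vac D, 0, 0) (vac D, 0, 0)) =
      Fsym D' b (dua D b) b b (vac D, 0, 0) (vac D, 0, 0)" if "b \<in> lab D" for b
    using that spherical_fus[OF assms(1)] spherical_vac[OF assms(1)] spherical_dua[OF assms(1)]
    by (intro galois_related_F) auto
  show "conj_mor \<sigma> (\<lambda>a t s. case t of
     Node b b' i i' \<mu> \<Rightarrow>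
       if i' = i then inverse (Fsym D b (dua D b) b b (vac D, 0, 0) (vac D, 0, 0)) else 0
     | _ \<Rightarrow> 0) a t s = (case t of
     Node b b' i i' \<mu> \<Rightarrow>
       if i' = i then inverse (Fsym D' b (dua D' b) b b (vac D', 0, 0) (vac D', 0, 0)) else 0
     | _ \<Rightarrow> 0)"
    using st objs_lab[OF assms(2)]
    by (auto simp: tenO_iff conj_mor_def aut_zero[OF aut] aut_inverse[OF aut] F galois_related_simps)
qed

lemma conj_twist:
  assumes sph: "spherical_fusion D" and X: "X \<in> objs D"
  shows "conj_mor \<sigma> (twist D X c) = twist D' X (conj_mor \<sigma> c)"
proof -
  have objs: "dual D X \<in> objs D" "unitO D \<in> objs D"
    using X spherical_dua[OF sph] spherical_vac[OF sph] by (auto intro: dual_objs unitO_objs)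
  have fin: "fin_obj ((X \<boxdot>\<^bsub>D\<^esub> X) \<boxdot>\<^bsub>D\<^esub> dual D X)" "fin_obj (X \<boxdot>\<^bsub>D\<^esub> (X \<boxdot>\<^bsub>D\<^esub> dual D X))"
    "fin_obj (X \<boxdot>\<^bsub>D\<^esub> unitO D)" "fin_obj X"
    using objs X by (blast intro: objs_fin tenO_objs spherical_finite[OF sph])+
  show ?thesis
    unfolding twist_def galois_related_structure galois_related_ev'
    using objs X fin spherical_asc[OF sph] is_iso_run[OF sph X]
    by (simp add: conj_mor_cmp[OF aut] conj_mor_tenM[OF aut] conj_mor_idm[OF aut] conj_run conj_ev'[OF sph]
        conj_asc conj_coev[OF sph] conj_mor_invm[OF aut])
qed

end

section \<open>The group action\<close>

context
  fixes G :: "('g, 'y) monoid_scheme" and D :: "('a, 'g) crossed_data"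
  assumes grp: "group G" and sph: "spherical_fusion D" and act: "crossed_action G D"
begin

interpretation group G by (rule grp)

lemma act_lab: "g \<in> carrier G \<Longrightarrow> a \<in> lab D \<Longrightarrow> act D g a \<in> lab D"
  using act by (auto simp: crossed_action_def)

lemma act_inv:
  assumes "g \<in> carrier G" "a \<in> lab D"
  shows "act D g (act D (inv\<^bsub>G\<^esub> g) a) = a" "act D (inv\<^bsub>G\<^esub> g) (act D g a) = a"
proof -
  have "act D (h \<otimes>\<^bsub>G\<^esub> k) a = act D h (act D k a)" if "h \<in> carrier G" "k \<in> carrier G" for h k
    using act that assms by (auto simp: crossed_action_def)
  moreover have "act D \<one>\<^bsub>G\<^esub> a = a" using act assms by (auto simp: crossed_action_def)
  ultimately show "act D g (act D (inv\<^bsub>G\<^esub> g) a) = a" "act D (inv\<^bsub>G\<^esub> g) (act D g a) = a"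
    using assms r_inv l_inv inv_closed by metis+
qed

lemma actO_objs: "g \<in> carrier G \<Longrightarrow> X \<in> objs D \<Longrightarrow> actO G D g X \<in> objs D"
  by (auto simp: actO_def objs_def)

lemma fin_tenO: "X \<in> objs D \<Longrightarrow> Y \<in> objs D \<Longrightarrow> fin_obj (X \<boxdot>\<^bsub>D\<^esub> Y)"
  by (rule objs_fin[OF tenO_objs[OF spherical_finite[OF sph]]])

lemma fin_actO: "g \<in> carrier G \<Longrightarrow> X \<in> objs D \<Longrightarrow> fin_obj (actO G D g X)"
  by (rule objs_fin[OF actO_objs])

lemma actO_unitO: assumes "g \<in> carrier G" shows "actO G D g (unitO D) = unitO D"
proof -
  have "act D h (vac D) = vac D" if "h \<in> carrier G" for h
    using act that by (auto simp: crossed_action_def)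
  then have "act D (inv\<^bsub>G\<^esub> g) a = vac D \<longleftrightarrow> a = vac D" if "a \<in> lab D" for a
    using act_inv(1)[OF assms that] assms inv_closed by metis
  then show ?thesis
    using spherical_vac[OF sph] by (auto simp: actO_def unitO_def fun_eq_iff)
qed

lemma actM_homs: "f \<in> homs X Y \<Longrightarrow> actM G D g f \<in> homs (actO G D g X) (actO G D g Y)"
  unfolding homs_def by (auto simp: actM_def actO_def)

lemma actM_cmp: "actM G D g (f \<star> h) = actM G D g f \<star> actM G D g h"
  by (auto simp: actM_def cmp_def fun_eq_iff)

lemma actM_idm: "actM G D g (idm X) = idm (actO G D g X)"
  by (auto simp: actM_def actO_def idm_def mat_def fun_eq_iff)

lemma act_ten_homs: "act_ten G D g X Y \<in> homs (actO G D g (X \<boxdot>\<^bsub>D\<^esub> Y)) (actO G D g X \<boxdot>\<^bsub>D\<^esub> actO G D g Y)"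
  unfolding act_ten_def by (rule mat_homs)

lemma act_mul_homs: "act_mul G D g h X \<in> homs (actO G D g (actO G D h X)) (actO G D (g \<otimes>\<^bsub>G\<^esub> h) X)"
  unfolding act_mul_def by (rule mat_homs)

text \<open>\<open>act_ten\<close> changes labels and multiplicity index but not the copies, while
  tensor products of morphisms change only the copies. Either order therefore gives the same product
  of three scalars.\<close>

lemma act_ten_natural:
  assumes g: "g \<in> carrier G" and objs: "X \<in> objs D" "Y \<in> objs D" "X' \<in> objs D" "Y' \<in> objs D"
    and f: "f \<in> homs X X'" and k: "k \<in> homs Y Y'"
  shows "act_ten G D g X' Y' \<star> actM G D g (f \<boxtimes>\<^bsub>D\<^esub> k) =
    (actM G D g f \<boxtimes>\<^bsub>D\<^esub> actM G D g k) \<star> act_ten G D g X Y"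
proof (intro ext)
  fix c t s
  let ?L = "act_ten G D g X' Y' \<star> actM G D g (f \<boxtimes>\<^bsub>D\<^esub> k)"
  let ?R = "(actM G D g f \<boxtimes>\<^bsub>D\<^esub> actM G D g k) \<star> act_ten G D g X Y"
  let ?S = "actO G D g (X \<boxdot>\<^bsub>D\<^esub> Y)" and ?T = "actO G D g X' \<boxdot>\<^bsub>D\<^esub> actO G D g Y'"
  note fk = actM_homs[OF tenM_homs[OF f k], of g D]
  have fin: "fin_obj (actO G D g (X' \<boxdot>\<^bsub>D\<^esub> Y'))"
    by (intro fin_actO[OF g] fin_tenO actO_objs[OF g] tenO_objs spherical_finite[OF sph] objs)
  show "?L c t s = ?R c t s"
  proof (cases "s \<in> ?S c \<and> t \<in> ?T c")
    case False
    have "?L \<in> homs ?S ?T" by (rule cmp_homs[OF fk act_ten_homs])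
    moreover have "?R \<in> homs ?S ?T"
      by (rule cmp_homs[OF act_ten_homs tenM_homs[OF actM_homs[OF f] actM_homs[OF k]]])
    ultimately show ?thesis using False homs_0[of ?L ?S ?T] homs_0[of ?R ?S ?T] by auto
  next
    case True
    then obtain a b i j \<mu> a' b' i' j' \<nu> where st: "s = Node a b i j \<mu>" "t = Node a' b' i' j' \<nu>"
      and c: "c \<in> lab D" "act D (inv\<^bsub>G\<^esub> g) c \<in> lab D" "i \<in> X a" "j \<in> Y b" "\<mu> < fus D a b (act D (inv\<^bsub>G\<^esub> g) c)"
        "a' \<in> lab D" "b' \<in> lab D" "i' \<in> X' (act D (inv\<^bsub>G\<^esub> g) a')" "j' \<in> Y' (act D (inv\<^bsub>G\<^esub> g) b')" "\<nu> < fus D a' b' c"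
      by (auto simp: tenO_iff actO_def split: if_splits)
    have ab: "a \<in> lab D" "b \<in> lab D" using c objs objs_lab by metis+
    show ?thesis
    proof (cases "a' = act D g a \<and> b' = act D g b")
      case True
      then have inv: "act D (inv\<^bsub>G\<^esub> g) a' = a" "act D (inv\<^bsub>G\<^esub> g) b' = b" using act_inv g ab by auto
      \<comment> \<open>On the left the copies change first: the intermediate tree has the labels
        and multiplicity of \<open>s\<close> and the copies of \<open>t\<close>.\<close>
      have "?L c t s = act_ten G D g X' Y' c t (Node a b i' j' \<mu>) * actM G D g (f \<boxtimes>\<^bsub>D\<^esub> k) c (Node a b i' j' \<mu>) s"
        by (rule cmp_eq_only[OF fk fin]) (auto simp: act_ten_def mat_def st actM_def split: tree.splits)
      also have "\<dots> = Usym D g a' b' c \<mu> \<nu> * (f a i' i * k b j' j)"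
        using c ab inv True by (auto simp: act_ten_def mat_def actO_def st actM_def)
      finally have L: "?L c t s = Usym D g a' b' c \<mu> \<nu> * (f a i' i * k b j' j)" .
      have fin': "fin_obj (actO G D g X \<boxdot>\<^bsub>D\<^esub> actO G D g Y)"
        by (intro fin_actO[OF g] fin_tenO actO_objs[OF g] tenO_objs spherical_finite[OF sph] objs)
      \<comment> \<open>On the right the roles are exchanged: labels and multiplicity of
        \<open>t\<close>, copies of \<open>s\<close>.\<close>
      have "?R c t s = (actM G D g f \<boxtimes>\<^bsub>D\<^esub> actM G D g k) c t (Node a' b' i j \<nu>) * act_ten G D g X Y c (Node a' b' i j \<nu>) s"
        by (rule cmp_eq_only[OF act_ten_homs fin']) (auto simp: act_ten_def mat_def st tenM_def split: tree.splits)
      also have "\<dots> = Usym D g a' b' c \<mu> \<nu> * (f a i' i * k b j' j)"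
        using c ab inv True by (auto simp: act_ten_def mat_def actO_def st actM_def)
      finally show ?thesis using L by simp
    next
      case False
      have "?L c t s = 0"
      proof (rule ccontr)
        assume "?L c t s \<noteq> 0"
        then obtain r where "act_ten G D g X' Y' c t r * actM G D g (f \<boxtimes>\<^bsub>D\<^esub> k) c r s \<noteq> 0"
          unfolding cmp_def by (rule sum.not_neutral_contains_not_neutral)
        then show False using False
          by (cases r) (auto simp: act_ten_def mat_def st actM_def split: if_splits)
      qed
      moreover have "?R c t s = 0"
      proof (rule ccontr)
        assume "?R c t s \<noteq> 0"
        then obtain r where "(actM G D g f \<boxtimes>\<^bsub>D\<^esub> actM G D g k) c t r * act_ten G D g X Y c r s \<noteq> 0"
          unfolding cmp_def by (rule sum.not_neutral_contains_not_neutral)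
        then show False using False
          by (cases r) (auto simp: act_ten_def mat_def st split: if_splits)
      qed
      ultimately show ?thesis by simp
    qed
  qed
qed

text \<open>The facts supplied by an equivalence are restricted to objects of the gauged category,
  so closure under tensor products must be known. The computation uses monoidality of
  \<open>act_mul\<close>, the interchange law, equivariance of the factors, and naturality of
  \<open>act_ten\<close> to move \<open>u h\<close> and \<open>v h\<close> under the action of
  \<open>g\<close>.\<close>

lemma equivariant_tenO:
  assumes X: "equivariant G D X u" and Y: "equivariant G D Y v"
  shows "equivariant G D (X \<boxdot>\<^bsub>D\<^esub> Y) (\<lambda>g. (u g \<boxtimes>\<^bsub>D\<^esub> v g) \<star> act_ten G D g X Y)"
  unfolding equivariant_def
proof (intro conjI ballI)
  note [simp] = spherical_finite[OF sph] actO_objs fin_tenO fin_actO tenO_objs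
  have [simp]: "X \<in> objs D" "Y \<in> objs D" using X Y by (auto simp: equivariant_def)
  have u: "is_iso (actO G D g X) X (u g)" and v: "is_iso (actO G D g Y) Y (v g)" if "g \<in> carrier G" for g
    using X Y that by (auto simp: equivariant_def)
  note uh = is_iso_homs[OF u] and vh = is_iso_homs[OF v]
  show "X \<boxdot>\<^bsub>D\<^esub> Y \<in> objs D" by simp
  show "is_iso (actO G D g (X \<boxdot>\<^bsub>D\<^esub> Y)) (X \<boxdot>\<^bsub>D\<^esub> Y) ((u g \<boxtimes>\<^bsub>D\<^esub> v g) \<star> act_ten G D g X Y)"
    if g: "g \<in> carrier G" for g
  proof (rule is_iso_cmp)
    show "is_iso (actO G D g (X \<boxdot>\<^bsub>D\<^esub> Y)) (actO G D g X \<boxdot>\<^bsub>D\<^esub> actO G D g Y) (act_ten G D g X Y)"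
      using act g by (auto simp: crossed_action_def)
    show "is_iso (actO G D g X \<boxdot>\<^bsub>D\<^esub> actO G D g Y) (X \<boxdot>\<^bsub>D\<^esub> Y) (u g \<boxtimes>\<^bsub>D\<^esub> v g)"
      using g by (intro is_iso_tenM u v) simp_all
  qed (use g in simp_all)
  fix g h assume g: "g \<in> carrier G" and h: "h \<in> carrier G"
  let ?gh = "g \<otimes>\<^bsub>G\<^esub> h" and ?hX = "actO G D h X" and ?hY = "actO G D h Y"
  let ?ghX = "actO G D g ?hX" and ?ghY = "actO G D g ?hY"
  have gh: "?gh \<in> carrier G" using g h by simp
  have coh: "act_ten G D ?gh X Y \<star> act_mul G D g h (X \<boxdot>\<^bsub>D\<^esub> Y) =
      (act_mul G D g h X \<boxtimes>\<^bsub>D\<^esub> act_mul G D g h Y) \<star> act_ten G D g ?hX ?hY \<star> actM G D g (act_ten G D h X Y)"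
    using act g h by (auto simp: crossed_action_def)
  have equ: "u ?gh \<star> act_mul G D g h X = u g \<star> actM G D g (u h)"
    and eqv: "v ?gh \<star> act_mul G D g h Y = v g \<star> actM G D g (v h)"
    using X Y g h by (auto simp: equivariant_def)
  let ?W = "act_ten G D g ?hX ?hY \<star> actM G D g (act_ten G D h X Y)"
  have W: "?W \<in> homs (actO G D g (actO G D h (X \<boxdot>\<^bsub>D\<^esub> Y))) (?ghX \<boxdot>\<^bsub>D\<^esub> ?ghY)"
    by (intro cmp_homs[OF actM_homs act_ten_homs] act_ten_homs)
  have "((u ?gh \<boxtimes>\<^bsub>D\<^esub> v ?gh) \<star> act_ten G D ?gh X Y) \<star> act_mul G D g h (X \<boxdot>\<^bsub>D\<^esub> Y) =
      (u ?gh \<boxtimes>\<^bsub>D\<^esub> v ?gh) \<star> (act_mul G D g h X \<boxtimes>\<^bsub>D\<^esub> act_mul G D g h Y) \<star> ?W"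
    using gh by (subst cmp_assoc[OF act_mul_homs act_ten_homs]) (simp_all add: coh)
  also have "\<dots> = ((u ?gh \<boxtimes>\<^bsub>D\<^esub> v ?gh) \<star> (act_mul G D g h X \<boxtimes>\<^bsub>D\<^esub> act_mul G D g h Y)) \<star> ?W"
    using g h gh by (intro cmp_assoc[symmetric, OF W tenM_homs[OF act_mul_homs act_mul_homs]]) simp_all
  also have "(u ?gh \<boxtimes>\<^bsub>D\<^esub> v ?gh) \<star> (act_mul G D g h X \<boxtimes>\<^bsub>D\<^esub> act_mul G D g h Y) =
      (u g \<star> actM G D g (u h)) \<boxtimes>\<^bsub>D\<^esub> (v g \<star> actM G D g (v h))"
    using g h gh by (subst tenM_cmp[OF _ act_mul_homs act_mul_homs]) (simp_all add: equ eqv)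
  also have "\<dots> = (u g \<boxtimes>\<^bsub>D\<^esub> v g) \<star> (actM G D g (u h) \<boxtimes>\<^bsub>D\<^esub> actM G D g (v h))"
    using g h by (intro tenM_cmp[symmetric, OF _ actM_homs[OF uh] actM_homs[OF vh]]) simp_all
  also have "\<dots> \<star> ?W = (u g \<boxtimes>\<^bsub>D\<^esub> v g) \<star> (actM G D g (u h) \<boxtimes>\<^bsub>D\<^esub> actM G D g (v h)) \<star> ?W"
    using g h by (intro cmp_assoc[OF W tenM_homs[OF actM_homs[OF uh] actM_homs[OF vh]]]) simp_all
  also have "(actM G D g (u h) \<boxtimes>\<^bsub>D\<^esub> actM G D g (v h)) \<star> ?W =
      ((actM G D g (u h) \<boxtimes>\<^bsub>D\<^esub> actM G D g (v h)) \<star> act_ten G D g ?hX ?hY) \<star> actM G D g (act_ten G D h X Y)"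
    using g h by (intro cmp_assoc[symmetric, OF actM_homs[OF act_ten_homs] act_ten_homs]) simp_all
  also have "(actM G D g (u h) \<boxtimes>\<^bsub>D\<^esub> actM G D g (v h)) \<star> act_ten G D g ?hX ?hY =
      act_ten G D g X Y \<star> actM G D g (u h \<boxtimes>\<^bsub>D\<^esub> v h)"
    using g h by (intro act_ten_natural[symmetric] uh vh) simp_all
  also have "(act_ten G D g X Y \<star> actM G D g (u h \<boxtimes>\<^bsub>D\<^esub> v h)) \<star> actM G D g (act_ten G D h X Y) =
      act_ten G D g X Y \<star> actM G D g ((u h \<boxtimes>\<^bsub>D\<^esub> v h) \<star> act_ten G D h X Y)"
    unfolding actM_cmp using g h
    by (intro cmp_assoc[OF actM_homs[OF act_ten_homs] actM_homs[OF tenM_homs[OF uh vh]]]) simp_all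
  also have "(u g \<boxtimes>\<^bsub>D\<^esub> v g) \<star> \<dots> =
      ((u g \<boxtimes>\<^bsub>D\<^esub> v g) \<star> act_ten G D g X Y) \<star> actM G D g ((u h \<boxtimes>\<^bsub>D\<^esub> v h) \<star> act_ten G D h X Y)"
    using g h
    by (intro cmp_assoc[symmetric, OF actM_homs[OF cmp_homs[OF act_ten_homs tenM_homs[OF uh vh]]] act_ten_homs]) simp_all
  finally show "((u ?gh \<boxtimes>\<^bsub>D\<^esub> v ?gh) \<star> act_ten G D ?gh X Y) \<star> act_mul G D g h (X \<boxdot>\<^bsub>D\<^esub> Y) =
      ((u g \<boxtimes>\<^bsub>D\<^esub> v g) \<star> act_ten G D g X Y) \<star> actM G D g ((u h \<boxtimes>\<^bsub>D\<^esub> v h) \<star> act_ten G D h X Y)" .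
qed

lemma equivariant_unitO: "equivariant G D (unitO D) (\<lambda>g. idm (unitO D))"
  unfolding equivariant_def
proof (intro conjI ballI)
  have U: "unitO D \<in> objs D" by (rule unitO_objs[OF spherical_vac[OF sph]])
  then show "unitO D \<in> objs D" .
  fix g assume g: "g \<in> carrier G"
  show "is_iso (actO G D g (unitO D)) (unitO D) (idm (unitO D))"
    using is_iso_idm[OF objs_fin[OF U]] by (simp add: actO_unitO[OF g])
  fix h assume h: "h \<in> carrier G"
  have "act_mul G D g h (unitO D) = idm (unitO D)"
    using act g h by (auto simp: crossed_action_def)
  then show "idm (unitO D) \<star> act_mul G D g h (unitO D) = idm (unitO D) \<star> actM G D g (idm (unitO D))"
    by (simp add: actM_idm actO_unitO g)
qed

section \<open>Naturality and equivariance of the unitors\<close>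

lemma lun_natural:
  assumes f: "f \<in> homs Y X" and objs: "X \<in> objs D" "Y \<in> objs D"
  shows "f \<star> lun D Y = lun D X \<star> (idm (unitO D) \<boxtimes>\<^bsub>D\<^esub> f)"
proof (intro ext)
  fix a k s
  let ?R = "lun D X \<star> (idm (unitO D) \<boxtimes>\<^bsub>D\<^esub> f)"
  have U: "s \<in> (unitO D \<boxdot>\<^bsub>D\<^esub> Z) a \<longleftrightarrow> (\<exists>j\<in>Z a. s = Node (vac D) a (Leaf 0) j 0)" if "Z \<in> objs D" for s a Z
    using objs_lab[OF that] spherical_fus[OF sph] spherical_vac[OF sph]
    by (auto simp: tenO_iff unitO_def split: if_splits)
  show "(f \<star> lun D Y) a k s = ?R a k s"
  proof (cases "s \<in> (unitO D \<boxdot>\<^bsub>D\<^esub> Y) a")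
    case False
    have "f \<star> lun D Y \<in> homs (unitO D \<boxdot>\<^bsub>D\<^esub> Y) X" "?R \<in> homs (unitO D \<boxdot>\<^bsub>D\<^esub> Y) X"
      by (intro cmp_homs[OF _ f] cmp_homs[OF tenM_homs[OF idm_homs f]]; simp add: lun_def mat_homs)+
    then show ?thesis using False homs_0 by metis
  next
    case True
    then obtain j where j: "j \<in> Y a" "s = Node (vac D) a (Leaf 0) j 0" using U objs by blast
    have a: "a \<in> lab D" by (rule objs_lab[OF objs(2) j(1)])
    have fus: "fus D (vac D) a a = 1" using spherical_fus[OF sph] spherical_vac[OF sph] a by simp
    have "(f \<star> lun D Y) a k s = f a k j * lun D Y a j s"
      by (rule cmp_eq_single) (auto simp: lun_def mat_def j split: if_splits)
    also have "\<dots> = f a k j" using True j by (simp add: lun_def mat_def)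
    finally have 1: "(f \<star> lun D Y) a k s = f a k j" .
    have "?R a k s = lun D X a k (Node (vac D) a (Leaf 0) k 0) * (idm (unitO D) \<boxtimes>\<^bsub>D\<^esub> f) a (Node (vac D) a (Leaf 0) k 0) s"
      using objs
      by (intro cmp_eq_single_left[OF tenM_homs[OF idm_homs f]])
        (auto simp: lun_def mat_def U fin_tenO
          unitO_objs[OF spherical_vac[OF sph]] split: if_splits)
    also have "\<dots> = f a k j"
      using a fus objs homsD[OF f, of a k j]
      by (auto simp: lun_def mat_def j U idm_def unitO_def)
    finally show ?thesis using 1 by simp
  qed
qed

lemma run_natural:
  assumes f: "f \<in> homs Y X" and objs: "X \<in> objs D" "Y \<in> objs D"
  shows "f \<star> run D Y = run D X \<star> (f \<boxtimes>\<^bsub>D\<^esub> idm (unitO D))"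
proof (intro ext)
  fix a k s
  let ?R = "run D X \<star> (f \<boxtimes>\<^bsub>D\<^esub> idm (unitO D))"
  have U: "s \<in> (Z \<boxdot>\<^bsub>D\<^esub> unitO D) a \<longleftrightarrow> (\<exists>j\<in>Z a. s = Node a (vac D) j (Leaf 0) 0)" if "Z \<in> objs D" for s a Z
    using objs_lab[OF that] spherical_fus[OF sph] spherical_vac[OF sph]
    by (auto simp: tenO_iff unitO_def split: if_splits)
  show "(f \<star> run D Y) a k s = ?R a k s"
  proof (cases "s \<in> (Y \<boxdot>\<^bsub>D\<^esub> unitO D) a")
    case False
    have "f \<star> run D Y \<in> homs (Y \<boxdot>\<^bsub>D\<^esub> unitO D) X" "?R \<in> homs (Y \<boxdot>\<^bsub>D\<^esub> unitO D) X"
      by (intro cmp_homs[OF _ f] cmp_homs[OF tenM_homs[OF f idm_homs]]; simp add: run_def mat_homs)+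
    then show ?thesis using False homs_0 by metis
  next
    case True
    then obtain j where j: "j \<in> Y a" "s = Node a (vac D) j (Leaf 0) 0" using U objs by blast
    have a: "a \<in> lab D" by (rule objs_lab[OF objs(2) j(1)])
    have fus: "fus D a (vac D) a = 1" using spherical_fus[OF sph] spherical_vac[OF sph] a by simp
    have "(f \<star> run D Y) a k s = f a k j * run D Y a j s"
      by (rule cmp_eq_single) (auto simp: run_def mat_def j split: if_splits)
    also have "\<dots> = f a k j" using True j by (simp add: run_def mat_def)
    finally have 1: "(f \<star> run D Y) a k s = f a k j" .
    have "?R a k s = run D X a k (Node a (vac D) k (Leaf 0) 0) * (f \<boxtimes>\<^bsub>D\<^esub> idm (unitO D)) a (Node a (vac D) k (Leaf 0) 0) s"
      using objs
      by (intro cmp_eq_single_left[OF tenM_homs[OF f idm_homs]])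
        (auto simp: run_def mat_def U fin_tenO
          unitO_objs[OF spherical_vac[OF sph]] split: if_splits)
    also have "\<dots> = f a k j"
      using a fus objs homsD[OF f, of a k j]
      by (auto simp: run_def mat_def j U idm_def unitO_def)
    finally show ?thesis using 1 by simp
  qed
qed

text \<open>The unit axiom of the action is combined with naturality of the unitors at
  \<open>u g\<close>. It makes the unitors morphisms of the gauged category, to which functoriality
  of an equivalence applies.\<close>

lemma unitors_equivariant:
  assumes X: "equivariant G D X u" and g: "g \<in> carrier G"
  shows "u g \<star> actM G D g (lun D X) =
      lun D X \<star> (idm (unitO D) \<boxtimes>\<^bsub>D\<^esub> u g) \<star> act_ten G D g (unitO D) X"
    and "u g \<star> actM G D g (run D X) =
      run D X \<star> (u g \<boxtimes>\<^bsub>D\<^esub> idm (unitO D)) \<star> act_ten G D g X (unitO D)"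
proof -
  have Xo: "X \<in> objs D" and u: "u g \<in> homs (actO G D g X) X"
    using X g is_iso_homs by (auto simp: equivariant_def)
  have U: "unitO D \<in> objs D" by (rule unitO_objs[OF spherical_vac[OF sph]])
  note fin = spherical_finite[OF sph]
  have lun: "lun D (actO G D g X) \<star> act_ten G D g (unitO D) X = actM G D g (lun D X)"
    and run: "run D (actO G D g X) \<star> act_ten G D g X (unitO D) = actM G D g (run D X)"
    using act g Xo by (auto simp: crossed_action_def)
  have at: "act_ten G D g (unitO D) X \<in> homs (actO G D g (unitO D \<boxdot>\<^bsub>D\<^esub> X)) (unitO D \<boxdot>\<^bsub>D\<^esub> actO G D g X)"
    "act_ten G D g X (unitO D) \<in> homs (actO G D g (X \<boxdot>\<^bsub>D\<^esub> unitO D)) (actO G D g X \<boxdot>\<^bsub>D\<^esub> unitO D)"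
    using act_ten_homs[of g "unitO D" X] act_ten_homs[of g X "unitO D"] by (simp_all add: actO_unitO[OF g])
  have lr: "lun D Y \<in> homs (unitO D \<boxdot>\<^bsub>D\<^esub> Y) Y" "run D Y \<in> homs (Y \<boxdot>\<^bsub>D\<^esub> unitO D) Y" for Y
    by (simp_all add: lun_def run_def mat_homs)
  have fins: "fin_obj (unitO D \<boxdot>\<^bsub>D\<^esub> actO G D g X)" "fin_obj (actO G D g X)" "fin_obj (unitO D \<boxdot>\<^bsub>D\<^esub> X)"
      "fin_obj (actO G D g X \<boxdot>\<^bsub>D\<^esub> unitO D)" "fin_obj (X \<boxdot>\<^bsub>D\<^esub> unitO D)"
    by (intro fin_tenO fin_actO tenO_objs actO_objs fin U Xo g)+
  have "u g \<star> actM G D g (lun D X) = (u g \<star> lun D (actO G D g X)) \<star> act_ten G D g (unitO D) X"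
    unfolding lun[symmetric] by (rule cmp_assoc[symmetric, OF at(1) lr(1) fins(1,2)])
  also have "\<dots> = (lun D X \<star> (idm (unitO D) \<boxtimes>\<^bsub>D\<^esub> u g)) \<star> act_ten G D g (unitO D) X"
    using lun_natural[OF u Xo actO_objs[OF g Xo]] by simp
  also have "\<dots> = lun D X \<star> (idm (unitO D) \<boxtimes>\<^bsub>D\<^esub> u g) \<star> act_ten G D g (unitO D) X"
    by (rule cmp_assoc[OF at(1) tenM_homs[OF idm_homs u] fins(1,3)])
  finally show "u g \<star> actM G D g (lun D X) = \<dots>" .
  have "u g \<star> actM G D g (run D X) = (u g \<star> run D (actO G D g X)) \<star> act_ten G D g X (unitO D)"
    unfolding run[symmetric] by (rule cmp_assoc[symmetric, OF at(2) lr(2) fins(4,2)])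
  also have "\<dots> = (run D X \<star> (u g \<boxtimes>\<^bsub>D\<^esub> idm (unitO D))) \<star> act_ten G D g X (unitO D)"
    using run_natural[OF u Xo actO_objs[OF g Xo]] by simp
  also have "\<dots> = run D X \<star> (u g \<boxtimes>\<^bsub>D\<^esub> idm (unitO D)) \<star> act_ten G D g X (unitO D)"
    by (rule cmp_assoc[OF at(2) tenM_homs[OF u idm_homs] fins(4,5)])
  finally show "u g \<star> actM G D g (run D X) = \<dots>" .
qed

end

section \<open>Galois conjugation of the extension and of its gauging\<close>

lemma galois_related_mtc: "galois_related \<sigma> M (galois_mtc \<sigma> M)"
  by (simp add: galois_related_def galois_mtc_def)

lemma sector_homogeneous: "X \<in> objs D \<Longrightarrow> homogeneous D g (sector D g X)"
  by (auto simp: homogeneous_def sector_def objs_def)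

text \<open>The condition evaluates the structure only on the carrier; the group axiom involved is
  closure under products, for the value at \<open>g \<otimes> h\<close>.\<close>

lemma equivariant_cong:
  assumes "group G" "\<And>g. g \<in> carrier G \<Longrightarrow> u g = v g"
  shows "equivariant G D X u \<longleftrightarrow> equivariant G D X v"
proof -
  interpret group G by fact
  show ?thesis unfolding equivariant_def using assms(2) by auto
qed

lemma eq_brd_cong: "(\<And>g. g \<in> carrier G \<Longrightarrow> u g = v g) \<Longrightarrow> eq_brd G D X Y u = eq_brd G D X Y v"
  by (simp add: eq_brd_def cong: sum.cong)

context
  fixes G :: "('g, 'y) monoid_scheme" and D :: "('a, 'g) crossed_data" and \<sigma> q :: "complex \<Rightarrow> complex"
  assumes aut: "field_automorphism \<sigma>"
    and agree: "\<And>x. x \<in> crossed_entries G D \<Longrightarrow> \<sigma> x = q x"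
    and grp: "group G" and sph: "spherical_fusion D" and act: "crossed_action G D"
begin

interpretation group G by (rule grp)

text \<open>\<open>galois_crossed\<close> applies \<open>q\<close> to every value of
  \<open>Fsym\<close>, and \<sigma> agrees with \<open>q\<close> on the genuine entries, which are
  the ones that \<open>galois_related\<close> compares.\<close>

lemma galois_related_crossed: "galois_related \<sigma> D (galois_crossed q D)"
  unfolding galois_related_def
proof (intro conjI allI impI)
  fix a b c d e f \<mu> \<nu> \<rho> \<tau>
  assume in_range: "{a, b, c, d, e, f} \<subseteq> lab D \<and>
        \<mu> < fus D a b e \<and> \<nu> < fus D e c d \<and> \<rho> < fus D b c f \<and> \<tau> < fus D a f d"
  have "Fsym D a b c d (e, \<mu>, \<nu>) (f, \<rho>, \<tau>) \<in> F_entries D"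
    unfolding F_entries_def
    by (rule CollectI, rule exI[of _ a], rule exI[of _ b], rule exI[of _ c], rule exI[of _ d],
        rule exI[of _ e], rule exI[of _ f], rule exI[of _ \<mu>], rule exI[of _ \<nu>], rule exI[of _ \<rho>],
        rule exI[of _ \<tau>]) (rule conjI[OF refl in_range])
  then have "Fsym D a b c d (e, \<mu>, \<nu>) (f, \<rho>, \<tau>) \<in> crossed_entries G D"
    by (simp add: crossed_entries_def)
  then show "Fsym (galois_crossed q D) a b c d (e, \<mu>, \<nu>) (f, \<rho>, \<tau>) = \<sigma> (Fsym D a b c d (e, \<mu>, \<nu>) (f, \<rho>, \<tau>))"
    using agree by (simp add: galois_crossed_def)
qed (simp_all add: galois_crossed_def)

lemma galois_crossed_simps:
  "lab (galois_crossed q D) = lab D" "fus (galois_crossed q D) = fus D"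
  "grd (galois_crossed q D) = grd D" "act (galois_crossed q D) = act D"
  by (simp_all add: galois_crossed_def)

lemmas galois_crossed_structure = galois_related_structure[OF aut galois_related_crossed]

lemma galois_crossed_act:
  "actO G (galois_crossed q D) = actO G D" "actM G (galois_crossed q D) = actM G D"
  "sector (galois_crossed q D) = sector D"
  unfolding fun_eq_iff actO_def actM_def sector_def galois_crossed_simps by simp_all

lemma conj_actM: "conj_mor \<sigma> (actM G D g f) = actM G D g (conj_mor \<sigma> f)"
  by (simp add: conj_mor_def actM_def aut_zero[OF aut] fun_eq_iff)

lemma conj_act_ten:
  assumes g: "g \<in> carrier G" and objs: "X \<in> objs D" "Y \<in> objs D"
  shows "conj_mor \<sigma> (act_ten G D g X Y) = act_ten G (galois_crossed q D) g X Y"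
  unfolding act_ten_def conj_mor_mat[OF aut] galois_crossed_act galois_crossed_structure
proof (intro mat_cong)
  fix c t s
  assume s: "s \<in> actO G D g (X \<boxdot>\<^bsub>D\<^esub> Y) c" and t: "t \<in> (actO G D g X \<boxdot>\<^bsub>D\<^esub> actO G D g Y) c"
  have U: "\<sigma> (Usym D g (act D g a) (act D g b) c \<mu> \<nu>) = q (Usym D g (act D g a) (act D g b) c \<mu> \<nu>)"
    if "a \<in> lab D" "b \<in> lab D" "c \<in> lab D" "\<mu> < fus D a b (act D (inv\<^bsub>G\<^esub> g) c)" "\<nu> < fus D (act D g a) (act D g b) c"
    for a b \<mu> \<nu>
  proof -
    \<comment> \<open>\<open>crossed_entries\<close> lists the \<open>Usym\<close> entries with
      every label written as an image under \<open>g\<close>; \<open>?c\<close> is the preimage that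
      puts \<open>c\<close> into this form.\<close>
    let ?c = "act D (inv\<^bsub>G\<^esub> g) c"
    have "act D g ?c = c" "?c \<in> lab D"
      using act_inv(1)[OF grp sph act g] act_lab[OF grp sph act] g that by auto
    then have "Usym D g (act D g a) (act D g b) c \<mu> \<nu> \<in>
        {Usym D g (act D g a) (act D g b) (act D g c) \<mu> \<nu> | g a b c \<mu> \<nu>.
        g \<in> carrier G \<and> {a, b, c} \<subseteq> lab D \<and> \<mu> < fus D a b c \<and>
        \<nu> < fus D (act D g a) (act D g b) (act D g c)}"
      using that g by (intro CollectI exI[of _ g] exI[of _ a] exI[of _ b] exI[of _ ?c] exI[of _ \<mu>] exI[of _ \<nu>]) auto
    then show ?thesis by (intro agree) (simp add: crossed_entries_def)
  qed
  show "conj_mor \<sigma> (\<lambda>c t s. case (s, t) of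
        (Node a b i j \<mu>, Node a' b' i' j' \<nu>) \<Rightarrow>
          if a' = act D g a \<and> b' = act D g b \<and> i' = i \<and> j' = j
          then Usym D g a' b' c \<mu> \<nu> else 0
      | _ \<Rightarrow> 0) c t s = (case (s, t) of
        (Node a b i j \<mu>, Node a' b' i' j' \<nu>) \<Rightarrow>
          if a' = act (galois_crossed q D) g a \<and> b' = act (galois_crossed q D) g b \<and> i' = i \<and> j' = j
          then Usym (galois_crossed q D) g a' b' c \<mu> \<nu> else 0
      | _ \<Rightarrow> 0)"
    using s t objs_lab[OF objs(1)] objs_lab[OF objs(2)]
    by (auto simp: tenO_iff actO_def conj_mor_def aut_zero[OF aut] galois_crossed_def U split: if_splits)
qed

lemma conj_act_mul:
  assumes g: "g \<in> carrier G" and h: "h \<in> carrier G"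
  shows "conj_mor \<sigma> (act_mul G D g h X) = act_mul G (galois_crossed q D) g h X"
  unfolding act_mul_def conj_mor_mat[OF aut] galois_crossed_act
proof (intro mat_cong)
  fix a j i assume "i \<in> actO G D g (actO G D h X) a"
  then have "a \<in> lab D" by (auto simp: actO_def split: if_splits)
  then have "eta D a g h \<in> crossed_entries G D" using g h by (auto simp: crossed_entries_def)
  then show "conj_mor \<sigma> (\<lambda>a j i. if i = j then eta D a g h else 0) a j i =
      (if i = j then eta (galois_crossed q D) a g h else 0)"
    by (simp add: conj_mor_def aut_zero[OF aut] galois_crossed_def agree)
qed

text \<open>In \<open>crossed_entries\<close> the label \<open>b\<close> is moved by the degree of
  \<open>a\<close>; homogeneity identifies that degree with the \<open>g\<close> used by
  \<open>xbrd\<close>.\<close>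

lemma conj_xbrd:
  assumes X: "homogeneous D g X" and Y: "Y \<in> objs D"
  shows "conj_mor \<sigma> (xbrd G D g X Y) = xbrd G (galois_crossed q D) g X Y"
  unfolding xbrd_def conj_mor_mat[OF aut] galois_crossed_act galois_crossed_structure
proof (intro mat_cong)
  fix c t s
  assume s: "s \<in> (X \<boxdot>\<^bsub>D\<^esub> Y) c" and t: "t \<in> (actO G D g Y \<boxdot>\<^bsub>D\<^esub> X) c"
  have "X \<in> objs D" using X by (simp add: homogeneous_def)
  have U: "\<sigma> (Xsym D a b c \<mu> \<nu>) = q (Xsym D a b c \<mu> \<nu>)"
    if "i \<in> X a" "b \<in> lab D" "c \<in> lab D" "\<mu> < fus D a b c" "\<nu> < fus D (act D g b) a c" for i a b \<mu> \<nu>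
  proof -
    have "grd D a = g" "a \<in> lab D"
      using X that(1) objs_lab[OF \<open>X \<in> objs D\<close>] by (auto simp: homogeneous_def)
    then have "Xsym D a b c \<mu> \<nu> \<in> crossed_entries G D"
      using that unfolding crossed_entries_def by auto
    then show ?thesis by (rule agree)
  qed
  show "conj_mor \<sigma> (\<lambda>c t s. case (s, t) of
     (Node a b i j \<mu>, Node b' a' j' i' \<nu>) \<Rightarrow>
       if a' = a \<and> b' = act D g b \<and> i' = i \<and> j' = j then Xsym D a b c \<mu> \<nu> else 0
   | _ \<Rightarrow> 0) c t s = (case (s, t) of
     (Node a b i j \<mu>, Node b' a' j' i' \<nu>) \<Rightarrow>
       if a' = a \<and> b' = act (galois_crossed q D) g b \<and> i' = i \<and> j' = j
       then Xsym (galois_crossed q D) a b c \<mu> \<nu> else 0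
   | _ \<Rightarrow> 0)"
    using s t objs_lab[OF Y]
    by (auto simp: tenO_iff conj_mor_def aut_zero[OF aut] galois_crossed_def U)
qed

text \<open>The braiding is a sum over the sectors of \<open>X\<close>, each of them homogeneous, so
  \<open>conj_xbrd\<close> applies to every summand.\<close>

lemma conj_eq_brd:
  assumes "X \<in> objs D" "Y \<in> objs D"
  shows "conj_mor \<sigma> (eq_brd G D X Y v) = eq_brd G (galois_crossed q D) X Y (\<lambda>g. conj_mor \<sigma> (v g))"
proof -
  have "conj_mor \<sigma> (v g \<boxtimes>\<^bsub>D\<^esub> idm (sector D g X) \<star> xbrd G D g (sector D g X) Y) =
      conj_mor \<sigma> (v g) \<boxtimes>\<^bsub>D\<^esub> idm (sector D g X) \<star> xbrd G (galois_crossed q D) g (sector D g X) Y" for g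
    by (simp add: conj_mor_cmp[OF aut] conj_mor_tenM[OF aut] conj_mor_idm[OF aut]
        conj_xbrd[OF sector_homogeneous[OF assms(1)] assms(2)])
  then show ?thesis
    unfolding eq_brd_def galois_crossed_act galois_crossed_structure
    by (simp add: conj_mor_def aut_sum[OF aut] fun_eq_iff)
qed

text \<open>Entrywise application of \<sigma> is injective and compatible with composition, so it
  preserves and reflects both invertibility and the cocycle identity.\<close>

lemma conj_equivariant:
  "equivariant G (galois_crossed q D) X (\<lambda>g. conj_mor \<sigma> (u g)) \<longleftrightarrow> equivariant G D X u"
proof -
  have "conj_mor \<sigma> (u (g \<otimes>\<^bsub>G\<^esub> h)) \<star> act_mul G (galois_crossed q D) g h X = conj_mor \<sigma> (u g) \<star> actM G D g (conj_mor \<sigma> (u h))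
      \<longleftrightarrow> u (g \<otimes>\<^bsub>G\<^esub> h) \<star> act_mul G D g h X = u g \<star> actM G D g (u h)"
    if "g \<in> carrier G" "h \<in> carrier G" for g h
    using conj_mor_eq_iff[OF aut, of "u (g \<otimes>\<^bsub>G\<^esub> h) \<star> act_mul G D g h X" "u g \<star> actM G D g (u h)"]
    by (simp add: conj_mor_cmp[OF aut] conj_act_mul[OF that] conj_actM)
  then show ?thesis
    unfolding equivariant_def galois_crossed_act galois_crossed_structure
    by (simp add: is_iso_conj_mor[OF aut])
qed

end

section \<open>Conjugating an equivalence\<close>

lemma iso_in_mtc_cat: "iso_in (mtc_cat M) X Y f \<longleftrightarrow> is_iso X Y f"
  by (auto simp: iso_in_def mtc_cat_def is_iso_def is_inv_def)

locale gauged_extension =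
  fixes G :: "('g, 'y) monoid_scheme" and D :: "('a, 'g) crossed_data" and M :: "'b mtc_data"
    and Fo Fm J J0
  assumes grp: "group G" and sph: "spherical_fusion D" and act: "crossed_action G D"
    and sph_M: "spherical_fusion M"
    and equiv: "ribbon_equivalence (gauging G D) (mtc_cat M) Fo Fm J J0"
begin

interpretation group G by (rule grp)

abbreviation "\<A> \<equiv> gauging G D"

lemma Ob_iff: "x \<in> Ob \<A> \<longleftrightarrow> equivariant G D (fst x) (snd x)"
  by (simp add: gauging_def split_def)

lemma Mor_iff: "f \<in> Mor \<A> x y \<longleftrightarrow>
    f \<in> homs (fst x) (fst y) \<and> (\<forall>g\<in>carrier G. snd y g \<star> actM G D g f = f \<star> snd x g)"
  by (simp add: gauging_def split_def)

lemma gauging_simps: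
  "Cmp \<A> = cmp" "Ide \<A> x = idm (fst x)" "Add \<A> = addm" "Scl \<A> = sclm" "TenM \<A> = tenM D"
  "TenO \<A> x y = (fst x \<boxdot>\<^bsub>D\<^esub> fst y, \<lambda>g. (snd x g \<boxtimes>\<^bsub>D\<^esub> snd y g) \<star> act_ten G D g (fst x) (fst y))"
  "Unt \<A> = (unitO D, \<lambda>g. idm (unitO D))" "Asc \<A> x y z = asc D (fst x) (fst y) (fst z)"
  "Lun \<A> x = lun D (fst x)" "Run \<A> x = run D (fst x)"
  "Brd \<A> x y = eq_brd G D (fst x) (fst y) (snd y)"
  "Twi \<A> x = twist D (fst x) (eq_brd G D (fst x) (fst x) (snd x))"
  by (simp_all add: gauging_def split_def)

lemma mtc_simps:
  "Ob (mtc_cat N) = objs N" "Mor (mtc_cat N) = homs" "Cmp (mtc_cat N) = cmp" "Ide (mtc_cat N) = idm"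
  "Add (mtc_cat N) = addm" "Scl (mtc_cat N) = sclm" "TenO (mtc_cat N) = tenO N" "TenM (mtc_cat N) = tenM N"
  "Unt (mtc_cat N) = unitO N" "Asc (mtc_cat N) = asc N" "Lun (mtc_cat N) = lun N" "Run (mtc_cat N) = run N"
  "Brd (mtc_cat N) = brd N" "Twi (mtc_cat N) = (\<lambda>X. twist N X (brd N X X))"
  by (simp_all add: mtc_cat_def)

lemma objs_of_Ob: "x \<in> Ob \<A> \<Longrightarrow> fst x \<in> objs D"
  by (simp add: Ob_iff equivariant_def)

lemma TenO_closed: "x \<in> Ob \<A> \<Longrightarrow> y \<in> Ob \<A> \<Longrightarrow> TenO \<A> x y \<in> Ob \<A>"
  using equivariant_tenO[OF grp sph act] by (simp add: Ob_iff gauging_simps)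

lemma Unt_closed: "Unt \<A> \<in> Ob \<A>"
  using equivariant_unitO[OF grp sph act] by (simp add: Ob_iff gauging_simps)

text \<open>An equivariant structure may take arbitrary values off the carrier of the group, so an
  equivariant object of the paper has several, isomorphic, representatives.\<close>

definition same_obj :: "'a obj \<times> ('g \<Rightarrow> 'a mor) \<Rightarrow> 'a obj \<times> ('g \<Rightarrow> 'a mor) \<Rightarrow> bool" where
  "same_obj x y \<longleftrightarrow> fst x = fst y \<and> (\<forall>g\<in>carrier G. snd x g = snd y g)"

lemma same_obj_Ob: "same_obj x y \<Longrightarrow> x \<in> Ob \<A> \<longleftrightarrow> y \<in> Ob \<A>"
  unfolding same_obj_def Ob_iff using equivariant_cong[OF grp, of "snd x" "snd y" D "fst x"] by simp

lemma same_obj_sym: "same_obj x y \<Longrightarrow> same_obj y x"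
  by (simp add: same_obj_def)

lemma idm_Mor:
  assumes "same_obj x y" "x \<in> Ob \<A>" shows "idm (fst x) \<in> Mor \<A> x y"
  unfolding Mor_iff
proof (intro conjI ballI)
  show "idm (fst x) \<in> homs (fst x) (fst y)" using assms idm_homs by (simp add: same_obj_def)
  fix g assume g: "g \<in> carrier G"
  have u: "snd x g \<in> homs (actO G D g (fst x)) (fst x)"
    using assms(2) g is_iso_homs by (auto simp: Ob_iff equivariant_def)
  have "idm (fst x) \<star> snd x g = snd x g"
    by (rule cmp_idm_left[OF u objs_fin[OF objs_of_Ob[OF assms(2)]]])
  moreover have "snd x g \<star> idm (actO G D g (fst x)) = snd x g" by (rule cmp_idm_right[OF u])
  ultimately show "snd y g \<star> actM G D g (idm (fst x)) = idm (fst x) \<star> snd x g"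
    using assms(1) g by (simp add: actM_idm[OF grp sph act] same_obj_def)
qed

text \<open>The equations for \<open>TenO\<close> and \<open>Unt\<close> of the gauged category are
  left folded, so that the arguments of \<open>Fo\<close>, \<open>Fm\<close> and \<open>J\<close>
  remain visible as objects.\<close>

lemmas equiv_1 = equiv[unfolded ribbon_equivalence_def gauging_simps(1-5,8-12) mtc_simps iso_in_mtc_cat]
lemmas equiv_2 = equiv_1[THEN conjunct2]
lemmas equiv_3 = equiv_2[THEN conjunct2]
lemmas equiv_4 = equiv_3[THEN conjunct2]
lemmas equiv_5 = equiv_4[THEN conjunct2]
lemmas equiv_6 = equiv_5[THEN conjunct2]
lemmas equiv_7 = equiv_6[THEN conjunct2]
lemmas equiv_8 = equiv_7[THEN conjunct2]
lemmas equiv_9 = equiv_8[THEN conjunct2]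
lemmas equiv_10 = equiv_9[THEN conjunct2]
lemmas equiv_11 = equiv_10[THEN conjunct2]
lemmas equiv_12 = equiv_11[THEN conjunct2]
lemmas equiv_13 = equiv_12[THEN conjunct2]
lemmas equiv_14 = equiv_13[THEN conjunct2]
lemmas Fo_objs = equiv_1[THEN conjunct1, rule_format]
lemmas Fm_bij = equiv_2[THEN conjunct1, rule_format]
lemmas Fo_surj = equiv_3[THEN conjunct1, rule_format]
lemmas Fm_idm = equiv_4[THEN conjunct1, rule_format]
lemmas Fm_cmp = equiv_5[THEN conjunct1, rule_format]
lemmas Fm_addm = equiv_6[THEN conjunct1, rule_format]
lemmas Fm_sclm = equiv_7[THEN conjunct1, rule_format]
lemmas J0_iso = equiv_8[THEN conjunct1, rule_format]
lemmas J_iso = equiv_9[THEN conjunct1, rule_format]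
lemmas J_natural = equiv_10[THEN conjunct1, rule_format]
lemmas J_asc = equiv_11[THEN conjunct1, rule_format]
lemmas J_lun = equiv_12[THEN conjunct1, rule_format, THEN conjunct1]
lemmas J_run = equiv_12[THEN conjunct1, rule_format, THEN conjunct2]
lemmas J_brd = equiv_13[THEN conjunct1, rule_format]
lemmas Fm_twist = equiv_14[rule_format]

lemma Fm_homs: "x \<in> Ob \<A> \<Longrightarrow> y \<in> Ob \<A> \<Longrightarrow> f \<in> Mor \<A> x y \<Longrightarrow> Fm x y f \<in> homs (Fo x) (Fo y)"
  using Fm_bij bij_betwE by blast

text \<open>The identity matrix is a morphism in both directions between two representatives, and
  functoriality turns this into mutually inverse morphisms, although \<open>Fo x\<close> and
  \<open>Fo y\<close> may be different.\<close>

lemma Fm_same_obj_iso: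
  assumes "same_obj x y" "x \<in> Ob \<A>"
  shows "is_iso (Fo x) (Fo y) (Fm x y (idm (fst x)))"
proof -
  have y: "y \<in> Ob \<A>" using assms(2) same_obj_Ob[OF assms(1)] by simp
  have eq: "fst y = fst x" using assms(1) by (simp add: same_obj_def)
  have xy: "idm (fst x) \<in> Mor \<A> x y" by (rule idm_Mor[OF assms])
  have yx: "idm (fst x) \<in> Mor \<A> y x" using idm_Mor[OF same_obj_sym[OF assms(1)] y] by (simp add: eq)
  have "idm (fst x) \<star> idm (fst x) = idm (fst x)" by (rule cmp_idm_right[OF idm_homs])
  then have "is_inv (Fo x) (Fo y) (Fm x y (idm (fst x))) (Fm y x (idm (fst x)))"
    unfolding is_inv_def
    using Fm_cmp[OF assms(2) y assms(2) xy yx] Fm_cmp[OF y assms(2) y yx xy]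
      Fm_homs[OF assms(2) y xy] Fm_homs[OF y assms(2) yx] Fm_idm[OF assms(2)] Fm_idm[OF y]
    by (simp add: eq)
  then show ?thesis by (auto simp: is_iso_def)
qed

lemma same_obj_TenO:
  "same_obj x x' \<Longrightarrow> same_obj y y' \<Longrightarrow> same_obj (TenO \<A> x y) (TenO \<A> x' y')"
  by (simp add: same_obj_def gauging_simps)

lemma same_obj_refl: "same_obj x x"
  by (simp add: same_obj_def)

lemma unitors_Mor:
  assumes x: "x \<in> Ob \<A>" and e: "same_obj (Unt \<A>) e"
  shows "lun D (fst x) \<in> Mor \<A> (TenO \<A> e x) x" and "run D (fst x) \<in> Mor \<A> (TenO \<A> x e) x"
proof -
  have eq: "fst e = unitO D" "snd e g = idm (unitO D)" if "g \<in> carrier G" for g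
    using e that by (auto simp: same_obj_def gauging_simps)
  have fst_e: "fst e = unitO D" using eq(1)[OF one_closed] .
  have X: "equivariant G D (fst x) (snd x)" using x by (simp add: Ob_iff)
  show "lun D (fst x) \<in> Mor \<A> (TenO \<A> e x) x"
    unfolding Mor_iff using unitors_equivariant(1)[OF grp sph act X]
    by (simp add: gauging_simps fst_e eq) (simp add: lun_def mat_homs)
  show "run D (fst x) \<in> Mor \<A> (TenO \<A> x e) x"
    unfolding Mor_iff using unitors_equivariant(2)[OF grp sph act X]
    by (simp add: gauging_simps fst_e eq) (simp add: run_def mat_homs)
qed

text \<open>Lets any representative \<open>e\<close> of the unit replace \<open>Unt\<close>, with
  \<open>J0\<close> corrected by the comparison of the two. Naturality of \<open>J\<close> in the
  unit argument carries the unit axioms over.\<close>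

lemma change_unit:
  assumes x: "x \<in> Ob \<A>" and e: "same_obj (Unt \<A>) e"
  defines "I \<equiv> Fm (Unt \<A>) e (idm (unitO D)) \<star> J0"
  shows "is_iso (unitO M) (Fo e) I"
    and "Fm (TenO \<A> e x) x (lun D (fst x)) \<star> J e x \<star> (I \<boxtimes>\<^bsub>M\<^esub> idm (Fo x)) = lun M (Fo x)"
    and "Fm (TenO \<A> x e) x (run D (fst x)) \<star> J x e \<star> (idm (Fo x) \<boxtimes>\<^bsub>M\<^esub> I) = run M (Fo x)"
proof -
  let ?u = "Unt \<A>" and ?K = "Fm (Unt \<A>) e (idm (unitO D))"
  have u: "?u \<in> Ob \<A>" by (rule Unt_closed)
  then have eO: "e \<in> Ob \<A>" using e same_obj_Ob by blast
  note fin_M = spherical_finite[OF sph_M]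
  have Fo: "Fo x \<in> objs M" "Fo e \<in> objs M" "Fo ?u \<in> objs M" "unitO M \<in> objs M"
    using Fo_objs x eO u unitO_objs[OF spherical_vac[OF sph_M]] by auto
  have id_ue: "idm (unitO D) \<in> Mor \<A> ?u e" using idm_Mor[OF e u] by (simp add: gauging_simps)
  have id_x: "idm (fst x) \<in> Mor \<A> x x" by (rule idm_Mor[OF same_obj_refl x])
  have K: "is_iso (Fo ?u) (Fo e) ?K" using Fm_same_obj_iso[OF e u] by (simp add: gauging_simps)
  have J0: "is_iso (unitO M) (Fo ?u) J0" using J0_iso by (simp add: gauging_simps)
  note Kh = is_iso_homs[OF K] and J0h = is_iso_homs[OF J0]
  show "is_iso (unitO M) (Fo e) I"
    unfolding I_def using Fo by (intro is_iso_cmp[OF J0 K] objs_fin)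
  have TO: "TenO \<A> ?u x \<in> Ob \<A>" "TenO \<A> e x \<in> Ob \<A>" "TenO \<A> x ?u \<in> Ob \<A>" "TenO \<A> x e \<in> Ob \<A>"
    using TenO_closed x u eO by auto
  note lr = unitors_Mor[OF x e]
  have fins: "fin_obj (Fo ?u \<boxdot>\<^bsub>M\<^esub> Fo x)" "fin_obj (Fo e \<boxdot>\<^bsub>M\<^esub> Fo x)" "fin_obj (Fo x \<boxdot>\<^bsub>M\<^esub> Fo ?u)"
    "fin_obj (Fo x \<boxdot>\<^bsub>M\<^esub> Fo e)" "fin_obj (Fo (TenO \<A> ?u x))" "fin_obj (Fo (TenO \<A> e x))"
    "fin_obj (Fo (TenO \<A> x ?u))" "fin_obj (Fo (TenO \<A> x e))"
    using Fo TO Fo_objs by (blast intro: objs_fin tenO_objs[OF fin_M])+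
  have Jh: "J ?u x \<in> homs (Fo ?u \<boxdot>\<^bsub>M\<^esub> Fo x) (Fo (TenO \<A> ?u x))" "J e x \<in> homs (Fo e \<boxdot>\<^bsub>M\<^esub> Fo x) (Fo (TenO \<A> e x))"
    "J x ?u \<in> homs (Fo x \<boxdot>\<^bsub>M\<^esub> Fo ?u) (Fo (TenO \<A> x ?u))" "J x e \<in> homs (Fo x \<boxdot>\<^bsub>M\<^esub> Fo e) (Fo (TenO \<A> x e))"
    using J_iso x u eO is_iso_homs by blast+

  \<comment> \<open>An identity matrix, read as a morphism that exchanges the representative of the
    unit inside the tensor product; its image under \<open>Fm\<close> need not be an
    identity.\<close>
  let ?N = "idm (fst (TenO \<A> ?u x))"
  have N: "?N \<in> Mor \<A> (TenO \<A> ?u x) (TenO \<A> e x)"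
    by (rule idm_Mor[OF same_obj_TenO[OF e same_obj_refl] TO(1)])
  have N_eq: "idm (unitO D) \<boxtimes>\<^bsub>D\<^esub> idm (fst x) = ?N" by (simp add: tenM_idm gauging_simps)
  have lun_N: "lun D (fst x) \<star> ?N = lun D (fst x)"
    by (rule cmp_idm_right[of _ _ "fst x"]) (simp add: lun_def mat_homs gauging_simps)
  let ?L = "Fm (TenO \<A> e x) x (lun D (fst x))" and ?FN = "Fm (TenO \<A> ?u x) (TenO \<A> e x) ?N"
  have "I \<boxtimes>\<^bsub>M\<^esub> idm (Fo x) = (?K \<boxtimes>\<^bsub>M\<^esub> idm (Fo x)) \<star> (J0 \<boxtimes>\<^bsub>M\<^esub> idm (Fo x))"
    unfolding I_def using tenM_cmp[OF fin_M J0h idm_homs Fo(3,1)] cmp_idm_right[OF idm_homs] by metis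
  then have "J e x \<star> (I \<boxtimes>\<^bsub>M\<^esub> idm (Fo x)) = (J e x \<star> (?K \<boxtimes>\<^bsub>M\<^esub> idm (Fo x))) \<star> (J0 \<boxtimes>\<^bsub>M\<^esub> idm (Fo x))"
    using cmp_assoc[OF tenM_homs[OF J0h idm_homs] tenM_homs[OF Kh idm_homs] fins(1,2)] by simp
  moreover have "J e x \<star> (?K \<boxtimes>\<^bsub>M\<^esub> idm (Fo x)) = ?FN \<star> J ?u x"
    using J_natural[OF u x eO x id_ue id_x] by (simp add: Fm_idm[OF x] N_eq)
  moreover have "(?FN \<star> J ?u x) \<star> (J0 \<boxtimes>\<^bsub>M\<^esub> idm (Fo x)) = ?FN \<star> J ?u x \<star> (J0 \<boxtimes>\<^bsub>M\<^esub> idm (Fo x))"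
    by (rule cmp_assoc[OF tenM_homs[OF J0h idm_homs] Jh(1) fins(1,5)])
  ultimately have "?L \<star> J e x \<star> (I \<boxtimes>\<^bsub>M\<^esub> idm (Fo x)) = ?L \<star> ?FN \<star> J ?u x \<star> (J0 \<boxtimes>\<^bsub>M\<^esub> idm (Fo x))"
    by (simp only:)
  also have "\<dots> = (?L \<star> ?FN) \<star> J ?u x \<star> (J0 \<boxtimes>\<^bsub>M\<^esub> idm (Fo x))"
    by (rule cmp_assoc[symmetric, OF cmp_homs[OF tenM_homs[OF J0h idm_homs] Jh(1)] Fm_homs[OF TO(1,2) N] fins(5,6)])
  \<comment> \<open>Functoriality merges the two images, and composing with an identity matrix
    leaves \<open>lun\<close> as it was.\<close>
  also have "?L \<star> ?FN = Fm (TenO \<A> ?u x) x (lun D (fst x))"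
    using Fm_cmp[OF TO(1,2) x N lr(1)] by (simp add: lun_N)
  finally show "?L \<star> J e x \<star> (I \<boxtimes>\<^bsub>M\<^esub> idm (Fo x)) = lun M (Fo x)" using J_lun[OF x] by simp

  let ?N = "idm (fst (TenO \<A> x ?u))"
  have N: "?N \<in> Mor \<A> (TenO \<A> x ?u) (TenO \<A> x e)"
    by (rule idm_Mor[OF same_obj_TenO[OF same_obj_refl e] TO(3)])
  have N_eq: "idm (fst x) \<boxtimes>\<^bsub>D\<^esub> idm (unitO D) = ?N" by (simp add: tenM_idm gauging_simps)
  have run_N: "run D (fst x) \<star> ?N = run D (fst x)"
    by (rule cmp_idm_right[of _ _ "fst x"]) (simp add: run_def mat_homs gauging_simps)
  let ?L = "Fm (TenO \<A> x e) x (run D (fst x))" and ?FN = "Fm (TenO \<A> x ?u) (TenO \<A> x e) ?N"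
  have "idm (Fo x) \<boxtimes>\<^bsub>M\<^esub> I = (idm (Fo x) \<boxtimes>\<^bsub>M\<^esub> ?K) \<star> (idm (Fo x) \<boxtimes>\<^bsub>M\<^esub> J0)"
    unfolding I_def using tenM_cmp[OF fin_M idm_homs J0h Fo(1,3)] cmp_idm_right[OF idm_homs] by metis
  then have "J x e \<star> (idm (Fo x) \<boxtimes>\<^bsub>M\<^esub> I) = (J x e \<star> (idm (Fo x) \<boxtimes>\<^bsub>M\<^esub> ?K)) \<star> (idm (Fo x) \<boxtimes>\<^bsub>M\<^esub> J0)"
    using cmp_assoc[OF tenM_homs[OF idm_homs J0h] tenM_homs[OF idm_homs Kh] fins(3,4)] by simp
  moreover have "J x e \<star> (idm (Fo x) \<boxtimes>\<^bsub>M\<^esub> ?K) = ?FN \<star> J x ?u"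
    using J_natural[OF x u x eO id_x id_ue] by (simp add: Fm_idm[OF x] N_eq)
  moreover have "(?FN \<star> J x ?u) \<star> (idm (Fo x) \<boxtimes>\<^bsub>M\<^esub> J0) = ?FN \<star> J x ?u \<star> (idm (Fo x) \<boxtimes>\<^bsub>M\<^esub> J0)"
    by (rule cmp_assoc[OF tenM_homs[OF idm_homs J0h] Jh(3) fins(3,7)])
  ultimately have "?L \<star> J x e \<star> (idm (Fo x) \<boxtimes>\<^bsub>M\<^esub> I) = ?L \<star> ?FN \<star> J x ?u \<star> (idm (Fo x) \<boxtimes>\<^bsub>M\<^esub> J0)"
    by (simp only:)
  also have "\<dots> = (?L \<star> ?FN) \<star> J x ?u \<star> (idm (Fo x) \<boxtimes>\<^bsub>M\<^esub> J0)"
    by (rule cmp_assoc[symmetric, OF cmp_homs[OF tenM_homs[OF idm_homs J0h] Jh(3)] Fm_homs[OF TO(3,4) N] fins(7,8)])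
  also have "?L \<star> ?FN = Fm (TenO \<A> x ?u) x (run D (fst x))"
    using Fm_cmp[OF TO(3,4) x N lr(2)] by (simp add: run_N)
  finally show "?L \<star> J x e \<star> (idm (Fo x) \<boxtimes>\<^bsub>M\<^esub> I) = run M (Fo x)" using J_run[OF x] by simp
qed

end

text \<open>Each coherence axiom is \<open>S\<close> applied to the same axiom of the given
  equivalence at the images under \<open>P\<close>. Only essential surjectivity and the unit require
  a change of representative.\<close>

lemma (in gauged_extension) conjugate_equivalence:
  assumes aut: "field_automorphism \<sigma>"
    and agree: "\<And>x. x \<in> crossed_entries G D \<Longrightarrow> \<sigma> x = q x"
  shows "gauging G (galois_crossed q D) \<cong>\<^sub>r mtc_cat (galois_mtc \<sigma> M)"
proof -
  define D' where "D' = galois_crossed q D"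
  define M' where "M' = galois_mtc \<sigma> M"
  define S :: "'b mor \<Rightarrow> 'b mor" where "S = conj_mor \<sigma>"
  define T :: "'a mor \<Rightarrow> 'a mor" where "T = conj_mor (inv_into UNIV \<sigma>)"
  \<comment> \<open>The value 0 off the carrier makes \<open>P\<close> commute strictly with tensor products, although \<open>q\<close> and
    \<open>\<sigma>\<close> may disagree there; only the unit is then not preserved strictly.\<close>
  define P where "P x = (fst x, \<lambda>g. if g \<in> carrier G then T (snd x g) else (\<lambda>_ _ _. 0))"
    for x :: "'a obj \<times> ('g \<Rightarrow> 'a mor)"
  let ?A' = "gauging G D'"
  note autT = field_automorphism_inv[OF aut]
  have rel: "galois_related \<sigma> D D'"
    unfolding D'_def by (rule galois_related_crossed[OF aut agree grp sph act])
  have relM: "galois_related \<sigma> M M'" unfolding M'_def by (rule galois_related_mtc)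
  note D' = galois_related_structure[OF aut rel] galois_crossed_act[OF aut agree grp sph act, folded D'_def]
  note M' = galois_related_structure[OF aut relM]

  have T_conj: "T (conj_mor \<sigma> f) = f" and conj_T: "conj_mor \<sigma> (T f) = f" for f
    unfolding T_def by (rule conj_mor_inv[OF aut])+
  have T_cmp: "T (g \<star> f) = T g \<star> T f" for f g unfolding T_def by (rule conj_mor_cmp[OF autT])
  have T_tenM: "T (f \<boxtimes>\<^bsub>D\<^esub> g) = T f \<boxtimes>\<^bsub>D\<^esub> T g" for f g unfolding T_def by (rule conj_mor_tenM[OF autT])
  have T_idm: "T (idm X) = idm X" for X unfolding T_def by (rule conj_mor_idm[OF autT])
  have T_addm: "T (addm f g) = addm (T f) (T g)" for f g unfolding T_def by (rule conj_mor_addm[OF autT])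
  have T_sclm: "T (sclm z f) = sclm (inv_into UNIV \<sigma> z) (T f)" for z f unfolding T_def by (rule conj_mor_sclm[OF autT])
  have T_homs: "T f \<in> homs X Y \<longleftrightarrow> f \<in> homs X Y" for f X Y unfolding T_def by (rule conj_mor_homs[OF autT])
  have T_eq_iff: "T f = T g \<longleftrightarrow> f = g" for f g unfolding T_def by (rule conj_mor_eq_iff[OF autT])
  have T_actM: "T (actM G D g f) = actM G D g (T f)" for g f
    by (simp add: T_def conj_mor_def actM_def aut_zero[OF autT] fun_eq_iff)
  \<comment> \<open>Morphisms for \<open>D'\<close> are the conjugates of those for
    \<open>D\<close>, and \<open>T\<close>, conjugation by the inverse automorphism, takes them
    back; the facts below follow the same pattern.\<close>
  have T_asc: "T (asc D' X Y Z) = asc D X Y Z" if "X \<in> objs D" "Y \<in> objs D" "Z \<in> objs D" for X Y Z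
    using T_conj[of "asc D X Y Z"] by (simp add: conj_asc[OF aut rel that])
  have T_lun: "T (lun D X) = lun D X" "T (run D X) = run D X" for X
    using T_conj[of "lun D X"] T_conj[of "run D X"] by (simp_all add: conj_lun[OF aut rel] conj_run[OF aut rel])
  have T_act_ten: "T (act_ten G D' g X Y) = act_ten G D g X Y" if "g \<in> carrier G" "X \<in> objs D" "Y \<in> objs D" for g X Y
    using T_conj[of "act_ten G D g X Y"] by (simp add: conj_act_ten[OF aut agree grp sph act that] D'_def)
  have T_brd: "T (eq_brd G D' X Y v) = eq_brd G D X Y (\<lambda>g. T (v g))" if "X \<in> objs D" "Y \<in> objs D" for X Y v
    using T_conj[of "eq_brd G D X Y (\<lambda>g. T (v g))"]
    by (simp add: conj_eq_brd[OF aut agree grp sph act that] D'_def conj_T)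
  have T_twist: "T (twist D' X c) = twist D X (T c)" if "X \<in> objs D" for X c
    using T_conj[of "twist D X (T c)"] by (simp add: conj_twist[OF aut rel sph that] conj_T)

  have P_fst: "fst (P x) = fst x" for x by (simp add: P_def)
  have P_snd: "snd (P x) g = T (snd x g)" if "g \<in> carrier G" for x g using that by (simp add: P_def)

  have A'_simps: "Cmp ?A' = cmp" "Ide ?A' x = idm (fst x)" "Add ?A' = addm" "Scl ?A' = sclm" "TenM ?A' = tenM D"
    "TenO ?A' x y = (fst x \<boxdot>\<^bsub>D\<^esub> fst y, \<lambda>g. (snd x g \<boxtimes>\<^bsub>D\<^esub> snd y g) \<star> act_ten G D' g (fst x) (fst y))"
    "Unt ?A' = (unitO D, \<lambda>g. idm (unitO D))" "Asc ?A' x y z = asc D' (fst x) (fst y) (fst z)"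
    "Lun ?A' x = lun D (fst x)" "Run ?A' x = run D (fst x)"
    "Brd ?A' x y = eq_brd G D' (fst x) (fst y) (snd y)"
    "Twi ?A' x = twist D' (fst x) (eq_brd G D' (fst x) (fst x) (snd x))" for x y z
    by (simp_all add: gauging_def split_def D')
  have Ob': "x \<in> Ob ?A' \<longleftrightarrow> equivariant G D' (fst x) (snd x)" for x
    by (simp add: gauging_def split_def)
  have Mor': "f \<in> Mor ?A' x y \<longleftrightarrow>
    f \<in> homs (fst x) (fst y) \<and> (\<forall>g\<in>carrier G. snd y g \<star> actM G D g f = f \<star> snd x g)" for f x y
    by (simp add: gauging_def split_def D')
  have P_Ob: "P x \<in> Ob \<A> \<longleftrightarrow> x \<in> Ob ?A'" for x
  proof -
    have "P x \<in> Ob \<A> \<longleftrightarrow> equivariant G D (fst x) (\<lambda>g. T (snd x g))"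
      unfolding Ob_iff P_fst by (rule equivariant_cong[OF grp]) (simp add: P_snd)
    also have "\<dots> \<longleftrightarrow> equivariant G D' (fst x) (snd x)"
      using conj_equivariant[OF aut agree grp sph act, of "fst x" "\<lambda>g. T (snd x g)"]
      by (simp add: conj_T D'_def)
    finally show ?thesis by (simp add: Ob')
  qed
  have objs: "fst x \<in> objs D" if "x \<in> Ob ?A'" for x
    using objs_of_Ob[of "P x"] that by (simp add: P_Ob P_fst)
  \<comment> \<open>The intertwining identity for \<open>T f\<close> is \<open>T\<close> applied to
    the one for \<open>f\<close>, and \<open>T\<close> is injective.\<close>
  have P_Mor: "T f \<in> Mor \<A> (P x) (P y) \<longleftrightarrow> f \<in> Mor ?A' x y" for f x y
    unfolding Mor_iff Mor' P_fst T_homs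
    by (simp add: P_snd T_eq_iff flip: T_cmp T_actM)
  have T_bij: "bij_betw T (Mor ?A' x y) (Mor \<A> (P x) (P y))" for x y
    by (rule bij_betw_byWitness[of _ "conj_mor \<sigma>"])
      (auto simp: T_conj conj_T P_Mor simp flip: P_Mor)
  have P_TenO: "P (TenO ?A' x y) = TenO \<A> (P x) (P y)" if "x \<in> Ob ?A'" "y \<in> Ob ?A'" for x y
  proof -
    \<comment> \<open>Off the carrier the tensor product of two images under \<open>P\<close> has
      the zero matrix as structure, which is also what \<open>P\<close> puts there.\<close>
    have "(\<lambda>_ _ _. 0) \<boxtimes>\<^bsub>D\<^esub> (\<lambda>_ _ _. 0) = (\<lambda>_ _ _. 0)"
      by (auto simp: tenM_def fun_eq_iff split: tree.splits)
    then have "(\<lambda>_ _ _. 0) \<boxtimes>\<^bsub>D\<^esub> (\<lambda>_ _ _. 0) \<star> f = (\<lambda>_ _ _. 0)" for f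
      by (simp add: cmp_def)
    then show ?thesis
      by (simp add: gauging_simps A'_simps P_def fun_eq_iff T_cmp T_tenM T_act_ten objs that)
  qed

  have S_cmp: "S (g \<star> f) = S g \<star> S f" for f g unfolding S_def by (rule conj_mor_cmp[OF aut])
  have S_tenM: "S (f \<boxtimes>\<^bsub>M\<^esub> g) = S f \<boxtimes>\<^bsub>M\<^esub> S g" for f g unfolding S_def by (rule conj_mor_tenM[OF aut])
  have S_idm: "S (idm X) = idm X" for X unfolding S_def by (rule conj_mor_idm[OF aut])
  have S_addm: "S (addm f g) = addm (S f) (S g)" for f g unfolding S_def by (rule conj_mor_addm[OF aut])
  have S_sclm: "S (sclm z f) = sclm (\<sigma> z) (S f)" for z f unfolding S_def by (rule conj_mor_sclm[OF aut])
  have S_iso: "is_iso X Y (S f) \<longleftrightarrow> is_iso X Y f" for X Y f unfolding S_def by (rule is_iso_conj_mor[OF aut])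
  have S_lun: "S (lun M X) = lun M X" "S (run M X) = run M X" for X
    unfolding S_def by (rule conj_lun[OF aut relM] conj_run[OF aut relM])+
  have S_asc: "S (asc M X Y Z) = asc M' X Y Z" if "X \<in> objs M" "Y \<in> objs M" "Z \<in> objs M" for X Y Z
    unfolding S_def by (rule conj_asc[OF aut relM that])
  have S_brd: "S (brd M X Y) = brd M' X Y" for X Y
    unfolding S_def brd_def conj_mor_mat[OF aut] M'
    by (rule mat_cong) (simp add: conj_mor_def M'_def galois_mtc_def aut_zero[OF aut] split: tree.splits)
  have S_twist: "S (twist M X c) = twist M' X (S c)" if "X \<in> objs M" for X c
    unfolding S_def by (rule conj_twist[OF aut relM sph_M that])
  have S_bij: "bij_betw S (homs X Y) (homs X Y)" for X Y
    unfolding S_def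
    by (rule bij_betw_byWitness[of _ "conj_mor (inv_into UNIV \<sigma>)"])
      (auto simp: conj_mor_inv[OF aut] conj_mor_homs[OF aut] conj_mor_homs[OF autT])

  have PO: "x \<in> Ob ?A' \<Longrightarrow> P x \<in> Ob \<A>" for x by (simp add: P_Ob)

  define e where "e = P (Unt ?A')"
  have e: "same_obj (Unt \<A>) e"
    by (simp add: same_obj_def e_def P_def A'_simps gauging_simps T_idm)

  define Fo' where "Fo' x = Fo (P x)" for x
  define Fm' where "Fm' x y f = S (Fm (P x) (P y) (T f))" for x y f
  define J' where "J' x y = S (J (P x) (P y))" for x y
  define J0' where "J0' = S (Fm (Unt \<A>) e (idm (unitO D)) \<star> J0)"
  have "ribbon_equivalence ?A' (mtc_cat M') Fo' Fm' J' J0'"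
    unfolding ribbon_equivalence_def mtc_simps A'_simps(1-5,7-12) iso_in_mtc_cat M'
  proof (intro conjI ballI allI)
    fix x assume x: "x \<in> Ob ?A'"
    show "Fo' x \<in> objs M" unfolding Fo'_def by (intro Fo_objs PO x)
  next
    fix x y assume "x \<in> Ob ?A'" "y \<in> Ob ?A'"
    then have "bij_betw (Fm (P x) (P y)) (Mor \<A> (P x) (P y)) (homs (Fo' x) (Fo' y))"
      unfolding Fo'_def by (intro Fm_bij PO)
    from bij_betw_trans[OF bij_betw_trans[OF T_bij this] S_bij]
    show "bij_betw (Fm' x y) (Mor ?A' x y) (homs (Fo' x) (Fo' y))"
      by (simp add: Fm'_def[abs_def] comp_def)
  next
    fix Q assume "Q \<in> objs M"
    then obtain x f where x: "x \<in> Ob \<A>" and f: "is_iso (Fo x) Q f" using Fo_surj by blast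
    \<comment> \<open>Conjugating the structure gives a preimage only up to values off the carrier:
      \<open>P x'\<close> and \<open>x\<close> are two representatives of one object, whence the
      comparison isomorphism below.\<close>
    define x' where "x' = (fst x, \<lambda>g. conj_mor \<sigma> (snd x g))"
    have same: "same_obj (P x') x" by (simp add: same_obj_def P_def x'_def T_conj)
    then have Px': "P x' \<in> Ob \<A>" using same_obj_Ob x by blast
    have "is_iso (Fo (P x')) Q (f \<star> Fm (P x') x (idm (fst (P x'))))"
      using Px' x \<open>Q \<in> objs M\<close> Fo_objs
      by (intro is_iso_cmp[OF Fm_same_obj_iso[OF same Px'] f]) (blast intro: objs_fin)+
    then have "is_iso (Fo' x') Q (S (f \<star> Fm (P x') x (idm (fst (P x')))))"
      by (simp add: S_iso Fo'_def)
    moreover have "x' \<in> Ob ?A'" using Px' by (simp add: P_Ob)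
    ultimately show "\<exists>x\<in>Ob ?A'. \<exists>f. is_iso (Fo' x) Q f" by blast
  next
    fix x assume x: "x \<in> Ob ?A'"
    show "Fm' x x (idm (fst x)) = idm (Fo' x)"
      using Fm_idm[OF PO[OF x]] by (simp add: Fm'_def Fo'_def T_idm S_idm P_fst)
  next
    fix x y z f g assume "x \<in> Ob ?A'" "y \<in> Ob ?A'" "z \<in> Ob ?A'" "f \<in> Mor ?A' x y" "g \<in> Mor ?A' y z"
    then show "Fm' x z (g \<star> f) = Fm' y z g \<star> Fm' x y f"
      by (simp add: Fm'_def T_cmp Fm_cmp[of _ "P y"] PO P_Mor flip: S_cmp)
  next
    fix x y f g assume "x \<in> Ob ?A'" "y \<in> Ob ?A'" "f \<in> Mor ?A' x y" "g \<in> Mor ?A' x y"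
    then show "Fm' x y (addm f g) = addm (Fm' x y f) (Fm' x y g)"
      by (simp add: Fm'_def T_addm Fm_addm PO P_Mor flip: S_addm)
  next
    fix x y f z assume "x \<in> Ob ?A'" "y \<in> Ob ?A'" "f \<in> Mor ?A' x y"
    \<comment> \<open>\<open>T\<close> replaces \<open>z\<close> by its preimage under \<sigma>, the
      given equivalence is linear, and \<open>S\<close> restores \<open>z\<close>.\<close>
    then show "Fm' x y (sclm z f) = sclm z (Fm' x y f)"
      by (simp add: Fm'_def T_sclm Fm_sclm PO P_Mor S_sclm aut_inv[OF aut])
  next
    show "is_iso (unitO M) (Fo' (unitO D, \<lambda>g. idm (unitO D))) J0'"
      using change_unit(1)[OF Unt_closed e] by (simp add: J0'_def S_iso Fo'_def e_def A'_simps)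
  next
    fix x y assume "x \<in> Ob ?A'" "y \<in> Ob ?A'"
    then show "is_iso (Fo' x \<boxdot>\<^bsub>M\<^esub> Fo' y) (Fo' (TenO ?A' x y)) (J' x y)"
      using J_iso by (simp add: J'_def Fo'_def S_iso P_TenO PO)
  next
    fix x y x' y' f g assume xy: "x \<in> Ob ?A'" "y \<in> Ob ?A'" "x' \<in> Ob ?A'" "y' \<in> Ob ?A'"
      "f \<in> Mor ?A' x x'" "g \<in> Mor ?A' y y'"
    then show "Fm' (TenO ?A' x y) (TenO ?A' x' y') (f \<boxtimes>\<^bsub>D\<^esub> g) \<star> J' x y =
        J' x' y' \<star> Fm' x x' f \<boxtimes>\<^bsub>M\<^esub> Fm' y y' g"
      by (simp add: Fm'_def J'_def P_TenO T_tenM J_natural PO P_Mor flip: S_cmp S_tenM)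
  next
    fix x y z assume xyz: "x \<in> Ob ?A'" "y \<in> Ob ?A'" "z \<in> Ob ?A'"
    then have "TenO ?A' x y \<in> Ob ?A'" "TenO ?A' y z \<in> Ob ?A'"
      using TenO_closed by (simp_all add: P_TenO flip: P_Ob)
    then show "Fm' (TenO ?A' (TenO ?A' x y) z) (TenO ?A' x (TenO ?A' y z)) (asc D' (fst x) (fst y) (fst z))
          \<star> J' (TenO ?A' x y) z \<star> J' x y \<boxtimes>\<^bsub>M\<^esub> idm (Fo' z) =
        J' x (TenO ?A' y z) \<star> idm (Fo' x) \<boxtimes>\<^bsub>M\<^esub> J' y z \<star> asc M' (Fo' x) (Fo' y) (Fo' z)"
      using arg_cong[OF J_asc[OF PO PO PO, OF xyz], of S] xyz
      by (simp add: Fm'_def J'_def Fo'_def P_TenO T_asc objs P_fst S_cmp S_tenM S_idm S_asc Fo_objs PO)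
  next
    fix x assume x: "x \<in> Ob ?A'"
    have PT: "P (TenO ?A' (Unt ?A') x) = TenO \<A> e (P x)" "P (TenO ?A' x (Unt ?A')) = TenO \<A> (P x) e"
      unfolding e_def using Unt_closed same_obj_Ob[OF e] by (intro P_TenO x; simp add: e_def P_Ob)+
    show "Fm' (TenO ?A' (unitO D, \<lambda>g. idm (unitO D)) x) x (lun D (fst x)) \<star>
        J' (unitO D, \<lambda>g. idm (unitO D)) x \<star> J0' \<boxtimes>\<^bsub>M\<^esub> idm (Fo' x) = lun M (Fo' x)"
      and "Fm' (TenO ?A' x (unitO D, \<lambda>g. idm (unitO D))) x (run D (fst x)) \<star>
        J' x (unitO D, \<lambda>g. idm (unitO D)) \<star> idm (Fo' x) \<boxtimes>\<^bsub>M\<^esub> J0' = run M (Fo' x)"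
      using arg_cong[OF change_unit(2)[OF PO[OF x] e], of S] arg_cong[OF change_unit(3)[OF PO[OF x] e], of S]
      unfolding Fm'_def Fo'_def J'_def J0'_def PT[unfolded A'_simps(7)] e_def[unfolded A'_simps(7), symmetric]
      by (simp_all add: T_lun S_lun S_cmp S_tenM S_idm P_fst)
  next
    fix x y assume xy: "x \<in> Ob ?A'" "y \<in> Ob ?A'"
    \<comment> \<open>\<open>T\<close> applied to the structure of \<open>y\<close> and the
      structure of \<open>P y\<close> agree on the carrier, and the braiding uses nothing
      else.\<close>
    have "eq_brd G D (fst x) (fst y) (\<lambda>g. T (snd y g)) = eq_brd G D (fst x) (fst y) (snd (P y))"
      by (rule eq_brd_cong) (simp add: P_snd)
    then show "Fm' (TenO ?A' x y) (TenO ?A' y x) (eq_brd G D' (fst x) (fst y) (snd y)) \<star> J' x y =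
        J' y x \<star> brd M' (Fo' x) (Fo' y)"
      using arg_cong[OF J_brd[OF PO PO, OF xy], of S] xy
      by (simp add: Fm'_def J'_def Fo'_def P_TenO T_brd objs P_fst S_cmp S_brd)
  next
    fix x assume x: "x \<in> Ob ?A'"
    have "eq_brd G D (fst x) (fst x) (\<lambda>g. T (snd x g)) = eq_brd G D (fst x) (fst x) (snd (P x))"
      by (rule eq_brd_cong) (simp add: P_snd)
    then show "Fm' x x (twist D' (fst x) (eq_brd G D' (fst x) (fst x) (snd x))) =
        twist M' (Fo' x) (brd M' (Fo' x) (Fo' x))"
      using arg_cong[OF Fm_twist[OF PO[OF x]], of S] x
      by (simp add: Fm'_def Fo'_def T_twist T_brd objs P_fst S_twist S_brd Fo_objs PO)
  qed
  then show ?thesis unfolding ribbon_equivalent_def D'_def M'_def by blast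
qed


theorem theorem4p8:
  fixes G :: "'g monoid"
    and C :: "'c mtc_data"
    and D :: "('a, 'g) crossed_data"
    and M :: "'b mtc_data"
  assumes "group G" and "finite (carrier G)"
    and "modular C"
    and "crossed_extension G C D"
    and "number_field (crossed_field G D)"
    and "modular M"
    and "gauging G D \<cong>\<^sub>r mtc_cat M"
    and "number_field (mtc_field M)"
    and "q \<in> Gal (normal_closure (crossed_field G D))"
  shows "\<exists>q' \<in> Gal (normal_closure (mtc_field M)).
    gauging G (galois_crossed q D) \<cong>\<^sub>r mtc_cat (galois_mtc q' M)"
proof -
  obtain \<sigma> where aut: "field_automorphism \<sigma>"
    and ext: "\<And>x. x \<in> normal_closure (crossed_field G D) \<Longrightarrow> \<sigma> x = q x"
    by (rule Gal_extends[OF assms(9)]) (use that in blast)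
  \<comment> \<open>The entries lie in the field they generate, hence in its normal closure, where
    \<sigma> is known to extend \<open>q\<close>.\<close>
  have agree: "\<sigma> x = q x" if "x \<in> crossed_entries G D" for x
    using ext normal_closure_incl generate_field.incl[OF that] unfolding crossed_field_def by blast
  obtain Fo Fm J J0 where equiv: "ribbon_equivalence (gauging G D) (mtc_cat M) Fo Fm J J0"
    using assms(7) by (auto simp: ribbon_equivalent_def)
  interpret gauged_extension G D M Fo Fm J J0
    using assms(1,4,6) equiv by (intro gauged_extension.intro) (simp_all add: crossed_extension_def modular_def)
  show ?thesis
    using conjugate_equivalence[OF aut agree] aut_in_Gal[OF aut] by blast
qed

end
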